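(* Let $Q$ be $\mathbb R^n$ or $\mathbb Z^n$, let $Z\in\mathcal Z(Q)$, and let $V,W\in\mathrm{Pers}_{\mathrm{fp}}(Q)$. Then the HN filtered persistence landscapes of $V$ and $W$ along $Z$ satisfy \[\sup_{\theta\in\mathbb R}\big\lVert\lambda_{s^\theta_{Z,V}}-\lambda_{s^\theta_{Z,W}}\big\rVert_\infty\leqslant d_I(V,W).\]
   Context: Persistence modules. Fix a field $\mathbb{F}$. $Q=\mathbb R^n$ or $\mathbb Z^n$ with product order. $\mathrm{Pers}(Q)$ is the category of functors $V\colon Q\to\mathrm{Vect}_{\mathbb F}$ with all $V_q$ finite-dimensional; $\underline{\dim}_V\colon q\mapsto\dim V_q$. $\mathrm{Pers}_{\mathrm{fp}}(Q)$ is the (abelian) full subcategory of discretisable (equivalently finitely presentable) modules, i.e. those isomorphic to a left Kan extension $f_*U$ of some $U\in\mathrm{Pers}(P)$ along an order-preserving map $f\colon P\to Q$ with $P$ finite. Stability. For an abelian category $\mathcal A$, a stability condition is a group homomorphism $Z\colon K(\mathcal A)\to\mathbb C$ sending nonzero objects to $\{\operatorname{Re} z>0\}$. The slope of $V\ne0$ is $\mu_Z(V)=\operatorname{Im}Z([V])/\operatorname{Re}Z([V])$; $V\neq0$ is $Z$-semistable if $\mu_Z(W)\leqslant\mu_Z(V)$ for all nonzero subobjects $W$. An HN filtration of $V\neq0$ is a finite filtration $0=V^0\subsetneq\dots\subsetneq V^\ell=V$ with $Z$-semistable quotients $V^j/V^{j-1}$ of strictly decreasing slopes (unique when it exists). Write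 $\langle V,Z\rangle^\theta:=V^i$ where $\mu_Z(V^i/V^{i-1})\geqslant\theta>\mu_Z(V^{i+1}/V^i)$ (conventions $\mu_Z(V^0/V^{-1})=+\infty$, $\mu_Z(V^{\ell+1}/V^\ell)=-\infty$), and $\langle0,Z\rangle^\theta=0$. A stability condition over $Q$ is one on $\mathrm{Pers}_{\mathrm{fp}}(Q)$. Grid functions. A cube is a product of intervals (order-convex subsets). A grid function is a product $G=G_1\times\dots\times G_n\colon P=P_1\times\dots\times P_n\hookrightarrow Q$ where $P$ is a cube of $\mathbb Z^n$, each $G_i$ is strictly increasing, and $G_i(t)\to\pm\infty$ as $t\to\pm\infty$ if $P_i$ is unbounded in that direction. It is finite if $P$ is. $\lfloor q\rfloor_G=\max\{p: G(p)\leqslant q\}\in P\cup\{-\infty\}$ ($-\infty$ if the set is empty), $\mathrm{cub}_G(p)=\{q:\lfloor q\rfloor_G=p\}$; for $p\in P$ it is a product $\prod_i[a_i,b_i)$, $b_i\leqslant\infty$. A function $a\colon Q\to\mathbb R$ is $G$-discretisable if $a(q)=a'(\lfloor q\rfloor_G)$ for some $a'\colon P\to\mathbb R$ (with $a'(-\infty)=0$). A refinement of $G$ is a grid function $G'$ with $G=G'\circ g$ for some order-preserving $g$; it is an extension if $\operatorname{Im}G=\operatorname{Im}G'\cap c$ for some cube $c$ of $Q$. Integrals are for Lebesgue measure (counting measure for $\mathbb Z^n$). For a nonempty bounded cube $c$, $\delta_c(h)=\int_ch/\int_c1$, the integral being $\dim c$-dimensional, where $\dim c$ is the number of coordinates in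 which the projection of $c$ has nonempty interior ($\delta_{\{x\}}$ is evaluation at $x$). The faces of a bounded $\prod_i[a_i,b_i)$ are the products $\prod J_i$ with $J_i\in\{[a_i,b_i),\{a_i\},\{b_i\}\}$. $\mathcal Z(Q)$. For $G$ a finite grid function, $\mathcal Z^{\mathrm{step}}(G)$ is the set of stability conditions of the form $Z([V])=\int_Q(b+\sqrt{-1}a)\,\underline{\dim}_V$ with $a,b\colon Q\to\mathbb R$ discretisable by an extension of $G$, $a$ null on all unbounded $\mathrm{cub}_G(x)$, $x\in P\cup\{-\infty\}$, and $b$ strictly positive and integrable. $\mathcal Z(G)$ is the set of stability conditions of the form $[V]\mapsto Z([V])+\sqrt{-1}\sum_c\lambda_c\delta_c(\underline{\dim}_V)$ with $Z\in\mathcal Z^{\mathrm{step}}(G)$, the sum over faces $c$ of the bounded cubes $\mathrm{cub}_G(x)$, $x\in P$, and $\lambda_c\geqslant0$. $\mathcal Z(Q)=\bigcup_{G\text{ finite}}\mathcal Z(G)$. For $Z\in\mathcal Z(Q)$, HN filtrations along $Z$ of nonzero modules in $\mathrm{Pers}_{\mathrm{fp}}(Q)$ exist. HN filtered rank invariant and landscape. For $x\in Q$, $(T_x^*V)_y=V_{x+y}$. For $\theta\in\mathbb R$, $s_{Z,V}^\theta\colon Q\times Q\to\mathbb Z_+\cup\{+\infty\}$ is $s_{Z,V}^\theta(x,y)=\operatorname{rank}\big((\langle T_x^*V,Z\rangle^\theta)_{0}\to(\langle T_x^*V,Z\rangle^\theta)_{y-x}\big)$ if $x\leqslant y$, and $+\infty$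 otherwise. For $s\colon Q\times Q\to\mathbb Z_+\cup\{+\infty\}$ the persistence landscape is the function on $\mathbb N\times Q$ given by $\lambda_s(k,x)=\sup\{\varepsilon>0: s(x-h,x+h)\geqslant k\ \text{for all } h\in Q\text{ with }\|h\|_\infty\leqslant\varepsilon\}$, with $\sup\emptyset=0$. The family $(\lambda_{s^\theta_{Z,V}})_\theta$ is the HN filtered persistence landscape of $V$. $\|\cdot\|_\infty$ on functions on $\mathbb N\times Q$ is the supremum norm, values in $[0,+\infty]$ being allowed for landscapes, with the convention $(+\infty)-(+\infty)=0$. Interleaving distance. $\vec\varepsilon=(\varepsilon,\dots,\varepsilon)\in Q$ (so $\varepsilon$ is an integer if $Q=\mathbb Z^n$). An $\varepsilon$-interleaving between $V,W$ is a pair of maps $f\colon V\to T^*_{\vec\varepsilon}W$, $g\colon W\to T^*_{\vec\varepsilon}V$ with $T^*_{\vec\varepsilon}g\circ f$ and $T^*_{\vec\varepsilon}f\circ g$ equal to the maps $V\to T^*_{2\vec\varepsilon}V$, $W\to T^*_{2\vec\varepsilon}W$ given by the internal maps. $d_I(V,W)$ is the infimum of $\varepsilon\geqslant0$ for which an $\varepsilon$-interleaving exists. *)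

theory Defs
  imports "HOL-Analysis.Analysis" "HOL-Algebra.Free_Abelian_Groups"
begin

text \<open>
  The index poset \<open>Q\<close> is \<^typ>\<open>real^'n\<close> or \<^typ>\<open>int^'n\<close>, whose library order is the product
  order. The class below only serves to treat both at once: it adds to the order, the ring structure
  and the topology (discrete on \<^typ>\<open>int\<close>) the measure with respect to which one integrates in
  one coordinate, and the inclusion into the reals.
\<close>

class index_coord = linordered_idom + topological_space +
  fixes coord_measure :: "'a measure"
    and coord_real :: "'a \<Rightarrow> real"

instantiation real :: index_coord
begin
definition coord_measure_real_def: "(coord_measure :: real measure) = lborel"
definition coord_real_real_def: "(coord_real :: real \<Rightarrow> real) = id"
instance ..
end

instantiation int :: index_coord
begin
definition coord_measure_int_def: "(coord_measure :: int measure) = count_space UNIV"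
definition coord_real_int_def: "(coord_real :: int \<Rightarrow> real) = of_int"
instance ..
end


section \<open>Cubes and integrals\<close>

definition ord_convex :: "'a::order set \<Rightarrow> bool" where
  "ord_convex J \<longleftrightarrow> (\<forall>x\<in>J. \<forall>z\<in>J. \<forall>y. x \<le> y \<and> y \<le> z \<longrightarrow> y \<in> J)"

definition prod_cube :: "('n::finite \<Rightarrow> 'a set) \<Rightarrow> ('a^'n) set" where
  "prod_cube J = {q. \<forall>i. q $ i \<in> J i}"

definition is_cube :: "('a::order^'n) set \<Rightarrow> bool" where
  "is_cube c \<longleftrightarrow> (\<exists>J. (\<forall>i. ord_convex (J i)) \<and> c = prod_cube J)"

text \<open>
  The \<open>dim c\<close>-dimensional measure on a nonempty cube \<open>c\<close>. Coordinates in which \<open>c\<close> is degenerate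
  carry the unit point mass; as \<^typ>\<open>int\<close> is discrete, no coordinate of \<^typ>\<open>int^'n\<close> is degenerate.
\<close>

definition side_measure :: "'a::index_coord set \<Rightarrow> 'a measure" where
  "side_measure J = (if interior J \<noteq> {} then restrict_space coord_measure J else count_space J)"

definition cube_measure :: "('a::index_coord^'n) set \<Rightarrow> ('a^'n) measure" where
  "cube_measure c = embed_measure (PiM UNIV (\<lambda>i. side_measure ((\<lambda>q. q $ i) ` c))) vec_lambda"

lemma range_coord: "(\<lambda>q::'a^'n. q $ i) ` UNIV = UNIV"
  by (auto simp: image_def) (metis vec_component vec_def vec_lambda_beta)

lemma side_measure_UNIV: "side_measure (UNIV :: 'a::index_coord set) = coord_measure"
  by (auto simp: side_measure_def emeasure_restrict_space sets_restrict_space space_restrict_space intro!: measure_eqI)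

lemma inj_vec_lambda: "inj vec_lambda"
  by (simp add: inj_on_def vec_lambda_inject)

lemma cube_measure_UNIV_real: "cube_measure (UNIV :: (real^'n) set) = lborel"
proof -
  let ?P = "PiM UNIV (\<lambda>_::'n. lborel :: real measure)"
  let ?M = "embed_measure ?P vec_lambda"
  interpret product_sigma_finite "\<lambda>_::'n. lborel :: real measure"
    by standard
  have eq: "cube_measure (UNIV :: (real^'n) set) = ?M"
    by (simp add: cube_measure_def range_coord side_measure_UNIV coord_measure_real_def)
  have sp: "space ?P = UNIV" by (simp add: space_PiM)
  have meas: "(vec_lambda :: _ \<Rightarrow> real^'n) \<in> borel_measurable ?P"
    by (rule borel_measurable_euclidean_space[THEN iffD2])
      (auto simp: Basis_vec_def inner_axis)
  have meas2: "vec_nth \<in> measurable (borel :: (real^'n) measure) ?P"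
  proof (rule measurable_PiM_single')
    show "(\<lambda>x::real^'n. x $ i) \<in> borel \<rightarrow>\<^sub>M lborel" for i
      by (simp add: borel_measurable_nth)
  qed auto
  have sets: "sets ?M = sets borel"
  proof (rule antisym; rule subsetI)
    fix A assume "A \<in> sets ?M"
    then obtain B where B: "B \<in> sets ?P" "A = vec_lambda ` B"
      by (auto simp: sets_embed_measure[OF inj_vec_lambda])
    have "A = vec_nth -` B \<inter> space borel"
      unfolding B(2) by (auto simp: image_iff) (metis vec_nth_inverse)
    then show "A \<in> sets borel" using measurable_sets[OF meas2 B(1)] by simp
  next
    fix A :: "(real^'n) set" assume A: "A \<in> sets borel"
    have "A = vec_lambda ` (vec_lambda -` A \<inter> space ?P)"
      unfolding sp by (auto simp: image_iff) (metis vec_nth_inverse)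
    then show "A \<in> sets ?M"
      using measurable_sets[OF meas A] by (auto simp: sets_embed_measure[OF inj_vec_lambda])
  qed
  have "lborel = ?M"
  proof (rule lborel_eqI)
    fix l u :: "real^'n" assume lu: "\<And>b. b \<in> Basis \<Longrightarrow> l \<bullet> b \<le> u \<bullet> b"
    have lu': "l $ i \<le> u $ i" for i
      using lu[of "axis i 1", OF axis_in_Basis_iff[THEN iffD2]] by (simp add: inner_axis)
    have "box l u = vec_lambda ` (PiE UNIV (\<lambda>i. {l $ i <..< u $ i}))"
      proof (rule antisym; rule subsetI)
      fix q assume "q \<in> box l u"
      then have "vec_nth q \<in> PiE UNIV (\<lambda>i. {l $ i <..< u $ i})" by (simp add: mem_box_cart PiE_iff)
      then show "q \<in> vec_lambda ` PiE UNIV (\<lambda>i. {l $ i <..< u $ i})"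
        by (rule image_eqI[rotated]) (simp add: vec_nth_inverse)
    qed (auto simp: mem_box_cart PiE_iff)
    then have "emeasure ?M (box l u) = emeasure ?P (PiE UNIV (\<lambda>i. {l $ i <..< u $ i}))"
      by (simp add: emeasure_embed_measure_image[OF inj_vec_lambda])
    also have "\<dots> = (\<Prod>i\<in>UNIV. emeasure lborel {l $ i <..< u $ i})"
      by (subst emeasure_PiM) auto
    also have "\<dots> = ennreal (\<Prod>i\<in>UNIV. u $ i - l $ i)"
      using lu' by (simp add: prod_ennreal)
    also have "(\<Prod>i\<in>UNIV. u $ i - l $ i) = (\<Prod>b\<in>Basis. (u - l) \<bullet> b)"
    proof -
      have B: "(Basis :: (real^'n) set) = (\<lambda>i. axis i 1) ` UNIV"
        by (auto simp: Basis_vec_def)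
      have "inj (\<lambda>i::'n. axis i (1::real))" by (simp add: inj_on_def axis_eq_axis)
      then show ?thesis unfolding B by (simp add: prod.reindex inner_axis)
    qed
    finally show "emeasure ?M (box l u) = (\<Prod>b\<in>Basis. (u - l) \<bullet> b)" by simp
  qed (simp add: sets)
  with eq show ?thesis by simp
qed

lemma cube_measure_UNIV_int: "cube_measure (UNIV :: (int^'n) set) = count_space UNIV"
proof -
  have "PiM UNIV (\<lambda>_::'n. count_space (UNIV::int set)) = count_space (PiE UNIV (\<lambda>_. UNIV))"
    by (rule count_space_PiM_finite) auto
  moreover have "range (vec_lambda :: _ \<Rightarrow> int^'n) = UNIV"
    by (metis surjI vec_nth_inverse)
  ultimately show ?thesis
    by (simp add: cube_measure_def range_coord side_measure_UNIV coord_measure_int_def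
        embed_measure_count_space[OF inj_vec_lambda])
qed

definition cube_mean :: "('a::index_coord^'n) set \<Rightarrow> ('a^'n \<Rightarrow> real) \<Rightarrow> real" where
  "cube_mean c h = (\<integral>q. h q \<partial>cube_measure c) / (\<integral>q. 1 \<partial>cube_measure c)"

definition bounded_cube :: "('a::index_coord^'n) set \<Rightarrow> bool" where
  "bounded_cube c \<longleftrightarrow> bdd_below c \<and> bdd_above c"

definition faces :: "('a::index_coord^'n) set \<Rightarrow> ('a^'n) set set" where
  "faces c = {prod_cube J | J a b. (\<forall>i. a i < b i) \<and> c = prod_cube (\<lambda>i. {a i..<b i}) \<and>
                (\<forall>i. J i \<in> {{a i..<b i}, {a i}, {b i}})}"


section \<open>Grid functions\<close>

text \<open>
  \<open>grid_sides G i\<close> is the interval $P_i$, and \<open>grid_coord G i\<close> is $G_i$, relevant on $P_i$ only.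
  The element \<open>-\<infinity>\<close> adjoined to \<open>P\<close> is \<^const>\<open>None\<close>.
\<close>

record ('a, 'n) grid_fun =
  grid_sides :: "'n \<Rightarrow> int set"
  grid_coord :: "'n \<Rightarrow> int \<Rightarrow> 'a"

definition grid_dom :: "('a, 'n::finite) grid_fun \<Rightarrow> (int^'n) set" where
  "grid_dom G = prod_cube (grid_sides G)"

definition grid_app :: "('a, 'n::finite) grid_fun \<Rightarrow> int^'n \<Rightarrow> 'a^'n" where
  "grid_app G p = (\<chi> i. grid_coord G i (p $ i))"

definition is_grid :: "('a::index_coord, 'n::finite) grid_fun \<Rightarrow> bool" where
  "is_grid G \<longleftrightarrow> (\<forall>i. ord_convex (grid_sides G i) \<and>
     strict_mono_on (grid_sides G i) (grid_coord G i) \<and>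
     (\<not> bdd_above (grid_sides G i) \<longrightarrow> filterlim (grid_coord G i) at_top at_top) \<and>
     (\<not> bdd_below (grid_sides G i) \<longrightarrow> filterlim (grid_coord G i) at_bot at_bot))"

definition finite_grid :: "('a::index_coord, 'n::finite) grid_fun \<Rightarrow> bool" where
  "finite_grid G \<longleftrightarrow> is_grid G \<and> finite (grid_dom G)"

definition grid_floor :: "('a::index_coord, 'n::finite) grid_fun \<Rightarrow> 'a^'n \<Rightarrow> (int^'n) option" where
  "grid_floor G q =
     (if \<exists>p\<in>grid_dom G. grid_app G p \<le> q
      then Some (GREATEST p. p \<in> grid_dom G \<and> grid_app G p \<le> q) else None)"

definition cub :: "('a::index_coord, 'n::finite) grid_fun \<Rightarrow> (int^'n) option \<Rightarrow> ('a^'n) set" where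
  "cub G x = {q. grid_floor G q = x}"

definition discretisable :: "('a::index_coord, 'n::finite) grid_fun \<Rightarrow> ('a^'n \<Rightarrow> real) \<Rightarrow> bool" where
  "discretisable G a \<longleftrightarrow>
     (\<exists>a'. \<forall>q. a q = (case grid_floor G q of None \<Rightarrow> 0 | Some p \<Rightarrow> a' p))"

definition refinement ::
    "('a::index_coord, 'n::finite) grid_fun \<Rightarrow> ('a, 'n) grid_fun \<Rightarrow> bool" where
  "refinement G G' \<longleftrightarrow> is_grid G' \<and>
     (\<exists>g. mono_on (grid_dom G) g \<and> g ` grid_dom G \<subseteq> grid_dom G' \<and>
          (\<forall>p\<in>grid_dom G. grid_app G p = grid_app G' (g p)))"

definition extension ::
    "('a::index_coord, 'n::finite) grid_fun \<Rightarrow> ('a, 'n) grid_fun \<Rightarrow> bool" where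
  "extension G G' \<longleftrightarrow> refinement G G' \<and>
     (\<exists>c. is_cube c \<and> grid_app G ` grid_dom G = grid_app G' ` grid_dom G' \<inter> c)"


section \<open>Persistence modules\<close>

text \<open>
  A poset is given by its order relation \<open>r\<close>, its underlying set being \<^term>\<open>Field r\<close>. A functor
  from it to vector spaces consists of spaces \<open>sp V p\<close>, realised as subspaces of one ambient
  vector space, and of maps \<open>tr V p q\<close> for \<^term>\<open>(p, q) \<in> r\<close>.
\<close>

record ('p, 'v) pmod =
  sp :: "'p \<Rightarrow> 'v set"
  tr :: "'p \<Rightarrow> 'p \<Rightarrow> 'v \<Rightarrow> 'v"

abbreviation index_order :: "'q::order rel" where
  "index_order \<equiv> {(x, y). x \<le> y}"

definition order_preserving :: "'p rel \<Rightarrow> 'q rel \<Rightarrow> ('p \<Rightarrow> 'q) \<Rightarrow> bool" where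
  "order_preserving r r' f \<longleftrightarrow> (\<forall>(p, q) \<in> r. (f p, f q) \<in> r')"

definition pullback :: "('p \<Rightarrow> 'q) \<Rightarrow> ('q, 'v) pmod \<Rightarrow> ('p, 'v) pmod" where
  "pullback f V = \<lparr>sp = (\<lambda>p. sp V (f p)), tr = (\<lambda>p q. tr V (f p) (f q))\<rparr>"

definition shift :: "'q::plus \<Rightarrow> ('q, 'v) pmod \<Rightarrow> ('q, 'v) pmod" where
  "shift x V = pullback (\<lambda>y. x + y) V"

definition zero_pmod :: "('p, 'v::zero) pmod \<Rightarrow> bool" where
  "zero_pmod V \<longleftrightarrow> (\<forall>p. sp V p = {0})"

definition complex_add_group :: "complex monoid" where
  "complex_add_group = \<lparr>carrier = UNIV, monoid.mult = (+), one = 0\<rparr>"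

text \<open>
  The ambient vector space is infinite-dimensional, so that it contains a copy of every
  finite-dimensional one; hence the modules below form a category equivalent to that of all
  persistence modules, but with a set of objects.
\<close>

locale persistence = vector_space scale
  for scale :: "'k::field \<Rightarrow> 'v::ab_group_add \<Rightarrow> 'v" +
  assumes infinite_dimensional: "\<nexists>B. finite B \<and> span B = UNIV"
begin

definition linear_between :: "'v set \<Rightarrow> 'v set \<Rightarrow> ('v \<Rightarrow> 'v) \<Rightarrow> bool" where
  "linear_between S T f \<longleftrightarrow> f ` S \<subseteq> T \<and>
     (\<forall>x\<in>S. \<forall>y\<in>S. f (x + y) = f x + f y) \<and> (\<forall>c. \<forall>x\<in>S. f (scale c x) = scale c (f x))"

definition pers :: "'p rel \<Rightarrow> ('p, 'v) pmod set" where
  "pers r = {V.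
     (\<forall>p\<in>Field r. subspace (sp V p) \<and> (\<exists>B. finite B \<and> span B = sp V p)) \<and>
     (\<forall>(p, q) \<in> r. linear_between (sp V p) (sp V q) (tr V p q)) \<and>
     (\<forall>p\<in>Field r. \<forall>v\<in>sp V p. tr V p p v = v) \<and>
     (\<forall>p q s. (p, q) \<in> r \<and> (q, s) \<in> r \<longrightarrow>
        (\<forall>v\<in>sp V p. tr V q s (tr V p q v) = tr V p s v))}"

definition is_hom ::
    "'p rel \<Rightarrow> ('p, 'v) pmod \<Rightarrow> ('p, 'v) pmod \<Rightarrow> ('p \<Rightarrow> 'v \<Rightarrow> 'v) \<Rightarrow> bool" where
  "is_hom r V W \<phi> \<longleftrightarrow>
     (\<forall>p\<in>Field r. linear_between (sp V p) (sp W p) (\<phi> p)) \<and>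
     (\<forall>(p, q) \<in> r. \<forall>v\<in>sp V p. \<phi> q (tr V p q v) = tr W p q (\<phi> p v))"

text \<open>
  \<open>L\<close> with \<open>\<eta>\<close> is a left Kan extension of \<open>U\<close> along \<open>f\<close>, by its universal property. It determines
  \<open>L\<close> up to isomorphism, so being a left Kan extension is invariant under isomorphism.
\<close>

definition is_left_kan ::
    "'p rel \<Rightarrow> ('p \<Rightarrow> 'q::order) \<Rightarrow> ('p, 'v) pmod \<Rightarrow> ('q, 'v) pmod \<Rightarrow> ('p \<Rightarrow> 'v \<Rightarrow> 'v) \<Rightarrow> bool" where
  "is_left_kan r f U L \<eta> \<longleftrightarrow> is_hom r U (pullback f L) \<eta> \<and>
     (\<forall>X\<in>pers index_order. \<forall>\<alpha>. is_hom r U (pullback f X) \<alpha> \<longrightarrow>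
        (\<exists>\<beta>. is_hom index_order L X \<beta> \<and> (\<forall>p\<in>Field r. \<forall>u\<in>sp U p. \<beta> (f p) (\<eta> p u) = \<alpha> p u) \<and>
          (\<forall>\<beta>'. is_hom index_order L X \<beta>' \<and>
                (\<forall>p\<in>Field r. \<forall>u\<in>sp U p. \<beta>' (f p) (\<eta> p u) = \<alpha> p u) \<longrightarrow>
                (\<forall>q. \<forall>v\<in>sp L q. \<beta>' q v = \<beta> q v))))"

text \<open>Every finite poset is isomorphic to one on a set of natural numbers.\<close>

definition pers_fp :: "('q::order, 'v) pmod set" where
  "pers_fp = {V \<in> pers index_order. \<exists>(r :: nat rel) f U \<eta>.
     Partial_order r \<and> finite (Field r) \<and> order_preserving r index_order f \<and>
     U \<in> pers r \<and> is_left_kan r f U V \<eta>}"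


section \<open>Stability conditions\<close>

text \<open>
  Limits and colimits in \<^const>\<open>pers_fp\<close> are computed pointwise, and so is exactness; a subobject
  is represented by its image, a family \<open>S\<close> of subspaces, the module being \<open>V\<lparr>sp := S\<rparr>\<close>.
\<close>

definition short_exact ::
    "('q::order, 'v) pmod \<Rightarrow> ('q, 'v) pmod \<Rightarrow> ('q, 'v) pmod \<Rightarrow>
     ('q \<Rightarrow> 'v \<Rightarrow> 'v) \<Rightarrow> ('q \<Rightarrow> 'v \<Rightarrow> 'v) \<Rightarrow> bool" where
  "short_exact A B C \<phi> \<psi> \<longleftrightarrow> A \<in> pers_fp \<and> B \<in> pers_fp \<and> C \<in> pers_fp \<and>
     is_hom index_order A B \<phi> \<and> is_hom index_order B C \<psi> \<and>
     (\<forall>q. inj_on (\<phi> q) (sp A q) \<and> \<phi> q ` sp A q = {v \<in> sp B q. \<psi> q v = 0} \<and>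
          \<psi> q ` sp B q = sp C q)"

definition exact_relators :: "(('q::order, 'v) pmod \<Rightarrow>\<^sub>0 int) set" where
  "exact_relators = {frag_of B - frag_of A - frag_of C | A B C. \<exists>\<phi> \<psi>. short_exact A B C \<phi> \<psi>}"

definition K_relations :: "(('q::order, 'v) pmod \<Rightarrow>\<^sub>0 int) set" where
  "K_relations = generate (free_Abelian_group pers_fp) exact_relators"

definition K_group :: "(('q::order, 'v) pmod \<Rightarrow>\<^sub>0 int) set monoid" where
  "K_group = free_Abelian_group pers_fp Mod K_relations"

definition K_class :: "('q::order, 'v) pmod \<Rightarrow> (('q, 'v) pmod \<Rightarrow>\<^sub>0 int) set" where
  "K_class V = K_relations #>\<^bsub>free_Abelian_group pers_fp\<^esub> frag_of V"

definition stability_conditions :: "((('q::order, 'v) pmod \<Rightarrow>\<^sub>0 int) set \<Rightarrow> complex) set" where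
  "stability_conditions = {Z \<in> hom K_group complex_add_group.
     \<forall>V\<in>pers_fp. \<not> zero_pmod V \<longrightarrow> Re (Z (K_class V)) > 0}"

definition slope ::
    "((('q::order, 'v) pmod \<Rightarrow>\<^sub>0 int) set \<Rightarrow> complex) \<Rightarrow> ('q, 'v) pmod \<Rightarrow> real" where
  "slope Z V = Im (Z (K_class V)) / Re (Z (K_class V))"

definition subobject :: "('q::order, 'v) pmod \<Rightarrow> ('q \<Rightarrow> 'v set) \<Rightarrow> bool" where
  "subobject V S \<longleftrightarrow> (\<forall>q. subspace (S q) \<and> S q \<subseteq> sp V q) \<and>
     (\<forall>p q. p \<le> q \<longrightarrow> tr V p q ` S p \<subseteq> S q) \<and> V\<lparr>sp := S\<rparr> \<in> pers_fp"

definition semistable ::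
    "((('q::order, 'v) pmod \<Rightarrow>\<^sub>0 int) set \<Rightarrow> complex) \<Rightarrow> ('q, 'v) pmod \<Rightarrow> bool" where
  "semistable Z V \<longleftrightarrow> V \<in> pers_fp \<and> \<not> zero_pmod V \<and>
     (\<forall>S. subobject V S \<and> \<not> zero_pmod (V\<lparr>sp := S\<rparr>) \<longrightarrow> slope Z (V\<lparr>sp := S\<rparr>) \<le> slope Z V)"

text \<open>
  \<open>F 0, \<dots>, F l\<close> are the terms of the filtration, and \<open>C j\<close> is a quotient of \<open>F (Suc j)\<close> by \<open>F j\<close>
  for \<open>j < l\<close>; such a quotient is determined up to isomorphism.
\<close>

definition is_HN_filtration ::
    "((('q::order, 'v) pmod \<Rightarrow>\<^sub>0 int) set \<Rightarrow> complex) \<Rightarrow> ('q, 'v) pmod \<Rightarrow>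
     nat \<Rightarrow> (nat \<Rightarrow> 'q \<Rightarrow> 'v set) \<Rightarrow> (nat \<Rightarrow> ('q, 'v) pmod) \<Rightarrow> bool" where
  "is_HN_filtration Z V l F C \<longleftrightarrow>
     F 0 = (\<lambda>_. {0}) \<and> F l = sp V \<and> (\<forall>j\<le>l. subobject V (F j)) \<and>
     (\<forall>j<l. F j < F (Suc j) \<and>
        (\<exists>\<pi>. short_exact (V\<lparr>sp := F j\<rparr>) (V\<lparr>sp := F (Suc j)\<rparr>) (C j) (\<lambda>_ v. v) \<pi>) \<and>
        semistable Z (C j)) \<and>
     (\<forall>j. Suc j < l \<longrightarrow> slope Z (C (Suc j)) < slope Z (C j))"

text \<open>The cases \<open>i = 0\<close> and \<open>i = l\<close> below account for the slopes \<open>\<infinity>\<close> and \<open>-\<infinity>\<close> at the ends.\<close>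

definition HN_part ::
    "((('q::order, 'v) pmod \<Rightarrow>\<^sub>0 int) set \<Rightarrow> complex) \<Rightarrow> real \<Rightarrow> ('q, 'v) pmod \<Rightarrow> 'q \<Rightarrow> 'v set" where
  "HN_part Z \<theta> V = (if zero_pmod V then (\<lambda>_. {0}) else
     (THE S. \<exists>l F C i. is_HN_filtration Z V l F C \<and> i \<le> l \<and> S = F i \<and>
        (i = 0 \<or> \<theta> \<le> slope Z (C (i - 1))) \<and> (i = l \<or> slope Z (C i) < \<theta>)))"


section \<open>The stability conditions used over Q\<close>

definition Z_step ::
    "('a::index_coord, 'n::finite) grid_fun \<Rightarrow> (((('a^'n), 'v) pmod \<Rightarrow>\<^sub>0 int) set \<Rightarrow> complex) set" where
  "Z_step G = {Z \<in> stability_conditions. \<exists>G' a b. extension G G' \<and>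
     discretisable G' a \<and> discretisable G' b \<and>
     (\<forall>x \<in> insert None (Some ` grid_dom G). \<not> bounded_cube (cub G x) \<longrightarrow> (\<forall>q \<in> cub G x. a q = 0)) \<and>
     (\<forall>q. b q > 0) \<and> integrable (cube_measure UNIV) b \<and>
     (\<forall>V\<in>pers_fp. Z (K_class V) =
        (\<integral>q. Complex (b q) (a q) * of_nat (dim (sp V q)) \<partial>cube_measure UNIV))}"

definition Z_grid ::
    "('a::index_coord, 'n::finite) grid_fun \<Rightarrow> (((('a^'n), 'v) pmod \<Rightarrow>\<^sub>0 int) set \<Rightarrow> complex) set" where
  "Z_grid G = {Z \<in> stability_conditions. \<exists>Z' \<in> Z_step G. \<exists>wt.
     (\<forall>c. wt c \<ge> (0::real)) \<and>
     (\<forall>V\<in>pers_fp. Z (K_class V) = Z' (K_class V) + \<i> * of_real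
        (\<Sum>c \<in> \<Union>{faces (cub G (Some x)) | x. x \<in> grid_dom G \<and> bounded_cube (cub G (Some x))}.
           wt c * cube_mean c (\<lambda>q. real (dim (sp V q)))))}"

definition Z_all :: "(((('a::index_coord^'n::finite), 'v) pmod \<Rightarrow>\<^sub>0 int) set \<Rightarrow> complex) set" where
  "Z_all = \<Union>{Z_grid G | G. finite_grid G}"


section \<open>The HN filtered rank invariant and the interleaving distance\<close>

definition HN_rank ::
    "((('q::{order,ab_group_add}, 'v) pmod \<Rightarrow>\<^sub>0 int) set \<Rightarrow> complex) \<Rightarrow> real \<Rightarrow> ('q, 'v) pmod \<Rightarrow>
     'q \<Rightarrow> 'q \<Rightarrow> enat" where
  "HN_rank Z \<theta> V x y =
     (if x \<le> y then enat (dim (tr (shift x V) 0 (y - x) ` HN_part Z \<theta> (shift x V) 0)) else \<infinity>)"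

definition interleaved ::
    "'a::index_coord \<Rightarrow> ('a^'n, 'v) pmod \<Rightarrow> ('a^'n, 'v) pmod \<Rightarrow> bool" where
  "interleaved \<epsilon> V W \<longleftrightarrow> (\<exists>f g.
     is_hom index_order V (shift (vec \<epsilon>) W) f \<and> is_hom index_order W (shift (vec \<epsilon>) V) g \<and>
     (\<forall>q. \<forall>v\<in>sp V q. g (vec \<epsilon> + q) (f q v) = tr V q (vec \<epsilon> + (vec \<epsilon> + q)) v) \<and>
     (\<forall>q. \<forall>w\<in>sp W q. f (vec \<epsilon> + q) (g q w) = tr W q (vec \<epsilon> + (vec \<epsilon> + q)) w))"

definition interleaving_distance ::
    "('a::index_coord^'n, 'v) pmod \<Rightarrow> ('a^'n, 'v) pmod \<Rightarrow> ennreal" where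
  "interleaving_distance V W = Inf {ennreal (coord_real \<epsilon>) | \<epsilon>. \<epsilon> \<ge> 0 \<and> interleaved \<epsilon> V W}"

end


section \<open>Persistence landscapes\<close>

definition sup_norm :: "'a::index_coord^'n \<Rightarrow> real" where
  "sup_norm h = (MAX i. \<bar>coord_real (h $ i)\<bar>)"

text \<open>In both cases \<open>\<epsilon>\<close> is a real number here. In \<^typ>\<open>ennreal\<close> the supremum of \<^term>\<open>{}\<close> is 0.\<close>

definition landscape ::
    "('a::index_coord^'n \<Rightarrow> 'a^'n \<Rightarrow> enat) \<Rightarrow> nat \<Rightarrow> 'a^'n \<Rightarrow> ennreal" where
  "landscape s k x =
     Sup {ennreal \<epsilon> | \<epsilon>. \<epsilon> > 0 \<and> (\<forall>h. sup_norm h \<le> \<epsilon> \<longrightarrow> s (x - h) (x + h) \<ge> enat k)}"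

text \<open>Subtraction of \<^typ>\<open>ennreal\<close> is truncated, and \<^term>\<open>\<infinity> - \<infinity> = (\<infinity> :: ennreal)\<close>.\<close>

definition abs_diff :: "ennreal \<Rightarrow> ennreal \<Rightarrow> ennreal" where
  "abs_diff a b = (if a = \<infinity> \<and> b = \<infinity> then 0 else max (a - b) (b - a))"

definition landscape_distance :: "(nat \<Rightarrow> 'q \<Rightarrow> ennreal) \<Rightarrow> (nat \<Rightarrow> 'q \<Rightarrow> ennreal) \<Rightarrow> ennreal" where
  "landscape_distance f g = (SUP (k, x). abs_diff (f k x) (g k x))"

end

theory Submission
  imports Defs
begin

text \<open>
  \<^bold>\<open>The idea.\<close> For a real number \<open>\<theta>\<close> let the degree of a subobject \<open>S\<close> be \<open>Im Z(S) - \<theta> Re Z(S)\<close>. The piece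
  of the Harder-Narasimhan filtration of \<open>V\<close> cut out by \<open>\<theta>\<close> is the largest among the subobjects of
  maximal degree (\<open>HN_part_largest_maximiser\<close>). The degree is additive on short exact sequences. So if \<open>S\<close> and \<open>T\<close> are
  the pieces of \<open>V\<close> and \<open>W\<close>, and \<open>\<phi>\<close> is a morphism from \<open>V\<close> to \<open>W\<close>, then \<open>T + \<phi>(S)\<close> has at least the degree of \<open>T\<close>,
  and therefore \<open>\<phi>\<close> maps \<open>S\<close> to \<open>T\<close> (\<open>HN_part_hom\<close>). The maps of an \<open>\<epsilon>\<close>-interleaving are morphisms between
  shifted modules. Thus the structure map of \<open>V\<close> from \<open>x - \<epsilon>\<close> to \<open>y + \<epsilon>\<close>, restricted to a piece, factors
  through the structure map of \<open>W\<close> from \<open>x\<close> to \<open>y\<close> on the corresponding piece. The ranks satisfy the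
  corresponding inequality (\<open>HN_rank_interleaved\<close>), and landscapes differ by at most \<open>\<epsilon>\<close>.

  \<^bold>\<open>Existence of the filtrations.\<close> The category is neither noetherian nor artinian, so existence has to
  come from the shape of the stability conditions. A module is finitely presentable if and only if it is
  constant on the cells cut out by finitely many thresholds in each coordinate (\<open>pers_fp_iff_tame\<close>).
  Fix thresholds that work for \<open>V\<close> and for the finite grid function that underlies \<open>Z\<close>. A subobject with
  a further threshold \<open>s\<close> can be deformed by moving \<open>s\<close> between its neighbours. Its degree depends on the
  position of \<open>s\<close> in an affine way, apart from contributions of faces at the lower neighbour, which help
  to enlarge the subobject. Where the densities vary, the imaginary one is zero and the other is
  positive, so the sign of \<open>\<theta>\<close> tells in which direction to move. Hence \<open>s\<close> can be removed without losing degree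
  (\<open>remove_threshold\<close>), and every subobject is dominated by one that is constant on the fixed cells. These
  have only finitely many dimension functions, so maximisers exist (\<open>largest_maximiser_exists\<close>). As \<open>\<theta>\<close> decreases, the largest
  maximisers form a finite increasing chain, which is the Harder-Narasimhan filtration (\<open>HN_exists\<close>).

  The locale \<open>step_charge\<close> isolates what is used about \<open>Z\<close>; the stability conditions given by finite grid
  functions satisfy it by Fubini's theorem in one coordinate (\<open>Z_grid_step_charge\<close>).
\<close>

section \<open>Finite-dimensional subspaces\<close>

context persistence
begin

definition fin_subspace :: "'v set \<Rightarrow> bool" where
  "fin_subspace S \<longleftrightarrow> subspace S \<and> (\<exists>B. finite B \<and> span B = S)"

lemma fin_subspaceD: "fin_subspace S \<Longrightarrow> subspace S"
  by (simp add: fin_subspace_def)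

lemma fin_subspace_basis:
  assumes "fin_subspace S" "subspace T" "T \<subseteq> S" "independent C" "C \<subseteq> T"
  obtains B where "C \<subseteq> B" "independent B" "finite B" "span B = T" "dim T = card B"
proof -
  obtain B where B: "C \<subseteq> B" "B \<subseteq> T" "independent B" "T \<subseteq> span B"
    using maximal_independent_subset_extend[OF assms(5,4)] by blast
  moreover obtain D where "finite D" "span D = S" using assms(1) by (auto simp: fin_subspace_def)
  ultimately have "finite B" using independent_span_bound[of D B] assms(3) by blast
  moreover have "span B = T" using B assms(2) by (metis span_subspace)
  ultimately show ?thesis using B that dim_span_eq_card_independent by metis
qed

lemma fin_subspace_subset:
  assumes "fin_subspace S" "subspace T" "T \<subseteq> S" shows "fin_subspace T"
proof -
  obtain B where "finite B" "span B = T"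
    using fin_subspace_basis[OF assms independent_empty] by auto
  then show ?thesis using assms(2) by (auto simp: fin_subspace_def)
qed

text \<open>
  The structure maps of a persistence module are linear on a subspace only. Extended to the ambient
  space they become linear maps in the sense of the library.
\<close>

lemma linear_between_extend:
  assumes "subspace S" "linear_between S T f"
  obtains F where "Vector_Spaces.linear scale scale F" "\<And>v. v \<in> S \<Longrightarrow> F v = f v"
proof -
  interpret vp: vector_space_pair scale scale ..
  obtain B where B: "B \<subseteq> S" "independent B" "S \<subseteq> span B" using maximal_independent_subset by blast
  obtain F where F: "Vector_Spaces.linear scale scale F" "\<forall>x\<in>B. F x = f x"
    using vp.linear_independent_extend[OF B(2)] by blast
  interpret F: Vector_Spaces.linear scale scale F by fact
  have "F v = f v \<and> v \<in> S" if "v \<in> span B" for v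
    using that
  proof (induction rule: span_induct_alt)
    case base
    have "f (scale 0 0) = scale 0 (f 0)"
      using assms subspace_0 unfolding linear_between_def by blast
    then show ?case using assms subspace_0 by (simp add: F.zero)
  next
    case (step c x y)
    then have "x \<in> S" "scale c x \<in> S" using B assms subspace_scale by blast+
    then show ?case using step F assms unfolding linear_between_def
      by (auto simp: F.add F.scale subspace_add)
  qed
  then show ?thesis using that F B by blast
qed

lemma linear_betweenI:
  assumes "Vector_Spaces.linear scale scale F" "F ` S \<subseteq> T"
  shows "linear_between S T F"
proof -
  interpret F: Vector_Spaces.linear scale scale F by fact
  show ?thesis using assms by (auto simp: linear_between_def F.add F.scale)
qed

lemma linear_between_in: "linear_between S T f \<Longrightarrow> v \<in> S \<Longrightarrow> f v \<in> T"
  by (auto simp: linear_between_def)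

lemma linear_between_0: "linear_between S T f \<Longrightarrow> subspace S \<Longrightarrow> f 0 = 0"
  unfolding linear_between_def using subspace_0[of S] scale_zero_left by metis

lemma linear_between_diff:
  assumes "linear_between S T f" "subspace S" "x \<in> S" "y \<in> S" shows "f (x - y) = f x - f y"
proof -
  have "f (x - y + y) = f (x - y) + f y"
    using assms subspace_diff[OF assms(2-4)] unfolding linear_between_def by blast
  then show ?thesis by (simp add: algebra_simps)
qed

lemma linear_between_inj_iff:
  assumes "linear_between S T f" "subspace S"
  shows "inj_on f S \<longleftrightarrow> (\<forall>v\<in>S. f v = 0 \<longrightarrow> v = 0)"
proof
  assume "inj_on f S"
  then show "\<forall>v\<in>S. f v = 0 \<longrightarrow> v = 0"
    using linear_between_0[OF assms] subspace_0[OF assms(2)] by (metis inj_onD)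
next
  assume R: "\<forall>v\<in>S. f v = 0 \<longrightarrow> v = 0"
  show "inj_on f S"
  proof (rule inj_onI)
    fix x y assume "x \<in> S" "y \<in> S" "f x = f y"
    then have "f (x - y) = 0" using linear_between_diff[OF assms] by simp
    then have "x - y = 0" using R \<open>x \<in> S\<close> \<open>y \<in> S\<close> subspace_diff[OF assms(2)] by blast
    then show "x = y" by simp
  qed
qed

lemma linear_between_subset:
  "linear_between S T f \<Longrightarrow> S' \<subseteq> S \<Longrightarrow> f ` S' \<subseteq> T' \<Longrightarrow> linear_between S' T' f"
  by (auto simp: linear_between_def subset_iff)

lemma linear_between_comp:
  "linear_between S T f \<Longrightarrow> linear_between T U g \<Longrightarrow> linear_between S U (\<lambda>v. g (f v))"
  by (auto simp: linear_between_def image_subset_iff)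

lemma linear_between_preimage:
  assumes "linear_between S T f" "subspace S" "subspace U"
  shows "subspace {v \<in> S. f v \<in> U}"
  using assms linear_between_0[OF assms(1,2)]
  by (auto simp: linear_between_def intro!: subspaceI simp: subspace_0 subspace_add subspace_scale)

lemma fin_subspace_image:
  assumes "fin_subspace S" "linear_between S T f" shows "fin_subspace (f ` S)"
proof -
  obtain F where F: "Vector_Spaces.linear scale scale F" "\<And>v. v \<in> S \<Longrightarrow> F v = f v"
    using linear_between_extend[OF fin_subspaceD[OF assms(1)] assms(2)] by blast
  interpret F: Vector_Spaces.linear scale scale F by fact
  have eq: "f ` S = F ` S" using F(2) by simp
  obtain B where "finite B" "span B = S" using assms by (auto simp: fin_subspace_def)
  then have "finite (F ` B)" "span (F ` B) = F ` S" using F.span_image by auto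
  then show ?thesis using assms eq by (auto simp: fin_subspace_def intro: F.subspace_image)
qed

text \<open>
  The ambient space is infinite-dimensional, so the argument is local to \<open>S\<close>: extend a basis of the
  kernel to a basis of \<open>S\<close>; \<open>f\<close> is injective on the span of the added vectors and maps them to a
  basis of the image.
\<close>

lemma rank_nullity:
  assumes S: "fin_subspace S" and f: "linear_between S T f"
  shows "dim S = dim {v \<in> S. f v = 0} + dim (f ` S)"
proof -
  note sub = fin_subspaceD[OF S]
  let ?K = "{v \<in> S. f v = 0}"
  obtain F where F: "Vector_Spaces.linear scale scale F" "\<And>v. v \<in> S \<Longrightarrow> F v = f v"
    using linear_between_extend[OF sub f] by blast
  interpret F: Vector_Spaces.linear scale scale F by fact
  have K: "subspace ?K" using linear_between_preimage[OF f sub subspace_single_0] by simp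
  obtain C where C: "independent C" "finite C" "span C = ?K" "dim ?K = card C"
    using fin_subspace_basis[OF S K _ independent_empty] by auto
  have "C \<subseteq> S" using C(3) span_superset by auto
  then obtain B where B: "C \<subseteq> B" "independent B" "finite B" "span B = S" "dim S = card B"
    using fin_subspace_basis[OF S sub _ C(1)] by auto
  let ?D = "B - C"
  have inj: "inj_on F (span ?D)"
  proof (subst F.inj_on_iff_eq_0)
    show "\<forall>v\<in>span ?D. F v = 0 \<longrightarrow> v = 0"
    proof (intro ballI impI)
      fix v assume v: "v \<in> span ?D" "F v = 0"
      have vB: "v \<in> span B" using v(1) span_mono[of ?D B] by auto
      then have "v \<in> ?K" using B(4) F(2) v(2) by auto
      then have "v \<in> span C" using C by simp
      \<comment> \<open>The coordinates of \<open>v\<close> in \<open>B\<close> live both on \<open>C\<close> and off \<open>C\<close>.\<close>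
      then have "representation B v b = 0" for b
        using representation_extend[OF B(2) _ B(1)] representation_extend[OF B(2) v(1)]
          representation_ne_zero[of C v b] representation_ne_zero[of ?D v b] by fastforce
      then show "v = 0"
        using sum_nonzero_representation_eq[OF B(2) vB] by simp
    qed
  qed simp
  have indep: "independent (F ` ?D)"
    using F.independent_injective_image[OF _ inj] B(2) independent_mono by blast
  have "span (F ` ?D) = F ` S"
  proof
    show "span (F ` ?D) \<subseteq> F ` S"
      using F.span_image[of ?D] span_mono[of ?D B] B(4) by auto
    have "F ` B \<subseteq> span (F ` ?D)"
    proof
      fix y assume "y \<in> F ` B"
      then obtain b where b: "b \<in> B" "y = F b" by auto
      show "y \<in> span (F ` ?D)"
      proof (cases "b \<in> C")
        case True
        then have "b \<in> ?K" using C(3) span_base by blast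
        then have "y = 0" using F(2) b by auto
        then show ?thesis by (simp add: span_zero)
      qed (use b in \<open>auto intro: span_base\<close>)
    qed
    then show "F ` S \<subseteq> span (F ` ?D)"
      using F.span_image[of B] B(4) span_minimal subspace_span by metis
  qed
  then have "dim (F ` S) = card (F ` ?D)" using dim_span_eq_card_independent[OF indep] by simp
  also have "\<dots> = card ?D"
    using inj_on_subset[OF inj span_superset] by (rule card_image)
  also have "\<dots> = card B - card C" using B C by (simp add: card_Diff_subset)
  finally show ?thesis using B C F(2) card_mono[OF B(3,1)] by simp
qed

lemma dim_zero: "dim {0} = 0"
  using dim_span_eq_card_independent[OF independent_empty] by simp

lemma dim_image_inj:
  assumes "fin_subspace S" "linear_between S T f" "inj_on f S"
  shows "dim (f ` S) = dim S"
proof -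
  have "{v \<in> S. f v = 0} = {0}"
    using linear_between_inj_iff[OF assms(2) fin_subspaceD[OF assms(1)]] assms(3)
      linear_between_0[OF assms(2) fin_subspaceD[OF assms(1)]] subspace_0[OF fin_subspaceD[OF assms(1)]]
    by auto
  then show ?thesis using rank_nullity[OF assms(1,2)] dim_zero by simp
qed

lemma fin_subspace_zero: "fin_subspace {0}"
  unfolding fin_subspace_def by (auto intro!: exI[of _ "{}"])

lemma dim_subset_le:
  assumes "fin_subspace S" "subspace T" "T \<subseteq> S" shows "dim T \<le> dim S"
proof -
  obtain C where C: "independent C" "span C = T" "dim T = card C"
    using fin_subspace_basis[OF assms independent_empty] by auto
  have "C \<subseteq> S" using C(2) span_superset assms(3) by auto
  then obtain B where B: "C \<subseteq> B" "finite B" "dim S = card B"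
    using fin_subspace_basis[OF assms(1) fin_subspaceD[OF assms(1)] _ C(1)] by auto
  then show ?thesis using C(3) card_mono[OF B(2,1)] by simp
qed

lemma dim_subset_eq:
  assumes "fin_subspace S" "subspace T" "T \<subseteq> S" "dim S = dim T" shows "T = S"
proof -
  obtain C where C: "independent C" "finite C" "span C = T" "dim T = card C"
    using fin_subspace_basis[OF assms(1-3) independent_empty] by auto
  have "C \<subseteq> S" using C(3) span_superset assms(3) by auto
  then obtain B where B: "C \<subseteq> B" "finite B" "span B = S" "dim S = card B"
    using fin_subspace_basis[OF assms(1) fin_subspaceD[OF assms(1)] _ C(1)] by auto
  then have "C = B" using C assms(4) by (metis card_subset_eq)
  then show ?thesis using B C by simp
qed

text \<open>
  The image of \<open>\<pi>\<close> is a copy of \<open>S/T\<close> inside the ambient space. Quotient modules will be built from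
  such copies.
\<close>

lemma projection_exists:
  assumes "subspace S" "subspace T" "T \<subseteq> S"
  obtains \<pi> where "linear_between S S \<pi>" "\<And>v. v \<in> T \<Longrightarrow> \<pi> v = 0" "\<And>v. v \<in> S \<Longrightarrow> v - \<pi> v \<in> T"
proof -
  interpret vp: vector_space_pair scale scale ..
  obtain C where C: "C \<subseteq> T" "independent C" "T \<subseteq> span C" using maximal_independent_subset by blast
  then obtain B where B: "C \<subseteq> B" "B \<subseteq> S" "independent B" "S \<subseteq> span B"
    using maximal_independent_subset_extend[of C S] assms by blast
  obtain F where F: "Vector_Spaces.linear scale scale F" "\<forall>b\<in>B. F b = (if b \<in> C then 0 else b)"
    using vp.linear_independent_extend[OF B(3), of "\<lambda>b. if b \<in> C then 0 else b"] by blast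
  interpret F: Vector_Spaces.linear scale scale F by fact
  have S: "span B = S" using B assms(1) by (metis span_subspace)
  have T: "F v = 0" if "v \<in> T" for v
    by (rule F.eq_0_on_span[of C v]) (use F(2) B(1) C(3) that in auto)
  have main: "v - F v \<in> T" if "v \<in> span B" for v
    using that
  proof (induction rule: span_induct_alt)
    case base then show ?case by (simp add: F.zero subspace_0[OF assms(2)])
  next
    case (step c x y)
    have "x - F x \<in> T" using step F(2) C(1) by (auto simp: subspace_0[OF assms(2)])
    then have "scale c (x - F x) + (y - F y) \<in> T"
      using step assms(2) subspace_add subspace_scale by metis
    then show ?case by (simp add: F.add F.scale scale_right_diff_distrib algebra_simps)
  qed
  have "F v \<in> S" if "v \<in> S" for v
    using main[of v] that S assms subspace_diff[OF assms(1), of v "v - F v"] by auto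
  then show ?thesis using that[of F] linear_betweenI[OF F(1), of S S] T main S by auto
qed

text \<open>
  Modulo \<open>T\<close>, the space \<open>T + f(S)\<close> is the image of \<open>S\<close>, and the kernel of \<open>S \<rightarrow> (T + f(S))/T\<close> is the
  preimage of \<open>T\<close>. With \<open>f\<close> an inclusion this is the modular law for dimensions; with \<open>f\<close> a component
  of a morphism it yields the functoriality of the Harder-Narasimhan pieces.
\<close>

lemma dim_sum_image:
  assumes S: "fin_subspace S" and W: "fin_subspace W" and f: "linear_between S W f"
    and T: "subspace T" "T \<subseteq> W"
  shows "dim {t + f s | t s. t \<in> T \<and> s \<in> S} + dim {s \<in> S. f s \<in> T} = dim T + dim S"
proof -
  let ?U = "{t + f s | t s. t \<in> T \<and> s \<in> S}"
  have fS: "subspace (f ` S)" "f ` S \<subseteq> W"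
    using fin_subspace_image[OF S f] f by (auto simp: fin_subspace_def linear_between_def)
  have U: "subspace ?U"
  proof -
    have "?U = {x + y |x y. x \<in> T \<and> y \<in> f ` S}" by blast
    then show ?thesis using subspace_sums[OF T(1) fS(1)] by simp
  qed
  have 0: "0 \<in> T" "0 \<in> f ` S" using T(1) fS(1) subspace_0 by auto
  have UW: "?U \<subseteq> W" using T(2) fS(2) subspace_add[OF fin_subspaceD[OF W]] by auto
  have TU: "T \<subseteq> ?U" using 0 by force
  have SU: "f ` S \<subseteq> ?U" using 0 by force
  have finU: "fin_subspace ?U" using fin_subspace_subset[OF W U UW] .
  obtain \<pi> where \<pi>: "linear_between ?U ?U \<pi>" "\<And>v. v \<in> T \<Longrightarrow> \<pi> v = 0" "\<And>v. v \<in> ?U \<Longrightarrow> v - \<pi> v \<in> T"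
    using projection_exists[OF U T(1) TU] by blast
  have ker: "\<pi> v = 0 \<longleftrightarrow> v \<in> T" if "v \<in> ?U" for v using \<pi>(2,3) that by force
  have fSU: "linear_between S ?U f" using linear_between_subset[OF f subset_refl SU] .
  have "dim ?U = dim {v \<in> ?U. \<pi> v = 0} + dim (\<pi> ` ?U)" using rank_nullity[OF finU \<pi>(1)] .
  also have "{v \<in> ?U. \<pi> v = 0} = T" using ker TU by blast
  finally have 1: "dim ?U = dim T + dim (\<pi> ` ?U)" .
  have "dim S = dim {v \<in> S. \<pi> (f v) = 0} + dim ((\<lambda>v. \<pi> (f v)) ` S)"
    using rank_nullity[OF S linear_between_comp[OF fSU \<pi>(1)]] .
  also have "{v \<in> S. \<pi> (f v) = 0} = {v \<in> S. f v \<in> T}" using ker SU by blast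
  also have "(\<lambda>v. \<pi> (f v)) ` S = \<pi> ` ?U"
  proof
    show "\<pi> ` ?U \<subseteq> (\<lambda>v. \<pi> (f v)) ` S"
    proof
      fix y assume "y \<in> \<pi> ` ?U"
      then obtain t s where ts: "t \<in> T" "s \<in> S" "y = \<pi> (t + f s)" by blast
      then have "y = \<pi> t + \<pi> (f s)" using \<pi>(1) TU SU unfolding linear_between_def by blast
      then show "y \<in> (\<lambda>v. \<pi> (f v)) ` S" using ts \<pi>(2) by auto
    qed
    show "(\<lambda>v. \<pi> (f v)) ` S \<subseteq> \<pi> ` ?U"
      using image_mono[OF SU, of \<pi>] by (simp only: image_image)
  qed
  finally show ?thesis using 1 by simp
qed

end

section \<open>Cells of finite threshold sets\<close>

text \<open>
  A finite set \<open>B\<close> of pairs \<open>(i, a)\<close> prescribes thresholds \<open>a\<close> in the coordinates \<open>i\<close>. Two points lie in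
  the same cell of the resulting subdivision if they have passed the same thresholds, so the set of
  passed thresholds serves as the name of the cell. Working with threshold sets instead of grid
  functions makes common refinements unions, and allows for removing a single threshold.
\<close>

definition key :: "('n \<times> 'a::order) set \<Rightarrow> 'a^'n \<Rightarrow> ('n \<times> 'a) set" where
  "key B q = {(i, a) \<in> B. a \<le> q $ i}"

text \<open>
  The points that are not full form the cell of \<open>-\<infinity>\<close>: no grid point lies below them.
\<close>

definition full :: "('n \<times> 'a::order) set \<Rightarrow> 'a^'n \<Rightarrow> bool" where
  "full B q \<longleftrightarrow> (\<forall>i. \<exists>a. (i, a) \<in> B \<and> a \<le> q $ i)"

definition floor_pt :: "('n::finite \<times> 'a::linorder) set \<Rightarrow> 'a^'n \<Rightarrow> 'a^'n" where
  "floor_pt B q = (\<chi> i. Max {a. (i, a) \<in> B \<and> a \<le> q $ i})"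

lemma key_eq_iff: "key B q = key B q' \<longleftrightarrow> (\<forall>(i, a) \<in> B. a \<le> q $ i \<longleftrightarrow> a \<le> q' $ i)"
  by (auto simp: key_def)

lemma key_eqD: "key B q = key B q' \<Longrightarrow> (i, a) \<in> B \<Longrightarrow> a \<le> q $ i \<longleftrightarrow> a \<le> q' $ i"
  unfolding key_eq_iff by blast

lemma key_eq_mono: "key B q = key B q' \<Longrightarrow> A \<subseteq> B \<Longrightarrow> key A q = key A q'"
  by (auto simp: key_eq_iff)

lemma full_mono: "full A q \<Longrightarrow> A \<subseteq> B \<Longrightarrow> full B q"
  unfolding full_def by blast

lemma full_le: "full B q \<Longrightarrow> q \<le> q' \<Longrightarrow> full B q'"
  unfolding full_def less_eq_vec_def by (meson order_trans)

lemma full_key: "key B q = key B q' \<Longrightarrow> full B q = full B q'"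
  unfolding key_eq_iff full_def by blast

lemma finite_thresholds:
  assumes "finite B" shows "finite {a. (i, a) \<in> B \<and> P a}"
proof -
  have "{a. (i, a) \<in> B \<and> P a} \<subseteq> snd ` B" by force
  then show ?thesis using assms finite_surj by blast
qed

lemma finite_keys: "finite B \<Longrightarrow> finite (range (key B))"
  by (rule finite_subset[of _ "Pow B"]) (auto simp: key_def)

lemma floor_pt_mem:
  assumes "finite B" "full B q"
  shows "(i, floor_pt B q $ i) \<in> B \<and> floor_pt B q $ i \<le> q $ i"
proof -
  let ?A = "{a. (i, a) \<in> B \<and> a \<le> q $ i}"
  have "Max ?A \<in> ?A"
    using assms(2) finite_thresholds[OF assms(1)] by (intro Max_in) (auto simp: full_def)
  then show ?thesis by (simp add: floor_pt_def)
qed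

lemma floor_pt_le: "finite B \<Longrightarrow> full B q \<Longrightarrow> floor_pt B q \<le> q"
  using floor_pt_mem by (auto simp: less_eq_vec_def)

lemma floor_pt_ge:
  assumes "finite B" "(i, a) \<in> B" "a \<le> q $ i" shows "a \<le> floor_pt B q $ i"
  using assms finite_thresholds[OF assms(1), of i "\<lambda>a. a \<le> q $ i"]
  by (auto simp: floor_pt_def intro!: Max_ge)

lemma key_floor_pt: "finite B \<Longrightarrow> full B q \<Longrightarrow> key B (floor_pt B q) = key B q"
  unfolding key_eq_iff using floor_pt_ge floor_pt_mem by (fastforce intro: order_trans)

lemma floor_pt_mono:
  assumes "finite B" "full B q" "q \<le> q'" shows "floor_pt B q \<le> floor_pt B q'"
  unfolding less_eq_vec_def
  using floor_pt_mem[OF assms(1,2)] assms(3) floor_pt_ge[OF assms(1), of _ _ q']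
  by (metis less_eq_vec_def order_trans)

lemma floor_pt_key: "key B q = key B q' \<Longrightarrow> floor_pt B q = floor_pt B q'"
proof -
  assume "key B q = key B q'"
  then have "(i, a) \<in> B \<and> a \<le> q $ i \<longleftrightarrow> (i, a) \<in> B \<and> a \<le> q' $ i" for i a
    unfolding key_eq_iff by blast
  then show ?thesis by (simp add: floor_pt_def)
qed

lemma floor_pt_grid:
  assumes "finite B" "\<And>i. (i, q $ i) \<in> B" shows "full B q" "floor_pt B q = q"
proof -
  show "full B q" using assms(2) by (auto simp: full_def)
  then have "floor_pt B q \<le> q" using floor_pt_le[OF assms(1)] by blast
  moreover have "q \<le> floor_pt B q"
    unfolding less_eq_vec_def using floor_pt_ge[OF assms(1)] assms(2) by blast
  ultimately show "floor_pt B q = q" by simp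
qed

text \<open>
  Two points of a cell have a lower bound in that cell, so what is transported along \<open>\<le>\<close> within cells
  is constant on cells.
\<close>

lemma key_inf:
  fixes q q' :: "'a::linorder^'n"
  assumes "key B q = key B q'"
  shows "key B (\<chi> i. min (q $ i) (q' $ i)) = key B q"
proof -
  have "a \<le> q $ i \<longleftrightarrow> a \<le> q' $ i" if "(i, a) \<in> B" for i a
    using assms that unfolding key_eq_iff by blast
  then show ?thesis unfolding key_eq_iff by auto
qed

section \<open>Finitely presentable modules\<close>

lemma Field_index_order [simp]: "Field (index_order :: 'q::order rel) = UNIV"
  by (auto simp: Field_def)

context persistence
begin

lemma pers_index_iff:
  "V \<in> pers (index_order :: 'q::order rel) \<longleftrightarrow>
     (\<forall>q. fin_subspace (sp V q)) \<and>
     (\<forall>p q. p \<le> q \<longrightarrow> linear_between (sp V p) (sp V q) (tr V p q)) \<and>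
     (\<forall>q. \<forall>v\<in>sp V q. tr V q q v = v) \<and>
     (\<forall>p q s. p \<le> q \<longrightarrow> q \<le> s \<longrightarrow> (\<forall>v\<in>sp V p. tr V q s (tr V p q v) = tr V p s v))"
  unfolding pers_def fin_subspace_def by auto

lemma is_hom_index_iff:
  "is_hom (index_order :: 'q::order rel) V W \<phi> \<longleftrightarrow>
     (\<forall>p. linear_between (sp V p) (sp W p) (\<phi> p)) \<and>
     (\<forall>p q. p \<le> q \<longrightarrow> (\<forall>v\<in>sp V p. \<phi> q (tr V p q v) = tr W p q (\<phi> p v)))"
  unfolding is_hom_def by auto

lemma
  assumes "is_hom (index_order :: 'q::order rel) V W \<phi>"
  shows hom_linear: "linear_between (sp V p) (sp W p) (\<phi> p)"
    and hom_in: "v \<in> sp V p \<Longrightarrow> \<phi> p v \<in> sp W p"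
    and hom_comm: "p \<le> q \<Longrightarrow> v \<in> sp V p \<Longrightarrow> \<phi> q (tr V p q v) = tr W p q (\<phi> p v)"
proof -
  show lin: "linear_between (sp V p) (sp W p) (\<phi> p)" using assms by (simp add: is_hom_index_iff)
  show "v \<in> sp V p \<Longrightarrow> \<phi> p v \<in> sp W p" using linear_between_in[OF lin] .
  show "p \<le> q \<Longrightarrow> v \<in> sp V p \<Longrightarrow> \<phi> q (tr V p q v) = tr W p q (\<phi> p v)"
    using assms by (simp add: is_hom_index_iff)
qed

lemma
  assumes "V \<in> pers (index_order :: 'q::order rel)"
  shows pers_fin: "fin_subspace (sp V q)"
    and pers_sub: "subspace (sp V q)"
    and pers_zero: "0 \<in> sp V q"
    and pers_linear: "p \<le> q \<Longrightarrow> linear_between (sp V p) (sp V q) (tr V p q)"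
    and pers_tr: "p \<le> q \<Longrightarrow> v \<in> sp V p \<Longrightarrow> tr V p q v \<in> sp V q"
    and pers_tr0: "p \<le> q \<Longrightarrow> tr V p q 0 = 0"
    and pers_id: "v \<in> sp V q \<Longrightarrow> tr V q q v = v"
    and pers_comp: "p \<le> q \<Longrightarrow> q \<le> s \<Longrightarrow> v \<in> sp V p \<Longrightarrow> tr V q s (tr V p q v) = tr V p s v"
proof -
  note V = assms[unfolded pers_index_iff]
  note lin = V[THEN conjunct2, THEN conjunct1, rule_format]
  note idc = V[THEN conjunct2, THEN conjunct2, THEN conjunct1, rule_format]
  note comp = V[THEN conjunct2, THEN conjunct2, THEN conjunct2, rule_format]
  show fin: "fin_subspace (sp V q)" for q using V by simp
  show sub: "subspace (sp V q)" for q using fin_subspaceD[OF fin] .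
  show "0 \<in> sp V q" using sub subspace_0 by blast
  show "p \<le> q \<Longrightarrow> linear_between (sp V p) (sp V q) (tr V p q)" by (rule lin)
  show "p \<le> q \<Longrightarrow> v \<in> sp V p \<Longrightarrow> tr V p q v \<in> sp V q"
    using lin[of p q] by (auto simp: linear_between_def)
  show "p \<le> q \<Longrightarrow> tr V p q 0 = 0" using linear_between_0[OF lin sub] .
  show "v \<in> sp V q \<Longrightarrow> tr V q q v = v" by (rule idc)
  show "p \<le> q \<Longrightarrow> q \<le> s \<Longrightarrow> v \<in> sp V p \<Longrightarrow> tr V q s (tr V p q v) = tr V p s v"
    by (rule comp)
qed

text \<open>
  This is discretisability along the finite grid generated by \<open>B\<close>.
\<close>

definition tame :: "('n::finite \<times> 'a::index_coord) set \<Rightarrow> ('a^'n, 'v) pmod \<Rightarrow> bool" where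
  "tame B V \<longleftrightarrow> V \<in> pers index_order \<and> finite B \<and>
     (\<forall>q q'. q \<le> q' \<longrightarrow> key B q = key B q' \<longrightarrow> bij_betw (tr V q q') (sp V q) (sp V q')) \<and>
     (\<forall>q. \<not> full B q \<longrightarrow> sp V q = {0})"

lemma
  assumes "tame B V"
  shows tame_pers: "V \<in> pers index_order" and tame_finite: "finite B"
    and tame_bij: "q \<le> q' \<Longrightarrow> key B q = key B q' \<Longrightarrow> bij_betw (tr V q q') (sp V q) (sp V q')"
    and tame_zero: "\<not> full B q \<Longrightarrow> sp V q = {0}"
  using assms by (auto simp: tame_def)

lemma tame_mono: "tame A V \<Longrightarrow> A \<subseteq> B \<Longrightarrow> finite B \<Longrightarrow> tame B V"
  unfolding tame_def
  by (intro conjI allI impI) (auto dest: key_eq_mono[of B _ _ A] full_mono[of A _ B])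

lemma
  assumes "is_left_kan r f U L \<eta>" "X \<in> pers index_order" "is_hom r U (pullback f X) \<alpha>"
  shows left_kan_extend: "\<exists>\<beta>. is_hom index_order L X \<beta> \<and>
      (\<forall>p\<in>Field r. \<forall>u\<in>sp U p. \<beta> (f p) (\<eta> p u) = \<alpha> p u)"
    and left_kan_unique:
      "is_hom index_order L X \<beta>\<^sub>1 \<Longrightarrow> \<forall>p\<in>Field r. \<forall>u\<in>sp U p. \<beta>\<^sub>1 (f p) (\<eta> p u) = \<alpha> p u \<Longrightarrow>
       is_hom index_order L X \<beta>\<^sub>2 \<Longrightarrow> \<forall>p\<in>Field r. \<forall>u\<in>sp U p. \<beta>\<^sub>2 (f p) (\<eta> p u) = \<alpha> p u \<Longrightarrow>
       v \<in> sp L q \<Longrightarrow> \<beta>\<^sub>1 q v = \<beta>\<^sub>2 q v"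
proof -
  note K = assms(1)[unfolded is_left_kan_def, THEN conjunct2, rule_format, OF assms(2,3)]
  obtain \<beta> where \<beta>: "is_hom index_order L X \<beta> \<and>
      (\<forall>p\<in>Field r. \<forall>u\<in>sp U p. \<beta> (f p) (\<eta> p u) = \<alpha> p u) \<and>
      (\<forall>\<beta>'. is_hom index_order L X \<beta>' \<and> (\<forall>p\<in>Field r. \<forall>u\<in>sp U p. \<beta>' (f p) (\<eta> p u) = \<alpha> p u) \<longrightarrow>
        (\<forall>q. \<forall>v\<in>sp L q. \<beta>' q v = \<beta> q v))"
    using K by (rule exE)
  then show "\<exists>\<beta>. is_hom index_order L X \<beta> \<and>
      (\<forall>p\<in>Field r. \<forall>u\<in>sp U p. \<beta> (f p) (\<eta> p u) = \<alpha> p u)" by (intro exI[of _ \<beta>]) simp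
  show "is_hom index_order L X \<beta>\<^sub>1 \<Longrightarrow> \<forall>p\<in>Field r. \<forall>u\<in>sp U p. \<beta>\<^sub>1 (f p) (\<eta> p u) = \<alpha> p u \<Longrightarrow>
       is_hom index_order L X \<beta>\<^sub>2 \<Longrightarrow> \<forall>p\<in>Field r. \<forall>u\<in>sp U p. \<beta>\<^sub>2 (f p) (\<eta> p u) = \<alpha> p u \<Longrightarrow>
       v \<in> sp L q \<Longrightarrow> \<beta>\<^sub>1 q v = \<beta>\<^sub>2 q v"
    using \<beta>[THEN conjunct2, THEN conjunct2, rule_format, of \<beta>\<^sub>1 v q]
      \<beta>[THEN conjunct2, THEN conjunct2, rule_format, of \<beta>\<^sub>2 v q] by simp
qed

text \<open>
  Let \<open>X\<close> be the discretisation of \<open>L\<close> along the grid generated by the image of \<open>f\<close>: its value at \<open>q\<close> is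
  the value of \<open>L\<close> at the largest grid point below \<open>q\<close>. The structure maps of \<open>L\<close> give \<open>\<iota> : X \<rightarrow> L\<close>, and the
  universal property gives \<open>\<beta> : L \<rightarrow> X\<close>. By uniqueness \<open>\<iota> \<circ> \<beta>\<close> is the identity. As \<open>\<iota>\<close> is the identity at
  grid points, so is \<open>\<beta>\<close>, and naturality then makes \<open>\<beta>\<close> inverse to \<open>\<iota>\<close> everywhere.
\<close>

lemma left_kan_tame:
  fixes L :: "('a::index_coord^'n::finite, 'v) pmod"
  assumes L: "L \<in> pers index_order" and fin: "finite (Field r)"
    and kan: "is_left_kan r f U L \<eta>"
  shows "tame {(i, f p $ i) | i p. p \<in> Field r} L"
proof -
  define B where "B = {(i, f p $ i) | i p. p \<in> Field r}"
  have "B = (\<lambda>(i, p). (i, f p $ i)) ` (UNIV \<times> Field r)" by (auto simp: B_def)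
  then have fB: "finite B" using fin by simp
  let ?fl = "floor_pt B"
  have gr: "full B (f p)" "?fl (f p) = f p" if "p \<in> Field r" for p
    using floor_pt_grid[OF fB, of "f p"] that by (auto simp: B_def)
  define X where "X = \<lparr>sp = (\<lambda>q. if full B q then sp L (?fl q) else {0}),
      tr = (\<lambda>q q' v. if full B q then tr L (?fl q) (?fl q') v else 0)\<rparr>"
  have spX: "sp X q = (if full B q then sp L (?fl q) else {0})" for q by (simp add: X_def)
  have trX: "tr X q q' v = (if full B q then tr L (?fl q) (?fl q') v else 0)" for q q' v
    by (simp add: X_def)
  note fle = floor_pt_le[OF fB] and fmono = floor_pt_mono[OF fB]
  have X: "X \<in> pers index_order"
    unfolding pers_index_iff
  proof (intro conjI allI impI ballI)
    show "fin_subspace (sp X q)" for q using pers_fin[OF L] fin_subspace_zero by (simp add: spX)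
    show "linear_between (sp X p) (sp X q) (tr X p q)" if "p \<le> q" for p q
    proof (cases "full B p")
      case True
      then have "full B q" using full_le that by blast
      then show ?thesis using True pers_linear[OF L fmono[OF True that]]
        by (simp add: spX trX[abs_def])
    next
      case False
      then show ?thesis using pers_zero[OF L] by (auto simp: spX trX linear_between_def)
    qed
    show "tr X q q v = v" if "v \<in> sp X q" for q v
      using that pers_id[OF L] by (auto simp: spX trX split: if_splits)
    show "tr X q s (tr X p q v) = tr X p s v" if "p \<le> q" "q \<le> s" "v \<in> sp X p" for p q s v
    proof (cases "full B p")
      case True
      then have q: "full B q" using full_le that by blast
      show ?thesis using True q that pers_comp[OF L fmono[OF True that(1)] fmono[OF q that(2)]]
        by (simp add: spX trX)
    next
      case False
      then show ?thesis using pers_tr0[OF L fmono[OF _ that(2)]] by (simp add: spX trX)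
    qed
  qed
  define \<iota> where "\<iota> = (\<lambda>q v. if full B q then tr L (?fl q) q v else 0)"
  have \<iota>: "is_hom index_order X L \<iota>"
    unfolding is_hom_index_iff
  proof (intro conjI allI impI ballI)
    show "linear_between (sp X p) (sp L p) (\<iota> p)" for p
    proof (cases "full B p")
      case True
      then show ?thesis using pers_linear[OF L fle[OF True]]
        by (simp add: spX \<iota>_def)
    next
      case False
      then show ?thesis using pers_zero[OF L] by (auto simp: spX \<iota>_def linear_between_def)
    qed
    show "\<iota> q (tr X p q v) = tr L p q (\<iota> p v)" if "p \<le> q" "v \<in> sp X p" for p q v
    proof (cases "full B p")
      case True
      then have q: "full B q" using full_le that by blast
      show ?thesis using True q that pers_comp[OF L fle[OF True] that(1)]
          pers_comp[OF L fmono[OF True that(1)] fle[OF q]]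
        by (simp add: spX trX \<iota>_def)
    next
      case False
      then show ?thesis using pers_tr0[OF L that(1)] pers_tr0[OF L fle] by (simp add: trX \<iota>_def)
    qed
  qed
  have \<eta>: "is_hom r U (pullback f L) \<eta>" using kan by (simp add: is_left_kan_def)
  have \<eta>X: "is_hom r U (pullback f X) \<eta>"
    unfolding is_hom_def
  proof (intro conjI ballI)
    show "linear_between (sp U p) (sp (pullback f X) p) (\<eta> p)" if "p \<in> Field r" for p
      using \<eta> that gr[OF that] by (simp add: is_hom_def pullback_def spX)
    show "case z of (p, q) \<Rightarrow> \<forall>v\<in>sp U p. \<eta> q (tr U p q v) = tr (pullback f X) p q (\<eta> p v)"
      if "z \<in> r" for z
    proof -
      obtain p q where z: "z = (p, q)" by force
      then have "p \<in> Field r" "q \<in> Field r" using that by (auto simp: Field_def)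
      then show ?thesis using \<eta> that gr z by (auto simp: is_hom_def pullback_def trX)
    qed
  qed
  obtain \<beta> where \<beta>: "is_hom index_order L X \<beta>"
    and \<beta>\<eta>: "\<forall>p\<in>Field r. \<forall>u\<in>sp U p. \<beta> (f p) (\<eta> p u) = \<eta> p u"
    using left_kan_extend[OF kan X \<eta>X] by (elim exE conjE) (rule that)
  have id_hom: "is_hom index_order L L (\<lambda>q v. v)"
    unfolding is_hom_index_iff by (simp add: linear_between_def)
  have comp_hom: "is_hom index_order L L (\<lambda>q v. \<iota> q (\<beta> q v))"
    unfolding is_hom_index_iff
  proof (intro conjI allI impI ballI)
    show "linear_between (sp L p) (sp L p) (\<lambda>v. \<iota> p (\<beta> p v))" for p
      by (rule linear_between_comp[OF hom_linear[OF \<beta>] hom_linear[OF \<iota>]])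
    show "\<iota> q (\<beta> q (tr L p q v)) = tr L p q (\<iota> p (\<beta> p v))" if "p \<le> q" "v \<in> sp L p" for p q v
      using hom_comm[OF \<beta> that] hom_comm[OF \<iota> that(1) hom_in[OF \<beta> that(2)]] by simp
  qed
  have \<eta>L: "\<eta> p u \<in> sp L (f p)" if "p \<in> Field r" "u \<in> sp U p" for p u
  proof -
    have "linear_between (sp U p) (sp L (f p)) (\<eta> p)"
      using \<eta> that(1) by (simp add: is_hom_def pullback_def)
    then show ?thesis using that(2) by (rule linear_between_in)
  qed
  have comp\<eta>: "\<iota> (f p) (\<beta> (f p) (\<eta> p u)) = \<eta> p u" if "p \<in> Field r" "u \<in> sp U p" for p u
    using gr[OF that(1)] \<beta>\<eta>[rule_format, OF that] pers_id[OF L \<eta>L[OF that]] by (simp add: \<iota>_def)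
  \<comment> \<open>Both the identity of \<open>L\<close> and the composite through \<open>X\<close> extend \<open>\<eta>\<close>.\<close>
  have retract: "\<iota> q (\<beta> q v) = v" if "v \<in> sp L q" for q v
    by (rule left_kan_unique[OF kan L \<eta> comp_hom _ id_hom]) (use that comp\<eta> in auto)
  have bij_floor: "bij_betw (tr L (?fl q) q) (sp L (?fl q)) (sp L q)" if q: "full B q" for q
  proof (rule bij_betw_byWitness[where f' = "\<beta> q"])
    have \<beta>q: "\<beta> q v \<in> sp L (?fl q)" if "v \<in> sp L q" for v
      using hom_in[OF \<beta> that] q by (simp add: spX)
    have flfl: "full B (?fl q)" "?fl (?fl q) = ?fl q"
      using floor_pt_grid[OF fB, of "?fl q"] floor_pt_mem[OF fB q] by auto
    show "\<forall>v\<in>sp L (?fl q). \<beta> q (tr L (?fl q) q v) = v"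
    proof
      fix v assume v: "v \<in> sp L (?fl q)"
      have b: "\<beta> (?fl q) v \<in> sp L (?fl q)"
        using hom_in[OF \<beta> v] flfl by (simp add: spX)
      have 1: "\<beta> (?fl q) v = v"
        using retract[OF v] flfl pers_id[OF L b] by (simp add: \<iota>_def)
      have "\<beta> q (tr L (?fl q) q v) = tr X (?fl q) q (\<beta> (?fl q) v)"
        using \<beta> fle[OF q] v by (simp add: is_hom_index_iff)
      also have "\<dots> = v" using 1 flfl pers_id[OF L v] by (simp add: trX)
      finally show "\<beta> q (tr L (?fl q) q v) = v" .
    qed
    show "\<forall>v\<in>sp L q. tr L (?fl q) q (\<beta> q v) = v"
    proof
      show "tr L (?fl q) q (\<beta> q v) = v" if "v \<in> sp L q" for v
        using retract[OF that] q by (simp add: \<iota>_def)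
    qed
    show "tr L (?fl q) q ` sp L (?fl q) \<subseteq> sp L q" using pers_tr[OF L fle[OF q]] by blast
    show "\<beta> q ` sp L q \<subseteq> sp L (?fl q)" using \<beta>q by blast
  qed
  have zero: "sp L q = {0}" if "\<not> full B q" for q
    using retract[of _ q] that pers_zero[OF L] by (auto simp: \<iota>_def)
  have "bij_betw (tr L q q') (sp L q) (sp L q')" if le: "q \<le> q'" and k: "key B q = key B q'" for q q'
  proof (cases "full B q")
    case True
    then have q': "full B q'" and fl: "?fl q' = ?fl q" using full_key[OF k] floor_pt_key[OF k] by auto
    have "bij_betw (\<lambda>v. tr L q q' (tr L (?fl q) q v)) (sp L (?fl q)) (sp L q')"
      using bij_floor[OF q', unfolded fl] pers_comp[OF L fle[OF True] le]
      by (simp cong: bij_betw_cong)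
    then have "bij_betw (tr L q q' \<circ> tr L (?fl q) q) (sp L (?fl q)) (sp L q')"
      by (simp add: comp_def)
    then show ?thesis using bij_betw_comp_iff[OF bij_floor[OF True]] by blast
  next
    case False
    then have "\<not> full B q'" using full_key[OF k] by auto
    then show ?thesis using zero False pers_tr0[OF L le] by (simp add: bij_betw_def)
  qed
  then show ?thesis using L fB zero unfolding tame_def B_def by blast
qed

text \<open>
  A morphism out of \<open>V\<close> is prescribed by \<open>\<alpha>\<close> at the grid points. At any other point \<open>q\<close> it is forced by
  naturality, because the structure map from the largest grid point below \<open>q\<close> is invertible.
\<close>

lemma tame_is_left_kan:
  fixes V :: "('a::index_coord^'n::finite, 'v) pmod"
  assumes V: "tame B V" and e: "bij_betw e N {q. \<forall>i. (i, q $ i) \<in> B}"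
  shows "is_left_kan {(m, n). m \<in> N \<and> n \<in> N \<and> e m \<le> e n} e (pullback e V) V (\<lambda>p v. v)"
    (is "is_left_kan ?r _ _ _ _")
proof -
  have Fr: "Field ?r = N" by (auto simp: Field_def)
  note L = tame_pers[OF V] and fB = tame_finite[OF V]
  let ?fl = "floor_pt B"
  note fle = floor_pt_le[OF fB] and fmono = floor_pt_mono[OF fB]
  define d where "d q = inv_into N e (?fl q)" for q
  have d: "d q \<in> N" "e (d q) = ?fl q" if "full B q" for q
  proof -
    have "?fl q \<in> e ` N" using floor_pt_mem[OF fB that] bij_betw_imp_surj_on[OF e] by auto
    then show "d q \<in> N" "e (d q) = ?fl q" by (auto simp: d_def inv_into_into f_inv_into_f)
  qed
  have bij: "bij_betw (tr V (?fl q) q) (sp V (?fl q)) (sp V q)" if "full B q" for q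
    using tame_bij[OF V fle[OF that] key_floor_pt[OF fB that]] .
  define u where "u q = inv_into (sp V (?fl q)) (tr V (?fl q) q)" for q
  have u: "u q v \<in> sp V (?fl q)" "tr V (?fl q) q (u q v) = v" if "full B q" "v \<in> sp V q" for q v
    using bij[OF that(1)] that(2) by (auto simp: u_def bij_betw_def inv_into_into f_inv_into_f)
  have u_eq: "u q (tr V (?fl q) q w) = w" if "full B q" "w \<in> sp V (?fl q)" for q w
    using bij[OF that(1)] that(2) by (simp add: u_def bij_betw_def)
  show ?thesis
    unfolding is_left_kan_def Fr
  proof (intro conjI ballI allI impI)
    show "is_hom ?r (pullback e V) (pullback e V) (\<lambda>p v. v)"
      by (auto simp: is_hom_def pullback_def linear_between_def)
    fix X \<alpha> assume X: "X \<in> pers (index_order :: ('a^'n) rel)"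
      and \<alpha>: "is_hom ?r (pullback e V) (pullback e X) \<alpha>"
    have \<alpha>lin: "linear_between (sp V (e p)) (sp X (e p)) (\<alpha> p)" if "p \<in> N" for p
      using \<alpha> that Fr by (simp add: is_hom_def pullback_def)
    have \<alpha>nat: "\<alpha> q (tr V (e p) (e q) v) = tr X (e p) (e q) (\<alpha> p v)"
      if "p \<in> N" "q \<in> N" "e p \<le> e q" "v \<in> sp V (e p)" for p q v
      using \<alpha> that by (auto simp: is_hom_def pullback_def)
    have \<alpha>in: "\<alpha> p v \<in> sp X (e p)" if "p \<in> N" "v \<in> sp V (e p)" for p v
      using \<alpha>lin[OF that(1)] that(2) by (auto simp: linear_between_def)
    define \<beta> where "\<beta> = (\<lambda>q v. if full B q then tr X (?fl q) q (\<alpha> (d q) (u q v)) else 0)"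
    have ulin: "linear_between (sp V q) (sp V (?fl q)) (u q)" if q: "full B q" for q
    proof -
      have lin: "linear_between (sp V (?fl q)) (sp V q) (tr V (?fl q) q)"
        using pers_linear[OF L fle[OF q]] .
      have sub: "subspace (sp V (?fl q))" using pers_sub[OF L] .
      have "u q (x + y) = u q x + u q y" if xy: "x \<in> sp V q" "y \<in> sp V q" for x y
      proof -
        have "tr V (?fl q) q (u q x + u q y) = x + y"
          using lin u[OF q xy(1)] u[OF q xy(2)] unfolding linear_between_def by simp
        then show ?thesis using u_eq[OF q] u(1)[OF q] xy subspace_add[OF sub] by metis
      qed
      moreover have "u q (scale c x) = scale c (u q x)" if x: "x \<in> sp V q" for c x
      proof -
        have "tr V (?fl q) q (scale c (u q x)) = scale c x"
          using lin u[OF q x] unfolding linear_between_def by simp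
        then show ?thesis using u_eq[OF q] u(1)[OF q x] subspace_scale[OF sub] by metis
      qed
      ultimately show ?thesis using u(1)[OF q] by (auto simp: linear_between_def)
    qed
    have \<beta>hom: "is_hom index_order V X \<beta>"
      unfolding is_hom_index_iff
    proof (intro conjI allI impI ballI)
      show "linear_between (sp V q) (sp X q) (\<beta> q)" for q
      proof (cases "full B q")
        case True
        have "linear_between (sp V q) (sp X q) (\<lambda>v. tr X (?fl q) q (\<alpha> (d q) (u q v)))"
          using linear_between_comp[OF linear_between_comp[OF ulin[OF True]]]
            \<alpha>lin[OF d(1)[OF True]] d(2)[OF True] pers_linear[OF X fle[OF True]] by metis
        then show ?thesis using True by (simp add: \<beta>_def)
      next
        case False
        then show ?thesis using tame_zero[OF V] pers_zero[OF X]
          by (auto simp: \<beta>_def linear_between_def)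
      qed
      show "\<beta> q (tr V p q v) = tr X p q (\<beta> p v)" if le: "p \<le> q" and v: "v \<in> sp V p" for p q v
      proof (cases "full B p")
        case p: True
        then have q: "full B q" using full_le le by blast
        have uv: "u p v \<in> sp V (?fl p)" using u(1)[OF p v] .
        have "tr V (?fl q) q (tr V (?fl p) (?fl q) (u p v)) = tr V p q v"
          using pers_comp[OF L fmono[OF p le] fle[OF q] uv] pers_comp[OF L fle[OF p] le uv] u(2)[OF p v]
          by simp
        then have "u q (tr V p q v) = tr V (?fl p) (?fl q) (u p v)"
          using u_eq[OF q] pers_tr[OF L fmono[OF p le] uv] by metis
        then have "\<alpha> (d q) (u q (tr V p q v)) = tr X (?fl p) (?fl q) (\<alpha> (d p) (u p v))"
          using \<alpha>nat[OF d(1)[OF p] d(1)[OF q]] d(2)[OF p] d(2)[OF q] fmono[OF p le] uv by simp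
        moreover have "\<alpha> (d p) (u p v) \<in> sp X (?fl p)"
          using \<alpha>in[OF d(1)[OF p]] d(2)[OF p] uv by simp
        ultimately show ?thesis
          using p q pers_comp[OF X fmono[OF p le] fle[OF q]] pers_comp[OF X fle[OF p] le]
          by (simp add: \<beta>_def)
      next
        case False
        then have "v = 0" using tame_zero[OF V] v by auto
        then have "tr V p q v = 0" using pers_tr0[OF L le] by simp
        moreover have "\<beta> q 0 = 0"
        proof (cases "full B q")
          case True
          have "u q 0 = 0" using linear_between_0[OF ulin[OF True] pers_sub[OF L]] .
          moreover have "\<alpha> (d q) 0 = 0" using linear_between_0[OF \<alpha>lin[OF d(1)[OF True]] pers_sub[OF L]] .
          ultimately show ?thesis using pers_tr0[OF X fle[OF True]] by (simp add: \<beta>_def)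
        qed (simp add: \<beta>_def)
        ultimately show ?thesis using False pers_tr0[OF X le] by (simp add: \<beta>_def)
      qed
    qed
    have \<beta>e: "\<forall>p\<in>N. \<forall>w\<in>sp (pullback e V) p. \<beta> (e p) w = \<alpha> p w"
    proof (intro ballI)
      fix p w assume p: "p \<in> N" and "w \<in> sp (pullback e V) p"
      then have w: "w \<in> sp V (e p)" by (simp add: pullback_def)
      have "e p \<in> {q. \<forall>i. (i, q $ i) \<in> B}" using e p by (auto simp: bij_betw_def)
      then have ep: "full B (e p)" "?fl (e p) = e p" using floor_pt_grid[OF fB, of "e p"] by auto
      then have "d (e p) = p" using e p by (simp add: d_def bij_betw_def)
      moreover have "u (e p) w = w" using u_eq[of "e p" w] ep w pers_id[OF L w] by simp
      ultimately show "\<beta> (e p) w = \<alpha> p w" using ep pers_id[OF X \<alpha>in[OF p w]] by (simp add: \<beta>_def)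
    qed
    have uniq: "\<beta>' q v = \<beta> q v" if \<beta>': "is_hom index_order V X \<beta>'"
        "\<forall>p\<in>N. \<forall>w\<in>sp (pullback e V) p. \<beta>' (e p) w = \<alpha> p w" and v: "v \<in> sp V q" for \<beta>' q v
    proof (cases "full B q")
      case True
      have "\<beta>' q v = \<beta>' q (tr V (?fl q) q (u q v))" using u(2)[OF True v] by simp
      also have "\<dots> = tr X (?fl q) q (\<beta>' (?fl q) (u q v))"
        using \<beta>'(1) fle[OF True] u(1)[OF True v] by (simp add: is_hom_index_iff)
      also have "\<beta>' (?fl q) (u q v) = \<alpha> (d q) (u q v)"
        using \<beta>'(2) d[OF True] u(1)[OF True v] by (force simp: pullback_def)
      finally show ?thesis using True by (simp add: \<beta>_def)
    next
      case False
      then have "v = 0" using tame_zero[OF V] v by auto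
      then show ?thesis
        using False linear_between_0[OF _ pers_sub[OF L]] \<beta>'(1) by (auto simp: \<beta>_def is_hom_index_iff)
    qed
    show "\<exists>\<beta>. is_hom index_order V X \<beta> \<and>
          (\<forall>p\<in>N. \<forall>w\<in>sp (pullback e V) p. \<beta> (e p) w = \<alpha> p w) \<and>
          (\<forall>\<beta>'. is_hom index_order V X \<beta>' \<and>
               (\<forall>p\<in>N. \<forall>w\<in>sp (pullback e V) p. \<beta>' (e p) w = \<alpha> p w) \<longrightarrow>
               (\<forall>q. \<forall>v\<in>sp V q. \<beta>' q v = \<beta> q v))"
      using \<beta>hom \<beta>e uniq by blast
  qed
qed

lemma finite_grid_points:
  assumes "finite (B :: ('n::finite \<times> 'a) set)" shows "finite {q :: 'a^'n. \<forall>i. (i, q $ i) \<in> B}"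
proof -
  have "finite (PiE UNIV (\<lambda>i::'n. {a. (i, a) \<in> B}))"
    using finite_thresholds[OF assms, of _ "\<lambda>_. True"] by (intro finite_PiE) auto
  moreover have "{q :: 'a^'n. \<forall>i. (i, q $ i) \<in> B} \<subseteq> vec_lambda ` PiE UNIV (\<lambda>i. {a. (i, a) \<in> B})"
  proof
    fix q :: "'a^'n" assume "q \<in> {q. \<forall>i. (i, q $ i) \<in> B}"
    then show "q \<in> vec_lambda ` PiE UNIV (\<lambda>i. {a. (i, a) \<in> B})"
      by (intro image_eqI[of _ _ "vec_nth q"]) (auto simp: vec_nth_inverse PiE_def)
  qed
  ultimately show ?thesis using finite_surj by blast
qed

theorem pers_fp_iff_tame:
  fixes V :: "('a::index_coord^'n::finite, 'v) pmod"
  shows "V \<in> pers_fp \<longleftrightarrow> (\<exists>B. tame B V)"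
proof
  assume "V \<in> pers_fp"
  then show "\<exists>B. tame B V" unfolding pers_fp_def using left_kan_tame by blast
next
  assume "\<exists>B. tame B V"
  then obtain B where V: "tame B V" by blast
  let ?P = "{q. \<forall>i. (i, q $ i) \<in> B}"
  have "finite ?P" using finite_grid_points[OF tame_finite[OF V]] .
  then obtain e and k :: nat where e: "bij_betw e {..<k} ?P"
    using ex_bij_betw_nat_finite[of ?P] by (auto simp: atLeast0LessThan)
  let ?r = "{(m, n). m \<in> {..<k} \<and> n \<in> {..<k} \<and> e m \<le> e n}"
  have Fr: "Field ?r = {..<k}" by (auto simp: Field_def)
  have inj: "inj_on e {..<k}" using e by (simp add: bij_betw_def)
  have "Partial_order ?r"
    unfolding partial_order_on_def preorder_on_def Fr
  proof (intro conjI)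
    show "refl_on {..<k} ?r" by (auto simp: refl_on_def)
    show "trans ?r" by (auto simp: trans_def intro: order_trans)
    show "antisym ?r" using inj by (auto simp: antisym_def dest!: inj_onD[OF inj])
  qed (auto)
  moreover have "order_preserving ?r index_order e" by (auto simp: order_preserving_def)
  moreover have "pullback e V \<in> pers ?r"
    unfolding pers_def Fr
    using tame_pers[OF V] pers_fin[OF tame_pers[OF V]] pers_linear[OF tame_pers[OF V]]
      pers_id[OF tame_pers[OF V]] pers_comp[OF tame_pers[OF V]]
    by (auto simp: pullback_def fin_subspace_def)
  ultimately show "V \<in> pers_fp"
    unfolding pers_fp_def using tame_pers[OF V] tame_is_left_kan[OF V e] Fr finite_lessThan
    by (metis (mono_tags, lifting) mem_Collect_eq)
qed

end

section \<open>Subobjects and quotients\<close>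

definition step_fun :: "('n \<times> 'a::order) set \<Rightarrow> ('a^'n \<Rightarrow> real) \<Rightarrow> bool" where
  "step_fun B h \<longleftrightarrow> (\<forall>q q'. key B q = key B q' \<longrightarrow> h q = h q')"

lemma step_funD: "step_fun B h \<Longrightarrow> key B q = key B q' \<Longrightarrow> h q = h q'"
  unfolding step_fun_def by blast

lemma step_fun_mono: "step_fun A h \<Longrightarrow> A \<subseteq> B \<Longrightarrow> step_fun B h"
  unfolding step_fun_def using key_eq_mono by blast

context persistence
begin

definition dimfun :: "('q \<Rightarrow> 'v set) \<Rightarrow> 'q \<Rightarrow> real" where
  "dimfun S = (\<lambda>q. real (dim (S q)))"

definition submod :: "('q::order, 'v) pmod \<Rightarrow> ('q \<Rightarrow> 'v set) \<Rightarrow> bool" where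
  "submod V S \<longleftrightarrow> (\<forall>q. subspace (S q) \<and> S q \<subseteq> sp V q) \<and> (\<forall>p q. p \<le> q \<longrightarrow> tr V p q ` S p \<subseteq> S q)"

lemma submodI:
  "(\<And>q. subspace (S q)) \<Longrightarrow> (\<And>q v. v \<in> S q \<Longrightarrow> v \<in> sp V q) \<Longrightarrow>
   (\<And>p q v. p \<le> q \<Longrightarrow> v \<in> S p \<Longrightarrow> tr V p q v \<in> S q) \<Longrightarrow> submod V S"
  by (auto simp: submod_def)

lemma
  assumes "submod V S"
  shows submod_sub: "subspace (S q)" and submod_le: "S q \<subseteq> sp V q"
    and submod_in: "v \<in> S q \<Longrightarrow> v \<in> sp V q"
    and submod_tr: "p \<le> q \<Longrightarrow> v \<in> S p \<Longrightarrow> tr V p q v \<in> S q"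
    and submod_zero: "0 \<in> S q"
proof -
  show "subspace (S q)" "S q \<subseteq> sp V q" using assms by (simp_all add: submod_def)
  then show "v \<in> S q \<Longrightarrow> v \<in> sp V q" "0 \<in> S q" using subspace_0 by auto
  show "p \<le> q \<Longrightarrow> v \<in> S p \<Longrightarrow> tr V p q v \<in> S q"
    using assms unfolding submod_def by (meson image_subset_iff)
qed

text \<open>
  Within a cell the structure maps of an ambient tame module are injective and preserve submodules,
  so this inclusion makes the submodule constant on cells.
\<close>

definition stepwise ::
    "('n \<times> 'a::index_coord) set \<Rightarrow> ('a^'n, 'v) pmod \<Rightarrow> ('a^'n \<Rightarrow> 'v set) \<Rightarrow> bool" where
  "stepwise B V S \<longleftrightarrow> (\<forall>q q'. q \<le> q' \<longrightarrow> key B q = key B q' \<longrightarrow> S q' \<subseteq> tr V q q' ` S q)"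

lemma stepwiseD: "stepwise B V S \<Longrightarrow> q \<le> q' \<Longrightarrow> key B q = key B q' \<Longrightarrow> S q' \<subseteq> tr V q q' ` S q"
  unfolding stepwise_def by blast

lemma stepwise_mono: "stepwise A V S \<Longrightarrow> A \<subseteq> B \<Longrightarrow> stepwise B V S"
  unfolding stepwise_def using key_eq_mono by blast

lemma stepwise_image:
  assumes "submod V S" "stepwise B V S" "q \<le> q'" "key B q = key B q'"
  shows "tr V q q' ` S q = S q'"
  using stepwiseD[OF assms(2-4)] submod_tr[OF assms(1,3)] by auto

lemma submod_fin:
  assumes "V \<in> pers index_order" "submod V S" shows "fin_subspace (S q)"
  using fin_subspace_subset[OF pers_fin[OF assms(1)] submod_sub[OF assms(2)] submod_le[OF assms(2)]] .

lemma submod_pers: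
  assumes "V \<in> pers index_order" "submod V S" shows "V\<lparr>sp := S\<rparr> \<in> pers index_order"
  unfolding pers_index_iff
proof (intro conjI allI impI ballI)
  show "fin_subspace (sp (V\<lparr>sp := S\<rparr>) q)" for q using submod_fin[OF assms] by simp
  show "linear_between (sp (V\<lparr>sp := S\<rparr>) p) (sp (V\<lparr>sp := S\<rparr>) q) (tr (V\<lparr>sp := S\<rparr>) p q)"
    if "p \<le> q" for p q
    using linear_between_subset[OF pers_linear[OF assms(1) that] submod_le[OF assms(2)], of "S q"]
      submod_tr[OF assms(2) that] by auto
qed (use pers_id[OF assms(1)] pers_comp[OF assms(1)] submod_in[OF assms(2)] in auto)

lemma submod_tame:
  assumes V: "tame B V" and S: "submod V S" "stepwise B V S"
  shows "tame B (V\<lparr>sp := S\<rparr>)"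
  unfolding tame_def
proof (intro conjI allI impI)
  show "V\<lparr>sp := S\<rparr> \<in> pers index_order" using submod_pers[OF tame_pers[OF V] S(1)] .
  show "finite B" using tame_finite[OF V] .
  show "bij_betw (tr (V\<lparr>sp := S\<rparr>) q q') (sp (V\<lparr>sp := S\<rparr>) q) (sp (V\<lparr>sp := S\<rparr>) q')"
    if "q \<le> q'" "key B q = key B q'" for q q'
    using tame_bij[OF V that] stepwise_image[OF S that] submod_le[OF S(1)]
    by (auto simp: bij_betw_def intro: inj_on_subset)
  show "sp (V\<lparr>sp := S\<rparr>) q = {0}" if "\<not> full B q" for q
    using tame_zero[OF V that] submod_le[OF S(1), of q] submod_zero[OF S(1), of q] by auto
qed

lemma subobject_submod: "subobject V S \<Longrightarrow> submod V S"
  by (simp add: subobject_def submod_def)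

lemma subobjectI:
  fixes V :: "('a::index_coord^'n::finite, 'v) pmod"
  assumes "tame B V" "submod V S" "stepwise B V S" shows "subobject V S"
  using submod_tame[OF assms] assms(2) pers_fp_iff_tame by (auto simp: subobject_def submod_def)

lemma subobject_stepwise:
  fixes V :: "('a::index_coord^'n::finite, 'v) pmod"
  assumes "subobject V S" obtains A where "finite A" "stepwise A V S"
proof -
  obtain A where A: "tame A (V\<lparr>sp := S\<rparr>)" using assms unfolding subobject_def pers_fp_iff_tame by blast
  have "stepwise A V S"
    unfolding stepwise_def using tame_bij[OF A] by (simp add: bij_betw_def)
  then show ?thesis using that tame_finite[OF A] by blast
qed

lemma subobject_thresholds:
  fixes V :: "('a::index_coord^'n::finite, 'v) pmod"
  assumes "subobject V S" "finite A" obtains B where "A \<subseteq> B" "finite B" "stepwise B V S"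
proof -
  obtain C where "finite C" "stepwise C V S" using subobject_stepwise[OF assms(1)] .
  then show ?thesis using that[of "A \<union> C"] stepwise_mono[of C V S "A \<union> C"] assms(2) by auto
qed

lemma subobject_fp: "subobject V S \<Longrightarrow> V\<lparr>sp := S\<rparr> \<in> pers_fp"
  by (simp add: subobject_def)

lemma fp_pers: "V \<in> pers_fp \<Longrightarrow> V \<in> pers index_order"
  by (simp add: pers_fp_def)

lemma subobject_self: "V \<in> pers_fp \<Longrightarrow> subobject V (sp V)"
  using pers_tr[OF fp_pers] pers_sub[OF fp_pers] by (auto simp: subobject_def)

lemma subobject_zero:
  fixes V :: "('a::index_coord^'n::finite, 'v) pmod"
  assumes "V \<in> pers_fp" shows "subobject V (\<lambda>_. {0})"
proof -
  obtain B where B: "tame B V" using assms pers_fp_iff_tame by blast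
  note L = tame_pers[OF B]
  show ?thesis
    by (rule subobjectI[OF B]) (auto simp: stepwise_def pers_tr0[OF L] pers_zero[OF L] intro!: submodI)
qed

lemma subobject_of_subobject:
  "subobject V F \<Longrightarrow> subobject (V\<lparr>sp := F\<rparr>) S \<longleftrightarrow> subobject V S \<and> S \<le> F"
  unfolding subobject_def le_fun_def by simp (meson order_trans)

lemma subobject_le: "subobject V S \<Longrightarrow> S \<le> sp V"
  by (auto simp: subobject_def le_fun_def)

lemma zero_pmod_sub: "zero_pmod (V\<lparr>sp := S\<rparr>) \<longleftrightarrow> S = (\<lambda>_. {0})"
  by (auto simp: zero_pmod_def)

lemma dimfun_step:
  fixes V :: "('a::index_coord^'n::finite, 'v) pmod"
  assumes "tame B V" shows "step_fun B (dimfun (sp V))"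
  unfolding step_fun_def
proof (intro allI impI)
  note L = tame_pers[OF assms]
  have le: "dim (sp V q) = dim (sp V q')" if "q \<le> q'" "key B q = key B q'" for q q'
    using tame_bij[OF assms that] dim_image_inj[OF pers_fin[OF L] pers_linear[OF L that(1)]]
    by (simp add: bij_betw_def)
  fix q q' :: "'a^'n" assume k: "key B q = key B q'"
  define m where "m = (\<chi> i. min (q $ i) (q' $ i))"
  have "m \<le> q" "m \<le> q'" by (auto simp: m_def less_eq_vec_def)
  moreover have "key B m = key B q" "key B m = key B q'" using key_inf[OF k] k by (auto simp: m_def)
  ultimately show "dimfun (sp V) q = dimfun (sp V) q'" using le by (metis dimfun_def)
qed

lemma dimfun_sub_step:
  fixes V :: "('a::index_coord^'n::finite, 'v) pmod"
  assumes "tame B V" "submod V S" "stepwise B V S" shows "step_fun B (dimfun S)"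
  using dimfun_step[OF submod_tame[OF assms]] by simp

lemma short_exact_dim:
  fixes B :: "('a::index_coord^'n::finite, 'v) pmod"
  assumes "short_exact A B C \<phi> \<psi>" shows "dimfun (sp B) = (\<lambda>q. dimfun (sp A) q + dimfun (sp C) q)"
proof
  fix q
  note E = assms[unfolded short_exact_def]
  have A: "A \<in> pers index_order" and B: "B \<in> pers index_order" using E fp_pers by auto
  have "dim (sp B q) = dim {v \<in> sp B q. \<psi> q v = 0} + dim (\<psi> q ` sp B q)"
    using rank_nullity[OF pers_fin[OF B] hom_linear[of B C \<psi>]] E by blast
  also have "{v \<in> sp B q. \<psi> q v = 0} = \<phi> q ` sp A q" using E by simp
  also have "dim \<dots> = dim (sp A q)"
    by (rule dim_image_inj[OF pers_fin[OF A] hom_linear[of A B \<phi>]]) (use E in auto)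
  also have "\<psi> q ` sp B q = sp C q" using E by simp
  finally show "dimfun (sp B) q = dimfun (sp A) q + dimfun (sp C) q" by (simp add: dimfun_def)
qed

text \<open>
  The quotient lives on the images of projections with kernel \<open>T\<close>. Its structure maps are those of
  \<open>V\<close> followed by the projection. The choice of projections is not natural, but it only affects
  values by elements of \<open>T\<close>, which the next projection kills.
\<close>

lemma quotient_exists:
  fixes V :: "('a::index_coord^'n::finite, 'v) pmod"
  assumes V: "V \<in> pers_fp" and S: "subobject V S" and T: "subobject V T" and TS: "T \<le> S"
  obtains C \<pi> where "short_exact (V\<lparr>sp := T\<rparr>) (V\<lparr>sp := S\<rparr>) C (\<lambda>_ v. v) \<pi>"
proof -
  obtain A where A: "tame A V" using V pers_fp_iff_tame by blast
  obtain A' where A': "A \<subseteq> A'" "finite A'" "stepwise A' V S"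
    using subobject_thresholds[OF S tame_finite[OF A]] .
  obtain B where B: "A' \<subseteq> B" "finite B" "stepwise B V T" using subobject_thresholds[OF T A'(2)] .
  have VB: "tame B V" using tame_mono[OF A] A' B by simp
  note L = tame_pers[OF VB]
  note S' = subobject_submod[OF S] stepwise_mono[OF A'(3) B(1)]
  note T' = subobject_submod[OF T] B(3)
  have TS': "v \<in> T q \<Longrightarrow> v \<in> S q" for v q using TS by (auto simp: le_fun_def)
  have "\<exists>\<pi>. linear_between (S q) (S q) \<pi> \<and> (\<forall>v\<in>T q. \<pi> v = 0) \<and> (\<forall>v\<in>S q. v - \<pi> v \<in> T q)" for q
  proof -
    have "T q \<subseteq> S q" using TS' by blast
    from projection_exists[OF submod_sub[OF S'(1)] submod_sub[OF T'(1)] this] show ?thesis by metis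
  qed
  then obtain \<pi> where \<pi>lin: "linear_between (S q) (S q) (\<pi> q)" and \<pi>T: "v \<in> T q \<Longrightarrow> \<pi> q v = 0"
    and \<pi>S: "v \<in> S q \<Longrightarrow> v - \<pi> q v \<in> T q" for q v
    by metis
  note \<pi>in = linear_between_in[OF \<pi>lin]
  note \<pi>diff = linear_between_diff[OF \<pi>lin submod_sub[OF S'(1)]]
  have \<pi>\<pi>: "\<pi> q (\<pi> q v) = \<pi> q v" if "v \<in> S q" for q v
    using \<pi>T[OF \<pi>S[OF that]] \<pi>diff[OF that \<pi>in[OF that]] by simp
  have ker: "\<pi> q v = 0 \<longleftrightarrow> v \<in> T q" if "v \<in> S q" for q v using \<pi>T \<pi>S[OF that] by force
  define C where "C = \<lparr>sp = (\<lambda>q. \<pi> q ` S q), tr = (\<lambda>p q v. \<pi> q (tr V p q v))\<rparr>"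
  have spC: "sp C q = \<pi> q ` S q" and trC: "tr C p q v = \<pi> q (tr V p q v)" for p q v
    by (auto simp: C_def)
  have CS: "w \<in> S q \<and> \<pi> q w = w" if "w \<in> sp C q" for q w
    using that \<pi>\<pi> \<pi>in by (auto simp: spC)
  note Str = submod_tr[OF S'(1)]
  have nat: "tr C p q (\<pi> p v) = \<pi> q (tr V p q v)" if le: "p \<le> q" and v: "v \<in> S p" for p q v
  proof -
    have lin: "linear_between (S p) (S q) (tr V p q)"
      using linear_between_subset[OF pers_linear[OF L le] submod_le[OF S'(1)]] Str[OF le] by blast
    have "tr V p q v - tr V p q (\<pi> p v) \<in> T q"
      using linear_between_diff[OF lin submod_sub[OF S'(1)] v \<pi>in[OF v]] submod_tr[OF T'(1) le \<pi>S[OF v]]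
      by simp
    then have "\<pi> q (tr V p q v) - \<pi> q (tr V p q (\<pi> p v)) = 0"
      using \<pi>T \<pi>diff[OF Str[OF le v] Str[OF le \<pi>in[OF v]]] by metis
    then show ?thesis by (simp add: trC)
  qed
  have C: "C \<in> pers index_order"
    unfolding pers_index_iff
  proof (intro conjI allI impI ballI)
    show "fin_subspace (sp C q)" for q
      using fin_subspace_image[OF submod_fin[OF L S'(1)] \<pi>lin] by (simp add: spC)
    show "linear_between (sp C p) (sp C q) (tr C p q)" if le: "p \<le> q" for p q
    proof -
      have "linear_between (sp C p) (S q) (tr V p q)"
        by (rule linear_between_subset[OF pers_linear[OF L le]])
          (use CS submod_in[OF S'(1)] Str[OF le] in auto)
      then have "linear_between (sp C p) (S q) (\<lambda>v. \<pi> q (tr V p q v))"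
        using linear_between_comp[OF _ \<pi>lin] by blast
      then have "linear_between (sp C p) (sp C q) (\<lambda>v. \<pi> q (tr V p q v))"
        by (rule linear_between_subset[OF _ subset_refl]) (intro image_subsetI, unfold spC[of q], intro imageI Str[OF le] CS[THEN conjunct1])
      then show ?thesis by (simp add: C_def)
    qed
    show "tr C q q v = v" if "v \<in> sp C q" for q v
      using CS[OF that] pers_id[OF L submod_in[OF S'(1)]] by (simp add: trC)
    show "tr C q s (tr C p q v) = tr C p s v" if "p \<le> q" "q \<le> s" "v \<in> sp C p" for p q s v
    proof -
      have v: "v \<in> S p" using CS[OF that(3)] by simp
      have "tr C q s (\<pi> q (tr V p q v)) = \<pi> s (tr V q s (tr V p q v))"
        using nat[OF that(2) Str[OF that(1) v]] .
      then show ?thesis using pers_comp[OF L that(1,2) submod_in[OF S'(1) v]] by (simp add: trC)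
    qed
  qed
  have "tame B C"
    unfolding tame_def
  proof (intro conjI allI impI)
    show "bij_betw (tr C q q') (sp C q) (sp C q')" if le: "q \<le> q'" and k: "key B q = key B q'" for q q'
      unfolding bij_betw_def
    proof
      show "inj_on (tr C q q') (sp C q)"
        unfolding linear_between_inj_iff[OF pers_linear[OF C le] pers_sub[OF C]]
      proof (intro ballI impI)
        fix v assume v: "v \<in> sp C q" "tr C q q' v = 0"
        then have vS: "v \<in> S q" "\<pi> q v = v" using CS by auto
        then have "tr V q q' v \<in> T q'" using ker[OF Str[OF le vS(1)]] v(2) by (simp add: trC)
        then obtain t where t: "t \<in> T q" "tr V q q' v = tr V q q' t"
          using stepwiseD[OF T'(2) le k] by blast
        then have "v = t"
          using tame_bij[OF VB le k] submod_in[OF S'(1) vS(1)] submod_in[OF T'(1) t(1)]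
          by (auto simp: bij_betw_def dest: inj_onD)
        then show "v = 0" using \<pi>T t vS by metis
      qed
      show "tr C q q' ` sp C q = sp C q'"
      proof
        show "tr C q q' ` sp C q \<subseteq> sp C q'" using pers_tr[OF C le] by blast
        show "sp C q' \<subseteq> tr C q q' ` sp C q"
        proof
          fix w assume "w \<in> sp C q'"
          then obtain s where "s \<in> S q'" "w = \<pi> q' s" by (auto simp: spC)
          then obtain v where "v \<in> S q" "w = \<pi> q' (tr V q q' v)"
            using stepwiseD[OF S'(2) le k] by blast
          then show "w \<in> tr C q q' ` sp C q" using nat[OF le] by (force simp: spC)
        qed
      qed
    qed
    show "sp C q = {0}" if "\<not> full B q" for q
      using CS[of _ q] submod_in[OF S'(1), of _ q] tame_zero[OF VB that] pers_zero[OF C, of q] by auto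
  qed (use C B in auto)
  then have Cfp: "C \<in> pers_fp" using pers_fp_iff_tame by blast
  have "short_exact (V\<lparr>sp := T\<rparr>) (V\<lparr>sp := S\<rparr>) C (\<lambda>_ v. v) \<pi>"
    unfolding short_exact_def
  proof (intro conjI allI)
    show "is_hom index_order (V\<lparr>sp := T\<rparr>) (V\<lparr>sp := S\<rparr>) (\<lambda>_ v. v)"
      using TS' by (auto simp: is_hom_index_iff linear_between_def)
    show "is_hom index_order (V\<lparr>sp := S\<rparr>) C \<pi>"
      unfolding is_hom_index_iff using nat linear_between_subset[OF \<pi>lin subset_refl] by (simp add: spC)
    show "(\<lambda>v. v) ` sp (V\<lparr>sp := T\<rparr>) q = {v \<in> sp (V\<lparr>sp := S\<rparr>) q. \<pi> q v = 0}" for q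
      using ker TS' by auto
  qed (use subobject_fp[OF S] subobject_fp[OF T] Cfp in \<open>auto simp: spC\<close>)
  then show ?thesis using that by blast
qed

text \<open>
  For \<open>\<phi>\<close> the identity, the next two constructions are the intersection and the sum of subobjects.
\<close>

definition pull_sub :: "('q \<Rightarrow> 'v \<Rightarrow> 'v) \<Rightarrow> ('q \<Rightarrow> 'v set) \<Rightarrow> ('q \<Rightarrow> 'v set) \<Rightarrow> 'q \<Rightarrow> 'v set" where
  "pull_sub \<phi> S T = (\<lambda>q. {s \<in> S q. \<phi> q s \<in> T q})"

definition join_sub :: "('q \<Rightarrow> 'v \<Rightarrow> 'v) \<Rightarrow> ('q \<Rightarrow> 'v set) \<Rightarrow> ('q \<Rightarrow> 'v set) \<Rightarrow> 'q \<Rightarrow> 'v set" where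
  "join_sub \<phi> S T = (\<lambda>q. {t + \<phi> q s | t s. t \<in> T q \<and> s \<in> S q})"

text \<open>
  On the cells of a common refinement of all thresholds involved, the structure maps of \<open>V\<close> and
  \<open>W\<close> are bijective and carry \<open>S\<close> and \<open>T\<close> onto themselves, so they also carry the preimage and the sum
  onto themselves.
\<close>

lemma
  fixes V W :: "('a::index_coord^'n::finite, 'v) pmod"
  assumes V: "V \<in> pers_fp" and W: "W \<in> pers_fp" and \<phi>: "is_hom index_order V W \<phi>"
    and S: "subobject V S" and T: "subobject W T"
  shows subobject_pull: "subobject V (pull_sub \<phi> S T)"
    and subobject_join: "subobject W (join_sub \<phi> S T)"
    and dimfun_join: "dimfun (join_sub \<phi> S T) q + dimfun (pull_sub \<phi> S T) q = dimfun T q + dimfun S q"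
proof -
  obtain A where A: "tame A V" using V pers_fp_iff_tame by blast
  obtain A1 where A1: "tame A1 W" using W pers_fp_iff_tame by blast
  have fin: "finite (A \<union> A1)" using tame_finite[OF A] tame_finite[OF A1] by simp
  obtain A2 where A2: "A \<union> A1 \<subseteq> A2" "finite A2" "stepwise A2 V S"
    using subobject_thresholds[OF S fin] .
  obtain B where B: "A2 \<subseteq> B" "finite B" "stepwise B W T" using subobject_thresholds[OF T A2(2)] .
  have VB: "tame B V" using tame_mono[OF A] A2 B by blast
  have WB: "tame B W" using tame_mono[OF A1] A2 B by blast
  note LV = tame_pers[OF VB] and LW = tame_pers[OF WB]
  note S' = subobject_submod[OF S] stepwise_mono[OF A2(3) B(1)]
  note T' = subobject_submod[OF T] B(3)
  note Sin = submod_in[OF S'(1)] and Tin = submod_in[OF T'(1)]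
  note \<phi>lin = hom_linear[OF \<phi>] and \<phi>in = hom_in[OF \<phi>] and \<phi>c = hom_comm[OF \<phi>]
  have \<phi>S: "linear_between (S q) (sp W q) (\<phi> q)" for q
    using linear_between_subset[OF \<phi>lin submod_le[OF S'(1)]] \<phi>in Sin by blast
  show "subobject V (pull_sub \<phi> S T)"
  proof (rule subobjectI[OF VB])
    show "submod V (pull_sub \<phi> S T)"
    proof (rule submodI)
      show "subspace (pull_sub \<phi> S T q)" for q
        using linear_between_preimage[OF \<phi>S submod_sub[OF S'(1)] submod_sub[OF T'(1)]]
        by (simp add: pull_sub_def)
      show "tr V p q v \<in> pull_sub \<phi> S T q" if "p \<le> q" "v \<in> pull_sub \<phi> S T p" for p q v
        using that submod_tr[OF S'(1) that(1)] submod_tr[OF T'(1) that(1)] \<phi>c[OF that(1)] Sin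
        by (auto simp: pull_sub_def)
    qed (use Sin in \<open>auto simp: pull_sub_def\<close>)
    show "stepwise B V (pull_sub \<phi> S T)"
      unfolding stepwise_def
    proof (intro allI impI subsetI)
      fix q q' w assume le: "q \<le> q'" and k: "key B q = key B q'" and "w \<in> pull_sub \<phi> S T q'"
      then have w: "w \<in> S q'" "\<phi> q' w \<in> T q'" by (auto simp: pull_sub_def)
      obtain v where v: "v \<in> S q" "w = tr V q q' v" using stepwiseD[OF S'(2) le k] w by blast
      obtain t where t: "t \<in> T q" "\<phi> q' w = tr W q q' t" using stepwiseD[OF T'(2) le k] w by blast
      have "tr W q q' (\<phi> q v) = tr W q q' t" using v t \<phi>c[OF le Sin[OF v(1)]] by simp
      then have "\<phi> q v = t"
        using tame_bij[OF WB le k] \<phi>in[OF Sin[OF v(1)]] Tin[OF t(1)]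
        by (auto simp: bij_betw_def dest: inj_onD)
      then show "w \<in> tr V q q' ` pull_sub \<phi> S T q" using v t by (auto simp: pull_sub_def)
    qed
  qed
  show "subobject W (join_sub \<phi> S T)"
  proof (rule subobjectI[OF WB])
    have trW: "tr W p q (t + \<phi> p s) = tr W p q t + \<phi> q (tr V p q s)"
      if "p \<le> q" "t \<in> T p" "s \<in> S p" for p q t s
      using pers_linear[OF LW that(1)] \<phi>c[OF that(1) Sin[OF that(3)]] Tin[OF that(2)]
        \<phi>in[OF Sin[OF that(3)]] unfolding linear_between_def by simp
    show "submod W (join_sub \<phi> S T)"
    proof (rule submodI)
      show "subspace (join_sub \<phi> S T q)" for q
      proof -
        have "subspace (\<phi> q ` S q)"
          using fin_subspaceD[OF fin_subspace_image[OF submod_fin[OF LV S'(1)] \<phi>S]] .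
        from subspace_sums[OF submod_sub[OF T'(1)] this]
        show ?thesis by (rule back_subst[of subspace]) (auto simp: join_sub_def)
      qed
      show "v \<in> sp W q" if "v \<in> join_sub \<phi> S T q" for q v
        using that subspace_add[OF pers_sub[OF LW]] Tin \<phi>in Sin by (auto simp: join_sub_def)
      show "tr W p q v \<in> join_sub \<phi> S T q" if le: "p \<le> q" and v: "v \<in> join_sub \<phi> S T p" for p q v
      proof -
        obtain t s where ts: "t \<in> T p" "s \<in> S p" "v = t + \<phi> p s" using v by (auto simp: join_sub_def)
        then have "tr W p q v = tr W p q t + \<phi> q (tr V p q s)" using trW[OF le] by simp
        then show ?thesis
          using submod_tr[OF S'(1) le ts(2)] submod_tr[OF T'(1) le ts(1)] unfolding join_sub_def by blast
      qed
    qed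
    show "stepwise B W (join_sub \<phi> S T)"
      unfolding stepwise_def
    proof (intro allI impI subsetI)
      fix q q' w assume le: "q \<le> q'" and k: "key B q = key B q'" and "w \<in> join_sub \<phi> S T q'"
      then obtain t' s' where w: "t' \<in> T q'" "s' \<in> S q'" "w = t' + \<phi> q' s'"
        by (auto simp: join_sub_def)
      obtain s where s: "s \<in> S q" "s' = tr V q q' s" using stepwiseD[OF S'(2) le k] w by blast
      obtain t where t: "t \<in> T q" "t' = tr W q q' t" using stepwiseD[OF T'(2) le k] w by blast
      have "w = tr W q q' (t + \<phi> q s)" using trW[OF le t(1) s(1)] w s t by simp
      then show "w \<in> tr W q q' ` join_sub \<phi> S T q" using s t by (auto simp: join_sub_def)
    qed
  qed
  have "dim (join_sub \<phi> S T q) + dim (pull_sub \<phi> S T q) = dim (T q) + dim (S q)"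
    using dim_sum_image[OF submod_fin[OF LV S'(1)] pers_fin[OF LW] \<phi>S submod_sub[OF T'(1)] submod_le[OF T'(1)]]
    by (simp add: join_sub_def pull_sub_def)
  then show "dimfun (join_sub \<phi> S T) q + dimfun (pull_sub \<phi> S T) q = dimfun T q + dimfun S q"
    unfolding dimfun_def by (metis of_nat_add)
qed

lemma join_sub_ge:
  assumes "\<And>q. 0 \<in> T q" "\<And>q. 0 \<in> S q" "\<And>q. \<phi> q 0 = 0"
  shows "T \<le> join_sub \<phi> S T" "v \<in> S q \<Longrightarrow> \<phi> q v \<in> join_sub \<phi> S T q"
proof -
  show "T \<le> join_sub \<phi> S T"
  proof (intro le_funI subsetI)
    fix q v assume "v \<in> T q"
    moreover have "v = v + \<phi> q 0" using assms(3) by simp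
    ultimately show "v \<in> join_sub \<phi> S T q" using assms(2) unfolding join_sub_def by blast
  qed
  have "\<phi> q v = 0 + \<phi> q v" by simp
  then show "v \<in> S q \<Longrightarrow> \<phi> q v \<in> join_sub \<phi> S T q" using assms(1) unfolding join_sub_def by blast
qed

lemma hom_ident: "is_hom index_order V V (\<lambda>_ v. v)"
  by (simp add: is_hom_index_iff linear_between_def)

lemma subobject_Int:
  fixes V :: "('a::index_coord^'n::finite, 'v) pmod"
  assumes "V \<in> pers_fp" "subobject V S" "subobject V T" shows "subobject V (\<lambda>q. S q \<inter> T q)"
  using subobject_pull[OF assms(1,1) hom_ident assms(2,3)] by (simp add: pull_sub_def Int_def)

lemma shift_fp:
  fixes V :: "('a::index_coord^'n::finite, 'v) pmod"
  assumes "V \<in> pers_fp" shows "shift x V \<in> pers_fp"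
proof -
  obtain B where V: "tame B V" using assms pers_fp_iff_tame by blast
  note L = tame_pers[OF V]
  let ?B = "(\<lambda>(i, a). (i, a - x $ i)) ` B"
  have mono: "x + p \<le> x + q" if "p \<le> q" for p q :: "'a^'n"
    using that by (simp add: less_eq_vec_def)
  have key: "key B (x + q) = key B (x + q')" if "key ?B q = key ?B q'" for q q'
    using that unfolding key_eq_iff by (fastforce simp: algebra_simps)
  have full: "full B (x + q) \<Longrightarrow> full ?B q" for q
    unfolding full_def by (force simp: algebra_simps)
  have "tame ?B (shift x V)"
    unfolding tame_def
  proof (intro conjI allI impI)
    show "shift x V \<in> pers index_order"
      unfolding pers_index_iff shift_def pullback_def
      using pers_fin[OF L] pers_linear[OF L mono] pers_id[OF L] pers_comp[OF L mono mono] by simp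
    show "finite ?B" using tame_finite[OF V] by simp
    show "bij_betw (tr (shift x V) q q') (sp (shift x V) q) (sp (shift x V) q')"
      if "q \<le> q'" "key ?B q = key ?B q'" for q q'
      using tame_bij[OF V mono[OF that(1)] key[OF that(2)]] by (simp add: shift_def pullback_def)
    show "sp (shift x V) q = {0}" if "\<not> full ?B q" for q
      using tame_zero[OF V] full that by (auto simp: shift_def pullback_def)
  qed
  then show ?thesis using pers_fp_iff_tame by blast
qed

end

section \<open>Largest subobjects of maximal degree\<close>

definition step_function :: "('a::order^'n \<Rightarrow> real) \<Rightarrow> bool" where
  "step_function h \<longleftrightarrow> (\<exists>B. finite B \<and> step_fun B h)"

lemma step_functionI: "finite B \<Longrightarrow> step_fun B h \<Longrightarrow> step_function h"
  by (auto simp: step_function_def)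

definition upd :: "'a^'n \<Rightarrow> 'n \<Rightarrow> 'a \<Rightarrow> 'a^'n" where
  "upd q i x = (\<chi> j. if j = i then x else q $ j)"

lemma upd_nth [simp]: "upd q i x $ j = (if j = i then x else q $ j)"
  by (simp add: upd_def)

lemma key_upd: "key B q = key B q' \<Longrightarrow> key B (upd q i x) = key B (upd q' i x)"
  unfolding key_eq_iff by (auto 0 4)

text \<open>
  A threshold \<open>s\<close> in coordinate \<open>i\<close>, with lower neighbour \<open>s'\<close> and \<open>U\<close> the set of higher thresholds, divides
  the slab from \<open>s'\<close> to the minimum of \<open>U\<close> into two halves. The restrictions of a function to them
  describe what changes when \<open>s\<close> is moved to \<open>s'\<close> or to its upper neighbour. If \<open>U\<close> is empty, the
  upper half is unbounded.
\<close>

definition slab_low :: "'a::order \<Rightarrow> 'a \<Rightarrow> 'n \<Rightarrow> ('a^'n \<Rightarrow> real) \<Rightarrow> 'a^'n \<Rightarrow> real" where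
  "slab_low s' s i \<Delta> = (\<lambda>q. if s' \<le> q $ i \<and> q $ i < s then \<Delta> q else 0)"

definition slab_high :: "'a::order \<Rightarrow> 'a set \<Rightarrow> 'n \<Rightarrow> ('a^'n \<Rightarrow> real) \<Rightarrow> 'a^'n \<Rightarrow> real" where
  "slab_high s U i \<Delta> = (\<lambda>q. if s \<le> q $ i \<and> (\<forall>u\<in>U. q $ i < u) then \<Delta> q else 0)"

text \<open>
  What the real line with Lebesgue measure and the integers with counting measure have in common.
\<close>

class measured_coord = index_coord +
  assumes coord_real_add: "coord_real (x + y) = coord_real x + coord_real y"
    and coord_real_nonneg: "0 \<le> x \<Longrightarrow> 0 \<le> coord_real x"
    and space_coord [simp]: "space coord_measure = UNIV"
    and sets_coord: "{s..} \<in> sets coord_measure"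
    and sigma_finite_coord: "sigma_finite_measure coord_measure"
    and coord_measure_pos: "a < b \<Longrightarrow> 0 < emeasure coord_measure {a..<b}"
    and coord_measure_finite: "emeasure coord_measure {a..<b} < \<infinity>"
    and interior_interval: "a < b \<Longrightarrow> \<exists>T. open T \<and> T \<noteq> {} \<and> T \<subseteq> {a..<b}"
    and sets_coord_singleton: "{x} \<in> sets coord_measure"

instance real :: measured_coord
proof
  fix a b s x y :: real
  show "sigma_finite_measure (coord_measure :: real measure)"
    by (simp add: coord_measure_real_def sigma_finite_lborel)
  show "\<exists>T. open T \<and> T \<noteq> {} \<and> T \<subseteq> {a..<b}" if "a < b"
    using that by (intro exI[of _ "{a<..<b}"]) auto
  show "emeasure coord_measure {a..<b} < \<infinity>"
    by (cases "a \<le> b") (simp_all add: coord_measure_real_def)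
qed (simp_all add: coord_real_real_def coord_measure_real_def)

instance int :: measured_coord
proof
  fix a b s x y :: int
  show "sigma_finite_measure (coord_measure :: int measure)"
    by (simp add: coord_measure_int_def sigma_finite_measure_count_space)
  show "0 < emeasure coord_measure {a..<b}" if "a < b"
    using that by (simp add: coord_measure_int_def)
  show "emeasure coord_measure {a..<b} < \<infinity>"
    by (simp add: coord_measure_int_def emeasure_count_space of_nat_less_top)
  show "\<exists>T. open T \<and> T \<noteq> {} \<and> T \<subseteq> {a..<b}" if "a < b"
    using that by (intro exI[of _ "{a..<b}"]) (simp add: open_discrete)
qed (simp_all add: coord_real_int_def coord_measure_int_def)

text \<open>
  A central charge \<open>R + \<i> I\<close> that sees dimension functions only. The assumption \<open>slab\<close> replaces the chain
  conditions that the category of modules fails: let \<open>\<Delta> \<ge> 0\<close> be constant in direction \<open>i\<close> and let no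
  threshold in \<open>A\<close> separate the slab around \<open>s\<close>. Then \<open>I - \<theta> R\<close> does not decrease when \<open>\<Delta>\<close> is added on the
  lower half, or it increases when \<open>\<Delta>\<close> is removed from the upper half. The last alternative covers the
  region where the imaginary density vanishes: there, removing \<open>\<Delta>\<close> pays for \<open>\<theta> > 0\<close> as soon as it
  removes something of positive \<open>R\<close>.
\<close>

locale step_charge = persistence scale
  for scale :: "'k::field \<Rightarrow> 'v::ab_group_add \<Rightarrow> 'v" +
  fixes Z :: "(('a::measured_coord^'n::finite, 'v) pmod \<Rightarrow>\<^sub>0 int) set \<Rightarrow> complex"
    and A :: "('n \<times> 'a) set"
    and R I :: "('a^'n \<Rightarrow> real) \<Rightarrow> real"
  assumes finite_A: "finite A"
    and charge: "V \<in> pers_fp \<Longrightarrow> Z (K_class V) = Complex (R (dimfun (sp V))) (I (dimfun (sp V)))"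
    and pos: "V \<in> pers_fp \<Longrightarrow> \<not> zero_pmod V \<Longrightarrow> R (dimfun (sp V)) > 0"
    and R_add: "step_function h \<Longrightarrow> step_function h' \<Longrightarrow> R (\<lambda>q. h q + h' q) = R h + R h'"
    and I_add: "step_function h \<Longrightarrow> step_function h' \<Longrightarrow> I (\<lambda>q. h q + h' q) = I h + I h'"
    and slab: "step_function \<Delta> \<Longrightarrow> (\<And>q. 0 \<le> \<Delta> q) \<Longrightarrow> (\<And>q x. \<Delta> (upd q i x) = \<Delta> q) \<Longrightarrow>
      s' < s \<Longrightarrow> finite U \<Longrightarrow> (\<And>u. u \<in> U \<Longrightarrow> s < u) \<Longrightarrow> (\<And>a. (i, a) \<in> A \<Longrightarrow> a \<le> s' \<or> a \<in> U) \<Longrightarrow>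
      0 \<le> I (slab_low s' s i \<Delta>) - \<theta> * R (slab_low s' s i \<Delta>) \<or>
      I (slab_high s U i \<Delta>) - \<theta> * R (slab_high s U i \<Delta>) < 0 \<or>
      0 < \<theta> \<and> I (slab_high s U i \<Delta>) = 0"
begin

text \<open>
  A subobject of positive real part has slope at least \<open>\<theta>\<close> if and only if its degree is nonnegative.
  Unlike the slope, the degree is additive.
\<close>

definition deg :: "real \<Rightarrow> ('a^'n \<Rightarrow> 'v set) \<Rightarrow> real" where
  "deg \<theta> S = I (dimfun S) - \<theta> * R (dimfun S)"

lemma step_sub:
  fixes V :: "('a^'n, 'v) pmod"
  assumes "V \<in> pers_fp" "subobject V S" shows "step_function (dimfun S)"
proof -
  obtain B where B: "tame B (V\<lparr>sp := S\<rparr>)" using subobject_fp[OF assms(2)] pers_fp_iff_tame by blast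
  show ?thesis using step_functionI[OF tame_finite[OF B] dimfun_step[OF B]] by simp
qed

lemma step_fp: "(V :: ('a^'n, 'v) pmod) \<in> pers_fp \<Longrightarrow> step_function (dimfun (sp V))"
  using step_sub subobject_self by blast

lemma RI_diff:
  assumes "step_function h" "step_function h'" "step_function k" "step_function k'"
    and "\<And>q. h q + h' q = k q + k' q"
  shows "R h + R h' = R k + R k'" "I h + I h' = I k + I k'"
  using R_add[OF assms(1,2)] R_add[OF assms(3,4)] I_add[OF assms(1,2)] I_add[OF assms(3,4)] assms(5)
  by simp_all

lemma RI_zero [simp]: "R (\<lambda>_. 0) = 0" "I (\<lambda>_. 0) = 0"
proof -
  have "step_function (\<lambda>_ :: 'a^'n. 0)" by (rule step_functionI[of "{}"]) (auto simp: step_fun_def)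
  from R_add[OF this this] I_add[OF this this] show "R (\<lambda>_. 0) = 0" "I (\<lambda>_. 0) = 0" by simp_all
qed

lemma dimfun_zero [simp]: "dimfun (\<lambda>_ :: 'a^'n. {0}) = (\<lambda>_. 0)"
  by (simp add: dimfun_def dim_zero)

lemma short_exact_RI:
  assumes "short_exact X Y C \<phi> \<psi>"
  shows "R (dimfun (sp Y)) = R (dimfun (sp X)) + R (dimfun (sp C))"
    and "I (dimfun (sp Y)) = I (dimfun (sp X)) + I (dimfun (sp C))"
proof -
  have "X \<in> pers_fp" "C \<in> pers_fp" using assms by (auto simp: short_exact_def)
  note s = this[THEN step_fp]
  show "R (dimfun (sp Y)) = R (dimfun (sp X)) + R (dimfun (sp C))"
    "I (dimfun (sp Y)) = I (dimfun (sp X)) + I (dimfun (sp C))"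
    using R_add[OF s] I_add[OF s] short_exact_dim[OF assms] by simp_all
qed

text \<open>
  The difference is the real part of the charge of the quotient.
\<close>

lemma R_mono:
  assumes V: "V \<in> pers_fp" and S: "subobject V S" and T: "subobject V T" and le: "T \<le> S"
  shows "R (dimfun T) \<le> R (dimfun S)" and "R (dimfun T) = R (dimfun S) \<Longrightarrow> T = S"
proof -
  obtain C \<pi> where C: "short_exact (V\<lparr>sp := T\<rparr>) (V\<lparr>sp := S\<rparr>) C (\<lambda>_ v. v) \<pi>"
    using quotient_exists[OF assms] .
  have Cfp: "C \<in> pers_fp" using C by (simp add: short_exact_def)
  have eq: "R (dimfun S) = R (dimfun T) + R (dimfun (sp C))" using short_exact_RI(1)[OF C] by simp
  have z: "T = S" if "zero_pmod C"
  proof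
    fix q
    have "dim (S q) = dim (T q)"
      using short_exact_dim[OF C] that by (auto simp: dimfun_def zero_pmod_def dim_zero dest!: fun_cong[of _ _ q])
    then show "T q = S q"
      using dim_subset_eq[OF submod_fin[OF fp_pers[OF V] subobject_submod[OF S]]
          submod_sub[OF subobject_submod[OF T]]] le by (auto simp: le_fun_def)
  qed
  show "R (dimfun T) \<le> R (dimfun S)" using eq z pos[OF Cfp] by fastforce
  show "T = S" if "R (dimfun T) = R (dimfun S)" using eq z pos[OF Cfp] that by fastforce
qed

lemma sub_pos:
  assumes "V \<in> pers_fp" "subobject V S" "S \<noteq> (\<lambda>_. {0})" shows "R (dimfun S) > 0"
  using pos[OF subobject_fp[OF assms(2)]] assms(3) by (simp add: zero_pmod_sub)

lemma deg_join:
  assumes "V \<in> pers_fp" "W \<in> pers_fp" "is_hom index_order V W \<phi>" "subobject V S" "subobject W T"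
  shows "deg \<theta> (join_sub \<phi> S T) + deg \<theta> (pull_sub \<phi> S T) = deg \<theta> T + deg \<theta> S"
    and "R (dimfun (join_sub \<phi> S T)) + R (dimfun (pull_sub \<phi> S T)) = R (dimfun T) + R (dimfun S)"
proof -
  note RI = RI_diff[OF step_sub[OF assms(2) subobject_join[OF assms]]
      step_sub[OF assms(1) subobject_pull[OF assms]] step_sub[OF assms(2,5)] step_sub[OF assms(1,4)]
      dimfun_join[OF assms]]
  show "R (dimfun (join_sub \<phi> S T)) + R (dimfun (pull_sub \<phi> S T)) = R (dimfun T) + R (dimfun S)"
    by (rule RI(1))
  have "\<theta> * R (dimfun (join_sub \<phi> S T)) + \<theta> * R (dimfun (pull_sub \<phi> S T)) = \<theta> * R (dimfun T) + \<theta> * R (dimfun S)"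
    using RI(1) by (metis distrib_left)
  then show "deg \<theta> (join_sub \<phi> S T) + deg \<theta> (pull_sub \<phi> S T) = deg \<theta> T + deg \<theta> S"
    using RI(2) by (simp add: deg_def)
qed

definition largest_maximiser :: "real \<Rightarrow> ('a^'n, 'v) pmod \<Rightarrow> ('a^'n \<Rightarrow> 'v set) \<Rightarrow> bool" where
  "largest_maximiser \<theta> V M \<longleftrightarrow> subobject V M \<and>
     (\<forall>S. subobject V S \<longrightarrow> deg \<theta> S \<le> deg \<theta> M \<and> (deg \<theta> S = deg \<theta> M \<longrightarrow> S \<le> M))"

lemma
  assumes "largest_maximiser \<theta> V M"
  shows largest_maximiser_sub: "subobject V M"
    and largest_maximiser_ge: "subobject V S \<Longrightarrow> deg \<theta> S \<le> deg \<theta> M"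
    and largest_maximiser_largest: "subobject V S \<Longrightarrow> deg \<theta> M \<le> deg \<theta> S \<Longrightarrow> S \<le> M"
  using assms by (auto simp: largest_maximiser_def intro: antisym)

lemma largest_maximiser_unique: "largest_maximiser \<theta> V M \<Longrightarrow> largest_maximiser \<theta> V M' \<Longrightarrow> M = M'"
  by (meson antisym largest_maximiser_ge largest_maximiser_largest largest_maximiser_sub)

lemma sub_zeros:
  assumes "subobject V S" shows "0 \<in> S q"
  using submod_zero[OF subobject_submod[OF assms]] .

lemma hom_zero: "V \<in> pers_fp \<Longrightarrow> is_hom index_order V W \<phi> \<Longrightarrow> \<phi> q 0 = 0"
  using linear_between_0[OF hom_linear pers_sub[OF fp_pers]] .

text \<open>
  Since \<open>S\<close> is a maximiser, \<open>S \<inter> \<phi> -` T\<close> has at most the degree of \<open>S\<close>, hence \<open>T + \<phi>(S)\<close> has at least the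
  degree of \<open>T\<close>. Since \<open>T\<close> contains all maximisers, it contains \<open>\<phi>(S)\<close>.
\<close>

lemma largest_maximiser_hom:
  assumes V: "V \<in> pers_fp" and W: "W \<in> pers_fp" and \<phi>: "is_hom index_order V W \<phi>"
    and S: "largest_maximiser \<theta> V S" and T: "largest_maximiser \<theta> W T" and v: "v \<in> S q"
  shows "\<phi> q v \<in> T q"
proof -
  note subs = V W \<phi> largest_maximiser_sub[OF S] largest_maximiser_sub[OF T]
  have "deg \<theta> (pull_sub \<phi> S T) \<le> deg \<theta> S" using largest_maximiser_ge[OF S subobject_pull[OF subs]] .
  then have "deg \<theta> T \<le> deg \<theta> (join_sub \<phi> S T)" using deg_join(1)[OF subs, of \<theta>] by linarith
  then have "join_sub \<phi> S T \<le> T" using largest_maximiser_largest[OF T subobject_join[OF subs]] by blast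
  moreover have "\<phi> q v \<in> join_sub \<phi> S T q"
    by (rule join_sub_ge(2)) (use v sub_zeros[OF subs(5)] sub_zeros[OF subs(4)] hom_zero[OF V \<phi>] in auto)
  ultimately show ?thesis by (auto simp: le_fun_def)
qed

text \<open>
  In a module constant on the cells of \<open>B'\<close>, a submodule with finer thresholds \<open>B\<close> is made constant on the
  cells of \<open>B'\<close> by reading it off at a lower point \<open>\<rho> q\<close> of the same cell of \<open>B'\<close>, which shrinks it, or
  at a higher point \<open>\<sigma> q\<close> as in the next lemma, which enlarges it.
\<close>

lemma push_down:
  assumes V: "tame B' V" and S: "submod V S" "stepwise B V S"
    and \<rho>: "\<And>q. \<rho> q \<le> q" "\<And>q q'. q \<le> q' \<Longrightarrow> \<rho> q \<le> \<rho> q'" "\<And>q. key B' (\<rho> q) = key B' q"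
      "\<And>q q'. key B' q = key B' q' \<Longrightarrow> key B (\<rho> q) = key B (\<rho> q')"
  defines "S' \<equiv> \<lambda>q. tr V (\<rho> q) q ` S (\<rho> q)"
  shows "submod V S'" "stepwise B' V S'" "dimfun S' q = dimfun S (\<rho> q)"
proof -
  note L = tame_pers[OF V]
  note Sin = submod_in[OF S(1)]
  have lin: "linear_between (S (\<rho> q)) (sp V q) (tr V (\<rho> q) q)" for q
    using linear_between_subset[OF pers_linear[OF L \<rho>(1)] submod_le[OF S(1)]] pers_tr[OF L \<rho>(1)] Sin
    by blast
  have comm: "tr V p q (tr V (\<rho> p) p v) = tr V (\<rho> q) q (tr V (\<rho> p) (\<rho> q) v)"
    if "p \<le> q" "v \<in> S (\<rho> p)" for p q v
    using pers_comp[OF L \<rho>(1) that(1) Sin[OF that(2)]]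
      pers_comp[OF L \<rho>(2)[OF that(1)] \<rho>(1) Sin[OF that(2)]] by simp
  show "submod V S'"
  proof (rule submodI)
    show "subspace (S' q)" for q
      using fin_subspaceD[OF fin_subspace_image[OF submod_fin[OF L S(1)] lin]] by (simp add: S'_def)
    show "v \<in> sp V q" if "v \<in> S' q" for q v
      using that pers_tr[OF L \<rho>(1)] Sin by (auto simp: S'_def)
    show "tr V p q v \<in> S' q" if le: "p \<le> q" and v: "v \<in> S' p" for p q v
    proof -
      obtain u where u: "u \<in> S (\<rho> p)" "v = tr V (\<rho> p) p u" using v by (auto simp: S'_def)
      then show ?thesis
        using comm[OF le u(1)] submod_tr[OF S(1) \<rho>(2)[OF le] u(1)] by (simp add: S'_def)
    qed
  qed
  show "stepwise B' V S'"
    unfolding stepwise_def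
  proof (intro allI impI subsetI)
    fix q q' w assume le: "q \<le> q'" and k: "key B' q = key B' q'" and "w \<in> S' q'"
    then obtain v where v: "v \<in> S (\<rho> q')" "w = tr V (\<rho> q') q' v" by (auto simp: S'_def)
    obtain u where u: "u \<in> S (\<rho> q)" "v = tr V (\<rho> q) (\<rho> q') u"
      using stepwiseD[OF S(2) \<rho>(2)[OF le] \<rho>(4)[OF k]] v(1) by blast
    have "w = tr V q q' (tr V (\<rho> q) q u)" using comm[OF le u(1)] u(2) v(2) by simp
    then show "w \<in> tr V q q' ` S' q" unfolding S'_def by (simp only:) (intro imageI u(1))
  qed
  have "inj_on (tr V (\<rho> q) q) (S (\<rho> q))"
    using inj_on_subset[OF bij_betw_imp_inj_on[OF tame_bij[OF V \<rho>(1,3)]] submod_le[OF S(1)]] .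
  from dim_image_inj[OF submod_fin[OF L S(1)] lin this]
  show "dimfun S' q = dimfun S (\<rho> q)" by (simp add: dimfun_def S'_def)
qed

lemma pull_up:
  assumes V: "tame B' V" and S: "submod V S" "stepwise B V S"
    and \<sigma>: "\<And>q. q \<le> \<sigma> q" "\<And>q q'. q \<le> q' \<Longrightarrow> \<sigma> q \<le> \<sigma> q'" "\<And>q. key B' q = key B' (\<sigma> q)"
      "\<And>q q'. key B' q = key B' q' \<Longrightarrow> key B (\<sigma> q) = key B (\<sigma> q')"
  defines "S' \<equiv> \<lambda>q. {v \<in> sp V q. tr V q (\<sigma> q) v \<in> S (\<sigma> q)}"
  shows "submod V S'" "stepwise B' V S'" "S \<le> S'" "dimfun S' q = dimfun S (\<sigma> q)"
proof -
  note L = tame_pers[OF V]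
  note Sin = submod_in[OF S(1)]
  have comm: "tr V q (\<sigma> q) (tr V p q v) = tr V (\<sigma> p) (\<sigma> q) (tr V p (\<sigma> p) v)"
    if "p \<le> q" "v \<in> sp V p" for p q v
    using pers_comp[OF L that(1) \<sigma>(1) that(2)] pers_comp[OF L \<sigma>(1) \<sigma>(2)[OF that(1)] that(2)] by simp
  show sub: "submod V S'"
  proof (rule submodI)
    show "subspace (S' q)" for q
      using linear_between_preimage[OF pers_linear[OF L \<sigma>(1)] pers_sub[OF L] submod_sub[OF S(1)]]
      by (simp add: S'_def)
    show "tr V p q v \<in> S' q" if "p \<le> q" "v \<in> S' p" for p q v
      using that comm[OF that(1)] submod_tr[OF S(1) \<sigma>(2)[OF that(1)]] pers_tr[OF L that(1)]
      by (auto simp: S'_def)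
  qed (auto simp: S'_def)
  show "stepwise B' V S'"
    unfolding stepwise_def
  proof (intro allI impI subsetI)
    fix q q' w assume le: "q \<le> q'" and k: "key B' q = key B' q'" and "w \<in> S' q'"
    then have w: "w \<in> sp V q'" "tr V q' (\<sigma> q') w \<in> S (\<sigma> q')" by (auto simp: S'_def)
    obtain v where v: "v \<in> sp V q" "w = tr V q q' v" using tame_bij[OF V le k] w(1) by (auto simp: bij_betw_def)
    obtain u where u: "u \<in> S (\<sigma> q)" "tr V q' (\<sigma> q') w = tr V (\<sigma> q) (\<sigma> q') u"
      using stepwiseD[OF S(2) \<sigma>(2)[OF le] \<sigma>(4)[OF k]] w(2) by blast
    have "key B' (\<sigma> q) = key B' (\<sigma> q')" using k \<sigma>(3) by metis
    then have "inj_on (tr V (\<sigma> q) (\<sigma> q')) (sp V (\<sigma> q))"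
      using tame_bij[OF V \<sigma>(2)[OF le]] by (simp add: bij_betw_def)
    moreover have "tr V (\<sigma> q) (\<sigma> q') (tr V q (\<sigma> q) v) = tr V (\<sigma> q) (\<sigma> q') u"
      using comm[OF le v(1)] v(2) u(2) by simp
    ultimately have "tr V q (\<sigma> q) v = u"
      using pers_tr[OF L \<sigma>(1) v(1)] Sin[OF u(1)] by (meson inj_onD)
    then show "w \<in> tr V q q' ` S' q" using u v by (auto simp: S'_def)
  qed
  show "S \<le> S'"
    using Sin submod_tr[OF S(1) \<sigma>(1)] by (auto simp: S'_def le_fun_def)
  have bij: "bij_betw (tr V q (\<sigma> q)) (sp V q) (sp V (\<sigma> q))" using tame_bij[OF V \<sigma>(1,3)] .
  have "tr V q (\<sigma> q) ` S' q = S (\<sigma> q)"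
    using bij Sin[of _ "\<sigma> q"] by (fastforce simp: S'_def bij_betw_def)
  moreover have "inj_on (tr V q (\<sigma> q)) (S' q)"
    by (rule inj_on_subset[OF bij_betw_imp_inj_on[OF bij]]) (auto simp: S'_def)
  moreover have "linear_between (S' q) (sp V (\<sigma> q)) (tr V q (\<sigma> q))"
    by (rule linear_between_subset[OF pers_linear[OF L \<sigma>(1)]]) (auto simp: S'_def pers_tr[OF L \<sigma>(1)])
  ultimately have "dim (S (\<sigma> q)) = dim (S' q)"
    using dim_image_inj[OF submod_fin[OF L sub]] by metis
  then show "dimfun S' q = dimfun S (\<sigma> q)" by (simp add: dimfun_def)
qed

end

section \<open>Existence of maximisers\<close>

context step_charge
begin

text \<open>
  The threshold \<open>s\<close> disappears when it is moved to one of its neighbours: moving it down enlarges \<open>S\<close> to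
  \<open>Sp\<close>, moving it up shrinks \<open>S\<close> to \<open>Sm\<close>. On dimension functions this adds \<open>\<Delta>\<close> on the lower half of the
  slab or removes it from the upper half, so \<open>slab\<close> says that one of the two moves does not lower the degree.
  Shrinking is only used when it strictly increases the degree or changes nothing, so maximisers are
  never shrunk.
\<close>

lemma remove_threshold:
  fixes V :: "('a^'n, 'v) pmod"
  assumes V: "tame D V" and AD: "A \<subseteq> D" and DB: "D \<subseteq> B" "finite B" and mem: "(i, s) \<in> B - D"
    and S: "submod V S" "stepwise B V S"
  obtains S' where "submod V S'" "stepwise (B - {(i, s)}) V S'"
    "deg \<theta> S < deg \<theta> S' \<or> deg \<theta> S \<le> deg \<theta> S' \<and> S \<le> S'"
proof -
  define B' where "B' = B - {(i, s)}"
  have DB': "D \<subseteq> B'" "finite B'" using DB mem by (auto simp: B'_def)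
  have VB': "tame B' V" using tame_mono[OF V DB'] .
  have VB: "tame B V" using tame_mono[OF V DB] .
  have Vfp: "V \<in> pers_fp" using V pers_fp_iff_tame by blast
  note L = tame_pers[OF V]
  have BB': "(j, a) \<in> B' \<longleftrightarrow> (j, a) \<in> B \<and> \<not> (j = i \<and> a = s)" for j a by (auto simp: B'_def)
  let ?P = "{a. (i, a) \<in> B \<and> a < s}"
  have finP: "finite ?P" using finite_thresholds[OF DB(2)] .
  show ?thesis
  proof (cases "?P = {}")
    case True
    \<comment> \<open>Below the lowest threshold of coordinate \<open>i\<close> everything vanishes, so \<open>s\<close> separates nothing.\<close>
    have "stepwise B' V S"
      unfolding stepwise_def
    proof (intro allI impI)
      fix q q' :: "'a^'n" assume le: "q \<le> q'" and k: "key B' q = key B' q'"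
      show "S q' \<subseteq> tr V q q' ` S q"
      proof (cases "key B q = key B q'")
        case True then show ?thesis using stepwiseD[OF S(2) le] by blast
      next
        case False
        then have c: "\<not> (s \<le> q $ i \<longleftrightarrow> s \<le> q' $ i)" using k by (auto simp: key_eq_iff B'_def)
        moreover have "q $ i \<le> q' $ i" using le by (simp add: less_eq_vec_def)
        ultimately have qs: "q $ i < s" by auto
        have "\<not> full D q'"
        proof
          assume "full D q'"
          then obtain a where a: "(i, a) \<in> D" "a \<le> q' $ i" by (auto simp: full_def)
          then have "(i, a) \<in> B'" using DB' by blast
          then have "a \<le> q $ i" using k a(2) unfolding key_eq_iff by blast
          then have "a \<in> ?P" using qs a(1) DB(1) by auto
          then show False using True by blast
        qed
        then have "sp V q' = {0}" using tame_zero[OF V] by blast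
        then have "S q' = {0}" using submod_le[OF S(1), of q'] submod_zero[OF S(1), of q'] by auto
        moreover have "tr V q q' 0 = 0" using pers_tr0[OF L le] .
        ultimately show ?thesis using submod_zero[OF S(1), of q] by force
      qed
    qed
    then show ?thesis using that S(1) by (auto simp: B'_def)
  next
    case False
    define s' where "s' = Max ?P"
    have s': "(i, s') \<in> B" "s' < s" using Max_in[OF finP False] by (auto simp: s'_def)
    have s'max: "a \<le> s'" if "(i, a) \<in> B" "a < s" for a
      using that finP by (auto simp: s'_def)
    define U where "U = {u. (i, u) \<in> B \<and> s < u}"
    have finU: "finite U" using finite_thresholds[OF DB(2)] by (simp add: U_def)
    have cases: "a \<le> s' \<or> a \<in> U" if "(i, a) \<in> B'" for a
      using that s'max[of a] by (cases "a < s") (auto simp: BB' U_def)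
    define sl where "sl q \<longleftrightarrow> s' \<le> q $ i \<and> (\<forall>u\<in>U. q $ i < u)" for q :: "'a^'n"
    have sl_key: "sl q = sl q'" if "key B' q = key B' q'" for q q'
    proof -
      have "s' \<le> q $ i \<longleftrightarrow> s' \<le> q' $ i"
        using that s' unfolding key_eq_iff by (force simp: BB')
      moreover have "u \<le> q $ i \<longleftrightarrow> u \<le> q' $ i" if "u \<in> U" for u
        using that \<open>key B' q = key B' q'\<close> unfolding key_eq_iff U_def by (force simp: BB')
      ultimately show ?thesis unfolding sl_def by (auto simp: not_le[symmetric])
    qed
    \<comment> \<open>Reading off at \<open>\<rho> q\<close> moves the threshold \<open>s\<close> up, reading off at \<open>\<sigma> q\<close> moves it down to \<open>s'\<close>.\<close>
    define \<rho> where "\<rho> q = (if sl q then upd q i s' else q)" for q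
    define \<sigma> where "\<sigma> q = (if sl q \<and> q $ i < s then upd q i s else q)" for q
    have sU: "s < u" if "u \<in> U" for u using that by (simp add: U_def)
    have \<rho>le: "\<rho> q \<le> q" for q by (auto simp: \<rho>_def sl_def less_eq_vec_def)
    have \<sigma>ge: "q \<le> \<sigma> q" for q by (auto simp: \<sigma>_def less_eq_vec_def)
    have \<rho>mono: "\<rho> q \<le> \<rho> q'" if "q \<le> q'" for q q'
    proof -
      have "q $ j \<le> q' $ j" for j using that by (simp add: less_eq_vec_def)
      moreover from this[of i] have "\<not> sl q \<Longrightarrow> sl q' \<Longrightarrow> q $ i \<le> s'"
        unfolding sl_def by (meson less_imp_le linorder_not_le order_trans)
      moreover have "sl q \<Longrightarrow> s' \<le> q' $ i"
        using \<open>q $ i \<le> q' $ i\<close> unfolding sl_def by (blast intro: order_trans)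
      ultimately show ?thesis by (auto simp: \<rho>_def less_eq_vec_def)
    qed
    have \<sigma>mono: "\<sigma> q \<le> \<sigma> q'" if "q \<le> q'" for q q'
    proof -
      have le: "q $ j \<le> q' $ j" for j using that by (simp add: less_eq_vec_def)
      have "s \<le> q' $ i" if "sl q" "q $ i < s" "\<not> (sl q' \<and> q' $ i < s)"
      proof (cases "sl q'")
        case False
        moreover have "s' \<le> q' $ i" using that(1) le[of i] unfolding sl_def by (meson order_trans)
        ultimately obtain u where "u \<in> U" "\<not> q' $ i < u" unfolding sl_def by blast
        then show ?thesis using sU[of u] by simp
      qed (use that in auto)
      moreover have "q $ i \<le> s" if "q' $ i < s" using le[of i] that by simp
      ultimately show ?thesis using le by (auto simp: \<sigma>_def less_eq_vec_def)
    qed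
    have key_slab: "key B' (upd q i x) = key B' q" if "sl q" "s' \<le> x" "\<And>u. u \<in> U \<Longrightarrow> x < u" for q x
      unfolding key_eq_iff
    proof (clarify)
      fix j a assume ja: "(j, a) \<in> B'"
      show "a \<le> upd q i x $ j \<longleftrightarrow> a \<le> q $ j"
      proof (cases "j = i")
        case True
        then have "a \<le> s' \<or> a \<in> U" using cases ja by blast
        then show ?thesis using that True unfolding sl_def
          by (auto simp: not_le[symmetric] intro: order_trans)
      qed simp
    qed
    have key\<rho>: "key B' (\<rho> q) = key B' q" for q
      using key_slab[of q s'] sU s'(2) by (auto simp: \<rho>_def intro: less_trans)
    have key\<sigma>: "key B' (\<sigma> q) = key B' q" for q
      using key_slab[of q s] sU s'(2) by (auto simp: \<sigma>_def)
    have keyB: "key B q = key B q'" if "key B' q = key B' q'" "s \<le> q $ i \<longleftrightarrow> s \<le> q' $ i" for q q'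
      using that by (auto simp: key_eq_iff B'_def)
    have not_sl: "s \<le> q $ i \<longleftrightarrow> s \<le> q' $ i" if k: "key B' q = key B' q'" and n: "\<not> sl q" for q q' :: "'a^'n"
    proof (cases "s' \<le> q $ i")
      case True
      then obtain u where "u \<in> U" "\<not> q $ i < u" using n unfolding sl_def by blast
      then have u: "u \<in> U" "u \<le> q $ i" by auto
      then have "u \<le> q' $ i" using k unfolding key_eq_iff U_def by (force simp: BB')
      then show ?thesis using u sU[OF u(1)] by auto
    next
      case False
      moreover have "\<not> s' \<le> q' $ i" using False k s' unfolding key_eq_iff by (force simp: BB')
      ultimately show ?thesis using s'(2) by auto
    qed
    have key\<rho>B: "key B (\<rho> q) = key B (\<rho> q')" if k: "key B' q = key B' q'" for q q'
    proof (rule keyB)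
      show "key B' (\<rho> q) = key B' (\<rho> q')" using key\<rho> k by simp
      show "s \<le> \<rho> q $ i \<longleftrightarrow> s \<le> \<rho> q' $ i"
        using sl_key[OF k] not_sl[OF k] s'(2) by (auto simp: \<rho>_def)
    qed
    have key\<sigma>B: "key B (\<sigma> q) = key B (\<sigma> q')" if k: "key B' q = key B' q'" for q q'
    proof (rule keyB)
      show "key B' (\<sigma> q) = key B' (\<sigma> q')" using key\<sigma> k by simp
      show "s \<le> \<sigma> q $ i \<longleftrightarrow> s \<le> \<sigma> q' $ i"
        using sl_key[OF k] not_sl[OF k] by (auto simp: \<sigma>_def)
    qed
    define Sm where "Sm = (\<lambda>q. tr V (\<rho> q) q ` S (\<rho> q))"
    define Sp where "Sp = (\<lambda>q. {v \<in> sp V q. tr V q (\<sigma> q) v \<in> S (\<sigma> q)})"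
    note Sm = push_down[OF VB' S \<rho>le \<rho>mono key\<rho> key\<rho>B, folded Sm_def]
    note Sp = pull_up[OF VB' S \<sigma>ge \<sigma>mono key\<sigma>[symmetric] key\<sigma>B, folded Sp_def]
    define \<Delta> where "\<Delta> q = dimfun S (upd q i s) - dimfun S (upd q i s')" for q
    define h\<^sub>1 where "h\<^sub>1 = slab_low s' s i \<Delta>"
    define h\<^sub>2 where "h\<^sub>2 = slab_high s U i \<Delta>"
    note h_eq = h\<^sub>1_def h\<^sub>2_def
    note h\<^sub>1_def = h\<^sub>1_def[unfolded slab_low_def] and h\<^sub>2_def = h\<^sub>2_def[unfolded slab_high_def]
    note hstep = dimfun_sub_step[OF VB S]
    have upd_slab: "sl (upd q i s')" "sl (upd q i s)" for q
      using s'(2) sU by (auto simp: sl_def intro: less_trans)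
    have \<Delta>0: "0 \<le> \<Delta> q" for q
    proof -
      let ?q = "upd q i s'" and ?q' = "upd q i s"
      have le: "?q \<le> ?q'" using s'(2) by (auto simp: less_eq_vec_def)
      have "upd ?q i s = ?q'" by (simp add: upd_def vec_eq_iff)
      then have k: "key B' ?q = key B' ?q'"
        using key_slab[OF upd_slab(1), of s q] s'(2) sU by simp
      have lin: "linear_between (S ?q) (S ?q') (tr V ?q ?q')"
        using linear_between_subset[OF pers_linear[OF L le] submod_le[OF S(1)]] submod_tr[OF S(1) le] by blast
      have inj: "inj_on (tr V ?q ?q') (S ?q)"
        using inj_on_subset[OF bij_betw_imp_inj_on[OF tame_bij[OF VB' le k]] submod_le[OF S(1)]] .
      have "dim (S ?q) = dim (tr V ?q ?q' ` S ?q)"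
        using dim_image_inj[OF submod_fin[OF L S(1)] lin inj] by simp
      also have "\<dots> \<le> dim (S ?q')"
        using submod_tr[OF S(1) le] fin_subspaceD[OF fin_subspace_image[OF submod_fin[OF L S(1)] lin]]
        by (intro dim_subset_le[OF submod_fin[OF L S(1)]]) auto
      finally show ?thesis by (simp add: \<Delta>_def dimfun_def)
    qed
    have \<Delta>step: "step_fun B \<Delta>"
      unfolding step_fun_def \<Delta>_def using step_funD[OF hstep key_upd] by metis
    have \<Delta>upd: "\<Delta> (upd q i x) = \<Delta> q" for q x
    proof -
      have "upd (upd q i x) i y = upd q i y" for y by (simp add: upd_def vec_eq_iff)
      then show ?thesis by (simp add: \<Delta>_def)
    qed
    have low: "dimfun S q = dimfun S (upd q i s')" if "sl q" "q $ i < s" for q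
      by (rule step_funD[OF hstep keyB])
        (use that key_slab[OF that(1), of s'] sU s'(2) in \<open>auto intro: less_trans\<close>)
    have high: "dimfun S q = dimfun S (upd q i s)" if "sl q" "s \<le> q $ i" for q
      by (rule step_funD[OF hstep keyB])
        (use that key_slab[OF that(1), of s] sU s'(2) in auto)
    have slab2: "sl q" if "s \<le> q $ i" "\<forall>u\<in>U. q $ i < u" for q
      using that s'(2) by (auto simp: sl_def)
    have slab1: "sl q" if "s' \<le> q $ i" "q $ i < s" for q
      using that sU by (auto simp: sl_def intro: less_trans)
    \<comment> \<open>The three dimension functions differ by the same \<open>\<Delta>\<close>, on the upper and on the lower half.\<close>
    have hm: "dimfun S q = dimfun Sm q + h\<^sub>2 q" for q
    proof (cases "sl q")
      case True
      then show ?thesis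
        using low[OF True] high[OF True] by (auto simp: Sm(3) \<rho>_def h\<^sub>2_def \<Delta>_def sl_def not_le)
    next
      case False
      then show ?thesis using slab2[of q] by (auto simp: Sm(3) \<rho>_def h\<^sub>2_def)
    qed
    have hp: "dimfun Sp q = dimfun S q + h\<^sub>1 q" for q
    proof (cases "sl q \<and> q $ i < s")
      case True
      then show ?thesis using low[of q] by (auto simp: Sp(4) \<sigma>_def h\<^sub>1_def \<Delta>_def sl_def)
    next
      case False
      have "\<sigma> q = q" using False by (simp only: \<sigma>_def if_False)
      moreover have "h\<^sub>1 q = 0" using False slab1[of q] unfolding h\<^sub>1_def by argo
      ultimately show ?thesis by (simp add: Sp(4))
    qed
    have key_s: "s' \<le> q $ i \<longleftrightarrow> s' \<le> q' $ i" "s \<le> q $ i \<longleftrightarrow> s \<le> q' $ i" if "key B q = key B q'" for q q'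
      by (rule key_eqD[OF that s'(1)], rule key_eqD[OF that]) (use mem in blast)
    have key_U: "u \<le> q $ i \<longleftrightarrow> u \<le> q' $ i" if "key B q = key B q'" "u \<in> U" for q q' u
      by (rule key_eqD[OF that(1)]) (use that(2) in \<open>simp add: U_def\<close>)
    have key_lt: "q $ i < u \<longleftrightarrow> q' $ i < u" if "u \<le> q $ i \<longleftrightarrow> u \<le> q' $ i" for q q' :: "'a^'n" and u
      using that unfolding not_le[symmetric] by blast
    have "step_fun B h\<^sub>1"
      unfolding step_fun_def
    proof (intro allI impI)
      fix q q' assume k: "key B q = key B q'"
      show "h\<^sub>1 q = h\<^sub>1 q'"
        using key_s[OF k] key_lt[OF key_s(2)[OF k]] step_funD[OF \<Delta>step k] by (simp add: h\<^sub>1_def)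
    qed
    then have st1: "step_function h\<^sub>1" using DB(2) step_functionI by blast
    have "step_fun B h\<^sub>2"
      unfolding step_fun_def
    proof (intro allI impI)
      fix q q' assume k: "key B q = key B q'"
      show "h\<^sub>2 q = h\<^sub>2 q'"
        using key_s[OF k] key_lt[OF key_U[OF k]] step_funD[OF \<Delta>step k] by (simp add: h\<^sub>2_def)
    qed
    then have st2: "step_function h\<^sub>2" using DB(2) step_functionI by blast
    have st\<Delta>: "step_function \<Delta>" using DB(2) \<Delta>step step_functionI by blast
    have Smsub: "subobject V Sm" using subobjectI[OF VB' Sm(1,2)] .
    have Ssub: "subobject V S" using subobjectI[OF VB S] .
    note sts = step_sub[OF Vfp Smsub] step_sub[OF Vfp Ssub]
    have "dimfun S = (\<lambda>q. dimfun Sm q + h\<^sub>2 q)" using hm by blast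
    then have degm: "deg \<theta> S = deg \<theta> Sm + (I h\<^sub>2 - \<theta> * R h\<^sub>2)"
      and Rm: "R (dimfun S) = R (dimfun Sm) + R h\<^sub>2"
      using R_add[OF sts(1) st2] I_add[OF sts(1) st2] by (simp_all add: deg_def algebra_simps)
    have degp: "deg \<theta> Sp = deg \<theta> S + (I h\<^sub>1 - \<theta> * R h\<^sub>1)"
    proof -
      have "dimfun Sp = (\<lambda>q. dimfun S q + h\<^sub>1 q)" using hp by blast
      then show ?thesis using R_add[OF sts(2) st1] I_add[OF sts(2) st1] by (simp add: deg_def algebra_simps)
    qed
    have "0 \<le> I h\<^sub>1 - \<theta> * R h\<^sub>1 \<or> I h\<^sub>2 - \<theta> * R h\<^sub>2 < 0 \<or> 0 < \<theta> \<and> I h\<^sub>2 = 0"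
      unfolding h_eq
    proof (rule slab[OF st\<Delta> \<Delta>0 \<Delta>upd s'(2) finU sU])
      show "a \<le> s' \<or> a \<in> U" if "(i, a) \<in> A" for a using that AD DB' cases by blast
    qed
    then consider "0 \<le> I h\<^sub>1 - \<theta> * R h\<^sub>1" | "I h\<^sub>2 - \<theta> * R h\<^sub>2 < 0" | "0 < \<theta>" "I h\<^sub>2 = 0" by blast
    then show ?thesis
    proof cases
      case 1
      then show ?thesis using that[OF Sp(1) Sp(2)[unfolded B'_def]] degp Sp(3) by simp
    next
      case 2
      then show ?thesis using that[OF Sm(1) Sm(2)[unfolded B'_def]] degm by simp
    next
      case 3
      have le: "Sm \<le> S"
        using submod_tr[OF S(1) \<rho>le] by (auto simp: Sm_def le_fun_def)
      show ?thesis
      proof (cases "Sm = S")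
        case True
        then show ?thesis using that[OF Sm(1) Sm(2)[unfolded B'_def]] by simp
      next
        case False
        then have "R h\<^sub>2 > 0" using R_mono[OF Vfp Ssub Smsub le] Rm by fastforce
        then have "\<theta> * R h\<^sub>2 > 0" using 3 by simp
        then show ?thesis using that[OF Sm(1) Sm(2)[unfolded B'_def]] degm 3 by simp
      qed
    qed
  qed
qed

lemma coarsen:
  fixes V :: "('a^'n, 'v) pmod"
  assumes V: "tame D V" and AD: "A \<subseteq> D" and S: "subobject V S"
  obtains S' where "submod V S'" "stepwise D V S'"
    "deg \<theta> S < deg \<theta> S' \<or> deg \<theta> S \<le> deg \<theta> S' \<and> S \<le> S'"
proof -
  obtain B where B: "D \<subseteq> B" "finite B" "stepwise B V S"
    using subobject_thresholds[OF S tame_finite[OF V]] .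
  have "\<exists>S'. submod V S' \<and> stepwise D V S' \<and> (deg \<theta> S < deg \<theta> S' \<or> deg \<theta> S \<le> deg \<theta> S' \<and> S \<le> S')"
    if "card (B - D) = n" "D \<subseteq> B" "finite B" "stepwise B V S" "submod V S" for n B S
    using that
  proof (induction n arbitrary: B S)
    case 0
    then have "B = D" by auto
    then show ?case using 0 by blast
  next
    case (Suc n)
    then have "B - D \<noteq> {}" by (metis card.empty nat.distinct(1))
    then obtain i s where mem: "(i, s) \<in> B - D" by auto
    obtain S1 where S1: "submod V S1" "stepwise (B - {(i, s)}) V S1"
      "deg \<theta> S < deg \<theta> S1 \<or> deg \<theta> S \<le> deg \<theta> S1 \<and> S \<le> S1"
      using remove_threshold[OF V AD Suc.prems(2,3) mem Suc.prems(5,4)] .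
    have "(B - {(i, s)}) - D = (B - D) - {(i, s)}" by blast
    then have "card ((B - {(i, s)}) - D) = n" using mem Suc.prems(1) by simp
    moreover have "D \<subseteq> B - {(i, s)}" using mem Suc.prems(2) by blast
    ultimately obtain S2 where "submod V S2" "stepwise D V S2"
      "deg \<theta> S1 < deg \<theta> S2 \<or> deg \<theta> S1 \<le> deg \<theta> S2 \<and> S1 \<le> S2"
      using Suc.IH[of "B - {(i, s)}" S1] S1 Suc.prems(3) by auto
    then show ?case using S1(3) by (intro exI[of _ S2]) auto
  qed
  then show ?thesis using that B subobject_submod[OF S] by blast
qed

text \<open>
  Such a dimension function is determined by its values on finitely many cells, which are bounded by
  those of \<open>V\<close>. So the degree takes finitely many values on submodules constant on the cells of \<open>D\<close>,
  although there may be infinitely many submodules.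
\<close>

lemma finite_dimfuns:
  fixes V :: "('a^'n, 'v) pmod"
  assumes V: "tame D V"
  shows "finite {dimfun S | S. submod V S \<and> stepwise D V S}"
proof -
  note L = tame_pers[OF V] and fD = tame_finite[OF V]
  have stV: "step_fun D (dimfun (sp V))" using dimfun_step[OF V] .
  define g where "g f = (\<lambda>q :: 'a^'n. real (f (key D q)))" for f
  define N where "N K = dim (sp V (SOME q. key D q = K))" for K
  have N: "N (key D q) = dim (sp V q)" for q
  proof -
    have "key D (SOME q'. key D q' = key D q) = key D q" by (rule someI) simp
    from step_funD[OF stV this] show ?thesis by (simp add: N_def dimfun_def)
  qed
  have "{dimfun S | S. submod V S \<and> stepwise D V S} \<subseteq> g ` PiE (range (key D)) (\<lambda>K. {..N K})"
  proof clarify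
    fix S assume S: "submod V S" "stepwise D V S"
    define f where "f = restrict (\<lambda>K. dim (S (SOME q. key D q = K))) (range (key D))"
    have f: "f (key D q) = dim (S q)" for q
    proof -
      have "key D (SOME q'. key D q' = key D q) = key D q" by (rule someI) simp
      from step_funD[OF dimfun_sub_step[OF V S] this] show ?thesis by (simp add: f_def dimfun_def)
    qed
    have "f \<in> PiE (range (key D)) (\<lambda>K. {..N K})"
    proof (rule PiE_I)
      fix K assume "K \<in> range (key D)"
      then obtain q where "K = key D q" by blast
      then show "f K \<in> {..N K}"
        using f N dim_subset_le[OF pers_fin[OF L] submod_sub[OF S(1)] submod_le[OF S(1)]] by simp
    qed (simp add: f_def)
    moreover have "dimfun S = g f" by (simp add: g_def f dimfun_def)
    ultimately show "dimfun S \<in> g ` PiE (range (key D)) (\<lambda>K. {..N K})" by blast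
  qed
  moreover have "finite (PiE (range (key D)) (\<lambda>K. {..N K}))"
    using finite_keys[OF fD] by (intro finite_PiE) auto
  ultimately show ?thesis using finite_surj by blast
qed

text \<open>
  Among the submodules constant on the cells of \<open>D\<close> take one of maximal degree and, subject to this,
  of maximal \<open>R\<close>. Coarsening shows that no other subobject has larger degree. The sum with a further
  maximiser is a maximiser again; it can be coarsened without shrinking, and then the choice by \<open>R\<close> shows
  that it adds nothing.
\<close>

lemma largest_maximiser_exists:
  fixes V :: "('a^'n, 'v) pmod"
  assumes V: "tame D V" and AD: "A \<subseteq> D"
  obtains M where "submod V M" "stepwise D V M" "largest_maximiser \<theta> V M"
proof -
  have Vfp: "V \<in> pers_fp" using V pers_fp_iff_tame by blast
  define X where "X = {dimfun S | S. submod V S \<and> stepwise D V S}"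
  have finX: "finite X" using finite_dimfuns[OF V] by (simp add: X_def)
  obtain Z0 where "submod V Z0" "stepwise D V Z0" using coarsen[OF V AD subobject_self[OF Vfp]] by blast
  then have neX: "X \<noteq> {}" by (auto simp: X_def)
  define d where "d h = I h - \<theta> * R h" for h
  define X' where "X' = {h \<in> X. d h = Max (d ` X)}"
  have finX': "finite X'" using finX by (simp add: X'_def)
  have neX': "X' \<noteq> {}"
  proof -
    have "Max (d ` X) \<in> d ` X" using finX neX by simp
    then obtain h where "h \<in> X" "d h = Max (d ` X)" by force
    then show ?thesis by (auto simp: X'_def)
  qed
  obtain h where h: "h \<in> X'" "R h = Max (R ` X')"
  proof -
    have "Max (R ` X') \<in> R ` X'" using finX' neX' by simp
    then show ?thesis using that by force
  qed
  then have hX: "h \<in> X" by (simp add: X'_def)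
  then obtain M where M: "submod V M" "stepwise D V M" "h = dimfun M" by (auto simp: X_def)
  have Mdeg: "deg \<theta> S \<le> deg \<theta> M" if "submod V S" "stepwise D V S" for S
  proof -
    have "dimfun S \<in> X" using that by (auto simp: X_def)
    then have "d (dimfun S) \<le> Max (d ` X)" using finX by simp
    then show ?thesis using h(1) M(3) by (simp add: X'_def d_def deg_def)
  qed
  have MR: "R (dimfun S) \<le> R (dimfun M)"
    if "submod V S" "stepwise D V S" "deg \<theta> M \<le> deg \<theta> S" for S
  proof -
    have "dimfun S \<in> X" using that by (auto simp: X_def)
    moreover have "d (dimfun S) = d (dimfun M)"
      using Mdeg[OF that(1,2)] that(3) by (simp add: d_def deg_def)
    ultimately have "dimfun S \<in> X'" using h(1) M(3) by (simp add: X'_def)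
    then show ?thesis using finX' h(2) M(3) by simp
  qed
  have Msub: "subobject V M" using subobjectI[OF V M(1,2)] .
  have ge: "deg \<theta> S \<le> deg \<theta> M" if S: "subobject V S" for S
  proof -
    obtain S' where "submod V S'" "stepwise D V S'" "deg \<theta> S \<le> deg \<theta> S'"
      using coarsen[OF V AD S, of \<theta>] by (metis less_imp_le)
    then show ?thesis using Mdeg by fastforce
  qed
  have "S \<le> M" if S: "subobject V S" and eq: "deg \<theta> S = deg \<theta> M" for S
  proof -
    note subs = Vfp Vfp hom_ident S Msub
    let ?J = "join_sub (\<lambda>_ v. v) S M"
    have J: "subobject V ?J" using subobject_join[OF subs] .
    have "deg \<theta> (pull_sub (\<lambda>_ v. v) S M) \<le> deg \<theta> M" using ge[OF subobject_pull[OF subs]] .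
    then have Jdeg: "deg \<theta> M \<le> deg \<theta> ?J" using deg_join(1)[OF subs, of \<theta>] eq by linarith
    obtain J' where J': "submod V J'" "stepwise D V J'"
      "deg \<theta> ?J < deg \<theta> J' \<or> deg \<theta> ?J \<le> deg \<theta> J' \<and> ?J \<le> J'"
      using coarsen[OF V AD J] .
    have "\<not> deg \<theta> ?J < deg \<theta> J'" using Mdeg[OF J'(1,2)] Jdeg by linarith
    then have le: "?J \<le> J'" and "deg \<theta> M \<le> deg \<theta> J'" using J'(3) Jdeg by auto
    then have RJ: "R (dimfun J') \<le> R (dimfun M)" using MR[OF J'(1,2)] by blast
    have in_J: "M \<le> ?J" "S \<le> ?J"
      using join_sub_ge[of M S "\<lambda>_ v. v"] sub_zeros[OF S] sub_zeros[OF Msub] by (auto simp: le_fun_def)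
    have MJ: "M \<le> J'" using in_J(1) le by (rule order_trans)
    have J'sub: "subobject V J'" using subobjectI[OF V J'(1,2)] .
    have "M = J'"
      using R_mono[OF Vfp J'sub Msub MJ] RJ by simp
    then show "S \<le> M" using in_J(2) le by simp
  qed
  then have "largest_maximiser \<theta> V M" using Msub ge by (simp add: largest_maximiser_def)
  then show ?thesis using that M by blast
qed

end

section \<open>Harder-Narasimhan filtrations\<close>

context step_charge
begin

lemma slope_eq: "V \<in> pers_fp \<Longrightarrow> slope Z V = I (dimfun (sp V)) / R (dimfun (sp V))"
  by (simp add: slope_def charge)

text \<open>
  Passing from \<open>\<theta>'\<close> to the smaller \<open>\<theta>\<close> raises the degree of \<open>M'\<close> at least as much as that of its
  subobject \<open>M' \<inter> M\<close>, so \<open>M + M'\<close> has at least the degree of \<open>M\<close>.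
\<close>

lemma max_antimono:
  assumes V: "V \<in> pers_fp" and M: "largest_maximiser \<theta> V M" and M': "largest_maximiser \<theta>' V M'" and le: "\<theta> \<le> \<theta>'"
  shows "M' \<le> M"
proof -
  note subs = V V hom_ident largest_maximiser_sub[OF M'] largest_maximiser_sub[OF M]
  let ?J = "join_sub (\<lambda>_ v. v) M' M" and ?P = "pull_sub (\<lambda>_ v. v) M' M"
  have P: "subobject V ?P" using subobject_pull[OF subs] .
  have "?P \<le> M'" by (auto simp: pull_sub_def le_fun_def)
  then have "R (dimfun ?P) \<le> R (dimfun M')" using R_mono(1)[OF V largest_maximiser_sub[OF M'] P] by blast
  then have "0 \<le> (\<theta>' - \<theta>) * (R (dimfun M') - R (dimfun ?P))" using le by simp
  moreover have "deg \<theta>' ?P \<le> deg \<theta>' M'" using largest_maximiser_ge[OF M' P] .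
  ultimately have "deg \<theta> ?P \<le> deg \<theta> M'" unfolding deg_def by argo
  then have "deg \<theta> M \<le> deg \<theta> ?J" using deg_join(1)[OF subs, of \<theta>] by linarith
  then have "?J \<le> M" using largest_maximiser_largest[OF M subobject_join[OF subs]] by blast
  moreover have "M' \<le> ?J"
    using join_sub_ge(2)[of M M' "\<lambda>_ v. v"] sub_zeros[OF subs(4)] sub_zeros[OF subs(5)]
    by (auto simp: le_fun_def)
  ultimately show ?thesis by (rule order_trans[rotated])
qed

lemma short_exact_pull:
  fixes X Y C :: "('a^'n, 'v) pmod"
  assumes E: "short_exact X Y C \<phi> \<pi>" and T: "subobject C T"
  shows "dimfun (pull_sub \<pi> (sp Y) T) q = dimfun (sp X) q + dimfun T q"
proof -
  note E' = E[unfolded short_exact_def]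
  have fp: "Y \<in> pers_fp" "C \<in> pers_fp" and hom: "is_hom index_order Y C \<pi>" using E' by auto
  note J = fp hom subobject_self[OF fp(1)] T
  have "join_sub \<pi> (sp Y) T = sp C"
  proof (rule antisym)
    show "join_sub \<pi> (sp Y) T \<le> sp C" using subobject_le[OF subobject_join[OF J]] .
    show "sp C \<le> join_sub \<pi> (sp Y) T"
    proof (intro le_funI subsetI)
      fix q w assume "w \<in> sp C q"
      moreover have "\<pi> q ` sp Y q = sp C q" using E' by simp
      ultimately obtain y where y: "y \<in> sp Y q" "w = \<pi> q y" by blast
      show "w \<in> join_sub \<pi> (sp Y) T q"
        unfolding y(2) by (rule join_sub_ge(2))
          (use y(1) sub_zeros[OF T] sub_zeros[OF J(4)] hom_zero[OF fp(1) hom] in auto)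
    qed
  qed
  then show ?thesis using dimfun_join[OF J, of q] short_exact_dim[OF E] by simp
qed

lemma semistable_bound:
  assumes C: "semistable Z C" and T: "subobject C T"
  shows "I (dimfun T) \<le> slope Z C * R (dimfun T)"
proof (cases "T = (\<lambda>_. {0})")
  case False
  have "C \<in> pers_fp" using C by (simp add: semistable_def)
  then have p: "0 < R (dimfun T)" using sub_pos[OF _ T False] by blast
  have "slope Z (C\<lparr>sp := T\<rparr>) \<le> slope Z C"
    using C T False by (simp add: semistable_def zero_pmod_sub)
  then show ?thesis using p slope_eq[OF subobject_fp[OF T]] by (simp add: field_simps)
qed simp

text \<open>
  Intersect a subobject \<open>S\<close> with the filtration. Each graded piece embeds into the semistable module
  \<open>C j\<close>. Below the cut its degree is at most that of \<open>C j\<close>; above the cut it is negative unless the piece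
  vanishes. Adding up, the degree of \<open>S\<close> is at most that of \<open>F i\<close>, with equality only if \<open>S \<subseteq> F i\<close>.
\<close>

lemma HN_cut:
  assumes V: "V \<in> pers_fp" and HN: "is_HN_filtration Z V l F C" and i: "i \<le> l"
    and lo: "i = 0 \<or> \<theta> \<le> slope Z (C (i - 1))" and hi: "i = l \<or> slope Z (C i) < \<theta>"
  shows "largest_maximiser \<theta> V (F i)"
proof -
  note H = HN[unfolded is_HN_filtration_def]
  have F0: "F 0 = (\<lambda>_. {0})" and Fl: "F l = sp V" using H by auto
  have Fsub: "subobject V (F j)" if "j \<le> l" for j using H that by blast
  have Css: "semistable Z (C j)" if "j < l" for j using H that by blast
  have dec: "slope Z (C (Suc j)) < slope Z (C j)" if "Suc j < l" for j using H that by blast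
  have anti: "slope Z (C k) \<le> slope Z (C j)" if "j \<le> k" "k < l" for j k
    using that
  proof (induction k rule: dec_induct)
    case (step k) then show ?case using dec[of k] by fastforce
  qed simp
  have lo': "\<theta> \<le> slope Z (C j)" if "j < i" for j
    using lo anti[of j "i - 1"] that i by (cases i) auto
  have hi': "slope Z (C j) < \<theta>" if "i \<le> j" "j < l" for j
    using hi anti[of i j] that i by fastforce
  have main: "deg \<theta> S \<le> deg \<theta> (F i) \<and> (deg \<theta> S = deg \<theta> (F i) \<longrightarrow> S \<le> F i)" if S: "subobject V S" for S
  proof -
    define G where "G j = (\<lambda>q. S q \<inter> F j q)" for j
    have Gsub: "subobject V (G j)" if "j \<le> l" for j
      unfolding G_def using subobject_Int[OF V S Fsub[OF that]] .
    have piece: "\<exists>T. subobject (C j) T \<and> R (dimfun (G (Suc j))) = R (dimfun (G j)) + R (dimfun T) \<and>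
        I (dimfun (G (Suc j))) = I (dimfun (G j)) + I (dimfun T) \<and>
        (T = (\<lambda>_. {0}) \<longrightarrow> G (Suc j) \<le> F j)" if j: "j < l" for j
    proof -
      obtain \<pi> where E: "short_exact (V\<lparr>sp := F j\<rparr>) (V\<lparr>sp := F (Suc j)\<rparr>) (C j) (\<lambda>_ v. v) \<pi>"
        using H j by blast
      note E' = E[unfolded short_exact_def]
      let ?Y = "V\<lparr>sp := F (Suc j)\<rparr>"
      have fp: "?Y \<in> pers_fp" "C j \<in> pers_fp" and hom: "is_hom index_order ?Y (C j) \<pi>" using E' by auto
      have GY: "subobject ?Y (G (Suc j))"
        using subobject_of_subobject[OF Fsub[of "Suc j"]] Gsub[of "Suc j"] j
        by (auto simp: G_def le_fun_def)
      note J = fp hom GY subobject_zero[OF fp(2)]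
      let ?T = "join_sub \<pi> (G (Suc j)) (\<lambda>_. {0})"
      have T: "subobject (C j) ?T" using subobject_join[OF J] .
      have ker: "F j q = {v \<in> F (Suc j) q. \<pi> q v = 0}" for q using E' by simp
      have "F j \<le> F (Suc j)" using H j by (auto simp: less_le)
      then have pull: "pull_sub \<pi> (G (Suc j)) (\<lambda>_. {0}) = G j"
        using ker by (auto simp: pull_sub_def G_def le_fun_def)
      have eq: "dimfun (G (Suc j)) = (\<lambda>q. dimfun (G j) q + dimfun ?T q)"
        using dimfun_join[OF J, unfolded pull] by (auto simp: algebra_simps dimfun_def dim_zero)
      have sts: "step_function (dimfun (G j))" "step_function (dimfun ?T)"
        using step_sub[OF V Gsub[of j]] step_sub[OF fp(2) T] j by auto
      have "G (Suc j) \<le> F j" if "?T = (\<lambda>_. {0})"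
      proof (intro le_funI subsetI)
        fix q v assume v: "v \<in> G (Suc j) q"
        have "\<pi> q v \<in> ?T q"
          by (rule join_sub_ge(2)) (use v sub_zeros[OF GY] hom_zero[OF fp(1) hom] in auto)
        then have "\<pi> q v = 0" using that by (auto dest: fun_cong[of _ _ q])
        then show "v \<in> F j q" using v ker by (auto simp: G_def)
      qed
      then show ?thesis using T R_add[OF sts] I_add[OF sts] eq by (intro exI[of _ ?T]) simp
    qed
    have FI: "I (dimfun (F (Suc j))) = I (dimfun (F j)) + slope Z (C j) * R (dimfun (sp (C j)))"
      "R (dimfun (F (Suc j))) = R (dimfun (F j)) + R (dimfun (sp (C j)))"
      "C j \<in> pers_fp" if j: "j < l" for j
    proof -
      obtain \<pi> where E: "short_exact (V\<lparr>sp := F j\<rparr>) (V\<lparr>sp := F (Suc j)\<rparr>) (C j) (\<lambda>_ v. v) \<pi>"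
        using H j by blast
      have Cj: "C j \<in> pers_fp" "\<not> zero_pmod (C j)" using Css[OF j] by (auto simp: semistable_def)
      then have "I (dimfun (sp (C j))) = slope Z (C j) * R (dimfun (sp (C j)))"
        using slope_eq pos by fastforce
      then show "I (dimfun (F (Suc j))) = I (dimfun (F j)) + slope Z (C j) * R (dimfun (sp (C j)))"
        "R (dimfun (F (Suc j))) = R (dimfun (F j)) + R (dimfun (sp (C j)))" "C j \<in> pers_fp"
        using short_exact_RI[OF E] Cj by simp_all
    qed
    \<comment> \<open>Below the cut, subobjects of the semistable pieces have smaller degree than the pieces.\<close>
    have below: "deg \<theta> (G j) \<le> deg \<theta> (F j)" if "j \<le> i" for j
      using that
    proof (induction j)
      case 0
      have "G 0 = F 0" using sub_zeros[OF S] by (auto simp: G_def F0)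
      then show ?case by simp
    next
      case (Suc j)
      then have j: "j < l" "j < i" using i by auto
      obtain T where T: "subobject (C j) T" "R (dimfun (G (Suc j))) = R (dimfun (G j)) + R (dimfun T)"
        "I (dimfun (G (Suc j))) = I (dimfun (G j)) + I (dimfun T)" using piece[OF j(1)] by blast
      have "I (dimfun T) - \<theta> * R (dimfun T) \<le> (slope Z (C j) - \<theta>) * R (dimfun T)"
        using semistable_bound[OF Css[OF j(1)] T(1)] by (simp add: algebra_simps)
      also have "\<dots> \<le> (slope Z (C j) - \<theta>) * R (dimfun (sp (C j)))"
        using lo'[OF j(2)] R_mono(1)[OF FI(3)[OF j(1)] subobject_self[OF FI(3)[OF j(1)]] T(1) subobject_le[OF T(1)]]
        by (intro mult_left_mono) auto
      finally show ?case
        using Suc FI[OF j(1)] T unfolding deg_def by (simp add: algebra_simps)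
    qed
    \<comment> \<open>Above the cut, nonzero subobjects of the pieces have negative degree.\<close>
    have above: "deg \<theta> (G j) \<le> deg \<theta> (G i) \<and> (deg \<theta> (G j) = deg \<theta> (G i) \<longrightarrow> G j \<le> F i)"
      if "i \<le> j" "j \<le> l" for j
      using that
    proof (induction j rule: dec_induct)
      case base
      then show ?case by (auto simp: G_def le_fun_def)
    next
      case (step j)
      then have j: "j < l" by simp
      obtain T where T: "subobject (C j) T" "R (dimfun (G (Suc j))) = R (dimfun (G j)) + R (dimfun T)"
        "I (dimfun (G (Suc j))) = I (dimfun (G j)) + I (dimfun T)"
        "T = (\<lambda>_. {0}) \<longrightarrow> G (Suc j) \<le> F j" using piece[OF j] by blast
      show ?case
      proof (cases "T = (\<lambda>_. {0})")
        case True
        then have "dimfun T = (\<lambda>_. 0)" by simp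
        then have "deg \<theta> (G (Suc j)) = deg \<theta> (G j)" using T by (simp add: deg_def)
        moreover have "G (Suc j) \<le> G j" using T(4) True by (auto simp: G_def le_fun_def)
        ultimately show ?thesis using step j by (auto intro: order_trans)
      next
        case False
        have "0 < R (dimfun T)" using sub_pos[OF FI(3)[OF j] T(1) False] .
        moreover have "slope Z (C j) < \<theta>" using hi' step j by simp
        ultimately have "slope Z (C j) * R (dimfun T) < \<theta> * R (dimfun T)" by simp
        then have "deg \<theta> (G (Suc j)) < deg \<theta> (G j)"
          using semistable_bound[OF Css[OF j] T(1)] T unfolding deg_def by (simp add: algebra_simps)
        then show ?thesis using step j by auto
      qed
    qed
    have "G l = S" using subobject_le[OF S] by (auto simp: G_def Fl le_fun_def)
    then show ?thesis using below[of i] above[OF i] by auto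
  qed
  then show ?thesis using Fsub[OF i] by (simp add: largest_maximiser_def)
qed

text \<open>
  Let \<open>M \<theta>\<close> be the largest maximiser at \<open>\<theta>\<close>. The function \<open>M\<close> is decreasing with finitely many values
  \<open>F 0 \<subset> \<dots> \<subset> F l\<close>, from \<open>0\<close> for large \<open>\<theta>\<close> to all of \<open>V\<close> for small \<open>\<theta>\<close>. If \<open>\<mu> j\<close> is the slope of
  \<open>F (j+1) / F j\<close>, then \<open>F j\<close> and \<open>F (j+1)\<close> have equal degree at \<open>\<mu> j\<close>, and this forces \<open>M (\<mu> j) = F (j+1)\<close>. So
  nothing between \<open>F j\<close> and \<open>F (j+1)\<close> has larger degree at \<open>\<mu> j\<close>, which is semistability of the quotient.
\<close>

lemma HN_exists:
  fixes V :: "('a^'n, 'v) pmod"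
  assumes V: "V \<in> pers_fp" and nz: "\<not> zero_pmod V"
  obtains l F C where "is_HN_filtration Z V l F C"
proof -
  obtain D0 where "tame D0 V" using V pers_fp_iff_tame by blast
  then have D: "tame (D0 \<union> A) V" using tame_mono finite_A tame_finite by blast
  define D where "D = D0 \<union> A"
  note D = D[folded D_def]
  have AD: "A \<subseteq> D" by (simp add: D_def)
  have "\<exists>M. submod V M \<and> stepwise D V M \<and> largest_maximiser \<theta> V M" for \<theta>
    by (rule largest_maximiser_exists[OF D AD, of \<theta>]) (use subobject_submod in blast)
  then obtain M where M: "submod V (M \<theta>)" "stepwise D V (M \<theta>)" "largest_maximiser \<theta> V (M \<theta>)" for \<theta> by metis
  note Msub = largest_maximiser_sub[OF M(3)]
  have anti: "\<theta> \<le> \<theta>' \<Longrightarrow> M \<theta>' \<le> M \<theta>" for \<theta> \<theta>' using max_antimono[OF V M(3) M(3)] .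
  let ?H = "{dimfun S | S. submod V S \<and> stepwise D V S}"
  have finH: "finite ?H" using finite_dimfuns[OF D] .
  have MH: "dimfun (M \<theta>) \<in> ?H" for \<theta> using M by blast
  have injR: "M \<theta> = M \<theta>'" if "dimfun (M \<theta>) = dimfun (M \<theta>')" for \<theta> \<theta>'
  proof (cases "\<theta> \<le> \<theta>'")
    case True
    show ?thesis by (rule R_mono(2)[OF V Msub Msub anti[OF True], symmetric]) (simp add: that)
  next
    case False
    then have "\<theta>' \<le> \<theta>" by simp
    show ?thesis by (rule R_mono(2)[OF V Msub Msub anti[OF \<open>\<theta>' \<le> \<theta>\<close>]]) (simp add: that)
  qed
  have finM: "finite (range M)"
  proof (rule finite_imageD[of dimfun])
    show "finite (dimfun ` range M)" by (rule finite_subset[OF _ finH]) (use MH in auto)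
    show "inj_on dimfun (range M)" using injR by (auto simp: inj_on_def)
  qed
  note zsub = subobject_zero[OF V] and vsub = subobject_self[OF V]
  \<comment> \<open>For \<open>\<theta>\<close> above all slopes that occur, every nonzero candidate has negative degree.\<close>
  have zero_mem: "(\<lambda>_. {0}) \<in> range M"
  proof -
    define \<theta> where "\<theta> = Max ((\<lambda>h. I h / R h) ` ?H) + 1"
    have "M \<theta> = (\<lambda>_. {0})"
    proof (rule ccontr)
      assume "M \<theta> \<noteq> (\<lambda>_. {0})"
      then have p: "0 < R (dimfun (M \<theta>))" using sub_pos[OF V Msub] by blast
      have "I (dimfun (M \<theta>)) / R (dimfun (M \<theta>)) \<le> Max ((\<lambda>h. I h / R h) ` ?H)"
        using finH MH by (intro Max_ge) auto
      then have "I (dimfun (M \<theta>)) / R (dimfun (M \<theta>)) < \<theta>" by (simp add: \<theta>_def)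
      then have "deg \<theta> (M \<theta>) < 0" using p by (simp add: deg_def field_simps)
      moreover have "deg \<theta> (\<lambda>_. {0}) \<le> deg \<theta> (M \<theta>)" using largest_maximiser_ge[OF M(3) zsub] .
      ultimately show False by (simp add: deg_def)
    qed
    then show ?thesis by (metis rangeI)
  qed
  \<comment> \<open>For \<open>\<theta>\<close> below all slopes of quotients that occur, enlarging a candidate to \<open>V\<close> pays.\<close>
  have top_mem: "sp V \<in> range M"
  proof -
    let ?r = "\<lambda>h. (I (dimfun (sp V)) - I h) / (R (dimfun (sp V)) - R h)"
    define \<theta> where "\<theta> = Min (?r ` ?H) - 1"
    have "M \<theta> = sp V"
    proof (rule ccontr)
      assume ne: "M \<theta> \<noteq> sp V"
      then have p: "R (dimfun (M \<theta>)) < R (dimfun (sp V))"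
        using R_mono[OF V vsub Msub[of \<theta>] subobject_le[OF Msub]] by fastforce
      have "Min (?r ` ?H) \<le> ?r (dimfun (M \<theta>))"
        using finH MH by (intro Min_le) auto
      then have "\<theta> < ?r (dimfun (M \<theta>))" by (simp add: \<theta>_def)
      then have "deg \<theta> (M \<theta>) < deg \<theta> (sp V)" using p by (simp add: deg_def field_simps)
      then show False using largest_maximiser_ge[OF M(3) vsub] by (simp add: not_le[symmetric])
    qed
    then show ?thesis by (metis rangeI)
  qed
  \<comment> \<open>Order the values of \<open>M\<close> by decreasing \<open>\<theta>\<close>.\<close>
  define rep where "rep y = (SOME \<theta>. M \<theta> = y)" for y
  have Mrep: "M (rep y) = y" if "y \<in> range M" for y
    unfolding rep_def by (rule someI_ex) (use that in auto)
  define X where "X = (\<lambda>y. - rep y) ` range M"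
  have finX: "finite X" and neX: "X \<noteq> {}" using finM by (auto simp: X_def)
  define ts where "ts = sorted_list_of_set X"
  have ts: "set ts = X" "sorted_wrt (<) ts" using finX by (auto simp: ts_def)
  then have "ts \<noteq> []" using neX by auto
  define l where "l = length ts - 1"
  have len: "length ts = Suc l" using \<open>ts \<noteq> []\<close> by (simp add: l_def)
  define th where "th j = - ts ! j" for j
  have th_less: "th k < th j" if "j < k" "k \<le> l" for j k
    using sorted_wrt_nth_less[OF ts(2) that(1)] that(2) len by (simp add: th_def)
  have th_le: "th k \<le> th j" if "j \<le> k" "k \<le> l" for j k
    using th_less[of j k] that by (cases "j = k") auto
  define F where "F j = M (th j)" for j
  have rep_th: "rep (F j) = th j" if "j \<le> l" for j
  proof -
    have "ts ! j \<in> X" using ts(1) len that by (metis le_imp_less_Suc nth_mem)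
    then obtain y where y: "y \<in> range M" "ts ! j = - rep y" by (auto simp: X_def)
    then have "F j = y" using Mrep by (simp add: F_def th_def)
    then show ?thesis using y by (simp add: th_def)
  qed
  have F_all: "\<exists>k\<le>l. y = F k" if "y \<in> range M" for y
  proof -
    have "- rep y \<in> set ts" using that ts(1) by (auto simp: X_def)
    then obtain k where "k < length ts" "ts ! k = - rep y" by (auto simp: in_set_conv_nth)
    then show ?thesis using Mrep[OF that] len by (intro exI[of _ k]) (auto simp: F_def th_def)
  qed
  have F_mono: "F j \<le> F k" if "j \<le> k" "k \<le> l" for j k
    using anti[OF th_le[OF that]] by (simp add: F_def)
  have F_neq: "F j \<noteq> F k" if "j < k" "k \<le> l" for j k
    using rep_th[of j] rep_th[of k] th_less[OF that] that by auto
  have Fsub: "subobject V (F j)" for j using Msub by (simp add: F_def)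
  have F0: "F 0 = (\<lambda>_. {0})"
  proof -
    obtain k where "k \<le> l" "(\<lambda>_. {0}) = F k" using F_all[OF zero_mem] by blast
    then have "F 0 \<le> (\<lambda>_. {0})" using F_mono[of 0 k] by simp
    then show ?thesis using sub_zeros[OF Fsub[of 0]] by (intro antisym) (auto simp: le_fun_def)
  qed
  have Fl: "F l = sp V"
  proof -
    obtain k where "k \<le> l" "sp V = F k" using F_all[OF top_mem] by blast
    then have "sp V \<le> F l" using F_mono[of k l] by simp
    then show ?thesis using subobject_le[OF Fsub] by (intro antisym)
  qed
  define \<mu> where "\<mu> j = (I (dimfun (F (Suc j))) - I (dimfun (F j))) /
      (R (dimfun (F (Suc j))) - R (dimfun (F j)))" for j
  have Rless: "R (dimfun (F j)) < R (dimfun (F (Suc j)))" if "j < l" for j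
    using R_mono[OF V Fsub Fsub F_mono[of j "Suc j"]] F_neq[of j "Suc j"] that by fastforce
  have \<mu>_eq: "I (dimfun (F (Suc j))) - I (dimfun (F j)) = \<mu> j * (R (dimfun (F (Suc j))) - R (dimfun (F j)))"
    if "j < l" for j using Rless[OF that] by (simp add: \<mu>_def)
  have \<mu>_ge: "th (Suc j) \<le> \<mu> j" if "j < l" for j
  proof -
    have "deg (th (Suc j)) (F j) \<le> deg (th (Suc j)) (F (Suc j))"
      using largest_maximiser_ge[OF M(3) Fsub] by (simp add: F_def)
    then show ?thesis using Rless[OF that] by (simp add: \<mu>_def deg_def field_simps)
  qed
  have \<mu>_less: "\<mu> j < th j" if "j < l" for j
  proof -
    have "\<not> F (Suc j) \<le> F j" using F_mono[of j "Suc j"] F_neq[of j "Suc j"] that by auto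
    then have "deg (th j) (F (Suc j)) < deg (th j) (F j)"
      using largest_maximiser_largest[OF M(3) Fsub, of "th j"] by (fastforce simp: F_def not_le)
    then show ?thesis using Rless[OF that] by (simp add: \<mu>_def deg_def field_simps)
  qed
  have \<mu>_tie: "deg (\<mu> j) (F j) = deg (\<mu> j) (F (Suc j))" if "j < l" for j
    using \<mu>_eq[OF that] by (simp add: deg_def algebra_simps)
  have M\<mu>: "M (\<mu> j) = F (Suc j)" if j: "j < l" for j
  proof -
    obtain k where k: "k \<le> l" "M (\<mu> j) = F k" using F_all by blast
    have 1: "F j \<le> F k" using anti[of "\<mu> j" "th j"] \<mu>_less[OF j] k by (simp add: F_def)
    have 2: "F k \<le> F (Suc j)" using anti[OF \<mu>_ge[OF j]] k by (simp add: F_def)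
    have "\<not> k < j" using 1 F_mono[of k j] F_neq[of k j] j by auto
    moreover have "\<not> Suc j < k" using 2 F_mono[of "Suc j" k] F_neq[of "Suc j" k] k by auto
    moreover have "k \<noteq> j"
    proof
      assume "k = j"
      then have "F (Suc j) \<le> F j"
        using largest_maximiser_largest[OF M(3) Fsub, of "\<mu> j" "Suc j"] k \<mu>_tie[OF j] by simp
      then show False using F_mono[of j "Suc j"] F_neq[of j "Suc j"] j by auto
    qed
    ultimately have "k = Suc j" by linarith
    then show ?thesis using k by simp
  qed
  have "\<exists>C \<pi>. short_exact (V\<lparr>sp := F j\<rparr>) (V\<lparr>sp := F (Suc j)\<rparr>) C (\<lambda>_ v. v) \<pi>" if "j < l" for j
    using quotient_exists[OF V Fsub Fsub F_mono[of j "Suc j"]] that by (metis Suc_leI le_SucI order_refl)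
  then obtain C where C: "\<exists>\<pi>. short_exact (V\<lparr>sp := F j\<rparr>) (V\<lparr>sp := F (Suc j)\<rparr>) (C j) (\<lambda>_ v. v) \<pi>"
    if "j < l" for j by metis
  have Cprop: "semistable Z (C j) \<and> slope Z (C j) = \<mu> j" if j: "j < l" for j
  proof -
    obtain \<pi> where E: "short_exact (V\<lparr>sp := F j\<rparr>) (V\<lparr>sp := F (Suc j)\<rparr>) (C j) (\<lambda>_ v. v) \<pi>"
      using C[OF j] by blast
    note E' = E[unfolded short_exact_def]
    let ?Y = "V\<lparr>sp := F (Suc j)\<rparr>"
    have fp: "?Y \<in> pers_fp" "C j \<in> pers_fp" and hom: "is_hom index_order ?Y (C j) \<pi>" using E' by auto
    have RI: "R (dimfun (F (Suc j))) = R (dimfun (F j)) + R (dimfun (sp (C j)))"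
      "I (dimfun (F (Suc j))) = I (dimfun (F j)) + I (dimfun (sp (C j)))"
      using short_exact_RI[OF E] by simp_all
    have slope: "slope Z (C j) = \<mu> j" using slope_eq[OF fp(2)] RI by (simp add: \<mu>_def)
    have nz: "\<not> zero_pmod (C j)"
    proof
      assume "zero_pmod (C j)"
      then have "dimfun (sp (C j)) = (\<lambda>_. 0)" by (simp add: zero_pmod_def dimfun_def dim_zero)
      then show False using RI(1) Rless[OF j] by simp
    qed
    have "slope Z (C j\<lparr>sp := T\<rparr>) \<le> slope Z (C j)"
      if T: "subobject (C j) T" "\<not> zero_pmod (C j\<lparr>sp := T\<rparr>)" for T
    proof -
      let ?P = "pull_sub \<pi> (F (Suc j)) T"
      have "subobject ?Y ?P" using subobject_pull[OF fp hom subobject_self[OF fp(1)] T(1)] by simp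
      then have P: "subobject V ?P" using subobject_of_subobject[OF Fsub] by blast
      have eq: "dimfun ?P = (\<lambda>q. dimfun (F j) q + dimfun T q)"
        using short_exact_pull[OF E T(1)] by auto
      have sts: "step_function (dimfun (F j))" "step_function (dimfun T)"
        using step_sub[OF V Fsub] step_sub[OF fp(2) T(1)] by auto
      have "deg (\<mu> j) ?P \<le> deg (\<mu> j) (F j)"
        using largest_maximiser_ge[OF M(3) P, of "\<mu> j"] M\<mu>[OF j] \<mu>_tie[OF j] by simp
      then have "I (dimfun T) \<le> \<mu> j * R (dimfun T)"
        using R_add[OF sts] I_add[OF sts] eq by (simp add: deg_def algebra_simps)
      moreover have "0 < R (dimfun T)" using sub_pos[OF fp(2) T(1)] T(2) by (simp add: zero_pmod_sub)
      ultimately show ?thesis using slope slope_eq[OF subobject_fp[OF T(1)]] by (simp add: pos_divide_le_eq)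
    qed
    then show ?thesis using slope nz fp(2) by (simp add: semistable_def)
  qed
  have "is_HN_filtration Z V l F C"
    unfolding is_HN_filtration_def
  proof (intro conjI allI impI)
    show "F j < F (Suc j)" if "j < l" for j
      using F_mono[of j "Suc j"] F_neq[of j "Suc j"] that by (simp add: less_le)
    show "slope Z (C (Suc j)) < slope Z (C j)" if "Suc j < l" for j
      using Cprop[of j] Cprop[of "Suc j"] that \<mu>_less[of "Suc j"] \<mu>_ge[of j] by fastforce
  qed (use F0 Fl Fsub C Cprop in auto)
  then show ?thesis using that by blast
qed

text \<open>
  Every admissible term of every Harder-Narasimhan filtration is the largest maximiser, so the
  definite description has a unique solution once some filtration exists.
\<close>

theorem HN_part_largest_maximiser:
  assumes V: "V \<in> pers_fp" shows "largest_maximiser \<theta> V (HN_part Z \<theta> V)"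
proof (cases "zero_pmod V")
  case True
  have zero: "S = (\<lambda>_. {0})" if "subobject V S" for S
    using subobject_le[OF that] sub_zeros[OF that] True
    by (intro ext) (auto simp: zero_pmod_def le_fun_def)
  have "largest_maximiser \<theta> V (\<lambda>_. {0})"
    unfolding largest_maximiser_def using subobject_zero[OF V] zero by blast
  then show ?thesis using True by (simp add: HN_part_def)
next
  case False
  let ?P = "\<lambda>S. \<exists>l F C i. is_HN_filtration Z V l F C \<and> i \<le> l \<and> S = F i \<and>
        (i = 0 \<or> \<theta> \<le> slope Z (C (i - 1))) \<and> (i = l \<or> slope Z (C i) < \<theta>)"
  have max: "largest_maximiser \<theta> V S" if "?P S" for S using that HN_cut[OF V] by blast
  obtain l F C where HN: "is_HN_filtration Z V l F C" using HN_exists[OF V False] .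
  define i where "i = (LEAST i. i = l \<or> slope Z (C i) < \<theta>)"
  have i: "i = l \<or> slope Z (C i) < \<theta>" unfolding i_def by (rule LeastI[of _ l]) simp
  have "i \<le> l" unfolding i_def by (rule Least_le) simp
  moreover have "i = 0 \<or> \<theta> \<le> slope Z (C (i - 1))"
    using not_less_Least[of "i - 1" "\<lambda>i. i = l \<or> slope Z (C i) < \<theta>"] unfolding i_def[symmetric]
    by (cases i) auto
  ultimately have P: "?P (F i)" using HN i by blast
  have "?P (THE S. ?P S)"
    by (rule theI[of ?P, OF P]) (use largest_maximiser_unique max P in blast)
  then have "largest_maximiser \<theta> V (THE S. ?P S)" by (rule max)
  then show ?thesis using False by (simp add: HN_part_def)
qed

corollary HN_part_hom:
  assumes "V \<in> pers_fp" "W \<in> pers_fp" "is_hom index_order V W \<phi>" "v \<in> HN_part Z \<theta> V q"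
  shows "\<phi> q v \<in> HN_part Z \<theta> W q"
  using largest_maximiser_hom[OF assms(1-3) HN_part_largest_maximiser[OF assms(1)] HN_part_largest_maximiser[OF assms(2)] assms(4)] .

end

section \<open>Ranks and landscapes\<close>

lemma sup_norm_add_vec:
  fixes h :: "'a::measured_coord^'n"
  assumes "0 \<le> \<epsilon>" shows "sup_norm (h + vec \<epsilon>) \<le> sup_norm h + coord_real \<epsilon>"
proof -
  have "\<bar>coord_real ((h + vec \<epsilon>) $ i)\<bar> \<le> sup_norm h + coord_real \<epsilon>" for i
  proof -
    have "\<bar>coord_real (h $ i)\<bar> \<le> sup_norm h" unfolding sup_norm_def by (intro Max_ge) auto
    then show ?thesis using coord_real_nonneg[OF assms] by (simp add: coord_real_add)
  qed
  then show ?thesis unfolding sup_norm_def[of "h + vec \<epsilon>"] by (intro Max.boundedI) auto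
qed

text \<open>
  If the radius \<open>e\<close> is admissible for \<open>s\<close>, then \<open>e - \<epsilon>\<close> is admissible for \<open>s'\<close>: test \<open>s\<close> on the enlarged
  vector \<open>h + (\<epsilon>, \<dots>, \<epsilon>)\<close>.
\<close>

lemma landscape_shift_le:
  fixes s s' :: "'a::measured_coord^'n \<Rightarrow> 'a^'n \<Rightarrow> enat"
  assumes \<epsilon>: "0 \<le> \<epsilon>" and le: "\<And>x y. x \<le> y \<Longrightarrow> s (x - vec \<epsilon>) (y + vec \<epsilon>) \<le> s' x y"
    and inf: "\<And>x y. \<not> x \<le> y \<Longrightarrow> s' x y = \<infinity>"
  shows "landscape s k x \<le> landscape s' k x + ennreal (coord_real \<epsilon>)"
  unfolding landscape_def[of s]
proof (rule Sup_least, clarify)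
  fix e :: real
  assume e: "0 < e" and ball: "\<forall>h. sup_norm h \<le> e \<longrightarrow> enat k \<le> s (x - h) (x + h)"
  note c0 = coord_real_nonneg[OF \<epsilon>]
  show "ennreal e \<le> landscape s' k x + ennreal (coord_real \<epsilon>)"
  proof (cases "e \<le> coord_real \<epsilon>")
    case True
    then show ?thesis by (metis add_increasing ennreal_leI zero_le)
  next
    case False
    define d where "d = e - coord_real \<epsilon>"
    have d: "0 < d" "e = d + coord_real \<epsilon>" using False by (auto simp: d_def)
    have "enat k \<le> s' (x - h) (x + h)" if h: "sup_norm h \<le> d" for h
    proof (cases "x - h \<le> x + h")
      case True
      have "sup_norm (h + vec \<epsilon>) \<le> e" using sup_norm_add_vec[OF \<epsilon>, of h] h d by simp
      then have "enat k \<le> s (x - (h + vec \<epsilon>)) (x + (h + vec \<epsilon>))" using ball by blast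
      also have "\<dots> = s ((x - h) - vec \<epsilon>) ((x + h) + vec \<epsilon>)" by (simp add: algebra_simps)
      also have "\<dots> \<le> s' (x - h) (x + h)" using le[OF True] .
      finally show ?thesis .
    qed (simp add: inf)
    then have "ennreal d \<le> landscape s' k x"
      unfolding landscape_def using d by (intro Sup_upper) blast
    then show ?thesis using d c0 by (simp add: ennreal_plus add_right_mono)
  qed
qed

lemma abs_diff_le:
  assumes "a \<le> b + c" "b \<le> a + c" shows "abs_diff a b \<le> c"
proof (cases "a = \<infinity> \<and> b = \<infinity>")
  case False
  have "a - b \<le> c" if "a \<le> b + c" "\<not> (a = \<infinity> \<and> b = \<infinity>)" for a b :: ennreal
    using that by (auto simp: ennreal_minus_le_iff)
  from this[of a b] this[of b a] show ?thesis using False assms by (auto simp: abs_diff_def)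
qed (simp add: abs_diff_def)

context step_charge
begin

text \<open>
  Restricted to the pieces of the shifted modules, the structure map of \<open>V\<close> from \<open>x - \<epsilon>\<close> to \<open>y + \<epsilon>\<close>
  factors through that of \<open>W\<close> from \<open>x\<close> to \<open>y\<close>. The first factor \<open>f\<close> respects the pieces because it is a
  morphism of shifted modules, and the linear map \<open>g\<close> applied last cannot raise the rank.
\<close>

lemma HN_rank_interleaved:
  fixes V W :: "('a^'n, 'v) pmod"
  assumes V: "V \<in> pers_fp" and W: "W \<in> pers_fp" and \<epsilon>: "0 \<le> \<epsilon>" and xy: "x \<le> y"
    and f: "is_hom index_order V (shift (vec \<epsilon>) W) f" and g: "is_hom index_order W (shift (vec \<epsilon>) V) g"
    and gf: "\<And>q v. v \<in> sp V q \<Longrightarrow> g (vec \<epsilon> + q) (f q v) = tr V q (vec \<epsilon> + (vec \<epsilon> + q)) v"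
  shows "HN_rank Z \<theta> V (x - vec \<epsilon>) (y + vec \<epsilon>) \<le> HN_rank Z \<theta> W x y"
proof -
  let ?X = "x - vec \<epsilon>" and ?Y = "y + vec \<epsilon>"
  note L = fp_pers[OF V] and LW = fp_pers[OF W]
  have e0: "?X \<le> x" "y \<le> ?Y" "x \<le> x + vec \<epsilon>" using \<epsilon> by (auto simp: less_eq_vec_def)
  then have XY: "?X \<le> ?Y" using xy by (meson order_trans)
  have mono: "a + p \<le> a + q" if "p \<le> q" for a p q :: "'a^'n"
    using that by (simp add: less_eq_vec_def)
  have flin: "linear_between (sp V p) (sp W (vec \<epsilon> + p)) (f p)" for p
    using hom_linear[OF f] by (simp add: shift_def pullback_def)
  have fcomm: "f q (tr V p q v) = tr W (vec \<epsilon> + p) (vec \<epsilon> + q) (f p v)"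
    if "p \<le> q" "v \<in> sp V p" for p q v
    using hom_comm[OF f that] by (simp add: shift_def pullback_def)
  have glin: "linear_between (sp W p) (sp V (vec \<epsilon> + p)) (g p)" for p
    using hom_linear[OF g] by (simp add: shift_def pullback_def)
  have gcomm: "g q (tr W p q v) = tr V (vec \<epsilon> + p) (vec \<epsilon> + q) (g p v)"
    if "p \<le> q" "v \<in> sp W p" for p q v
    using hom_comm[OF g that] by (simp add: shift_def pullback_def)
  have shift_eq: "vec \<epsilon> + (?X + q) = x + q" for q by simp
  have hom: "is_hom index_order (shift ?X V) (shift x W) (\<lambda>q. f (?X + q))"
    unfolding is_hom_index_iff
  proof (intro conjI allI impI ballI)
    show "linear_between (sp (shift ?X V) p) (sp (shift x W) p) (f (?X + p))" for p
      using flin[of "?X + p", unfolded shift_eq] by (simp add: shift_def pullback_def)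
    show "f (?X + q) (tr (shift ?X V) p q v) = tr (shift x W) p q (f (?X + p) v)"
      if "p \<le> q" "v \<in> sp (shift ?X V) p" for p q v
      using fcomm[OF mono[OF that(1), of ?X], unfolded shift_eq] that(2)
      by (simp add: shift_def pullback_def)
  qed
  define S where "S = HN_part Z \<theta> (shift ?X V) 0"
  define T where "T = HN_part Z \<theta> (shift x W) 0"
  note sV = shift_fp[OF V, of ?X] and sW = shift_fp[OF W, of x]
  have fST: "f ?X v \<in> T" if "v \<in> S" for v
    using HN_part_hom[OF sV sW hom, of v \<theta> 0] that by (simp add: S_def T_def)
  have S: "subspace S" "S \<subseteq> sp V ?X"
    using submod_sub[OF subobject_submod[OF largest_maximiser_sub[OF HN_part_largest_maximiser[OF sV]]]]
      submod_le[OF subobject_submod[OF largest_maximiser_sub[OF HN_part_largest_maximiser[OF sV]]], of _ 0]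
    by (auto simp: S_def shift_def pullback_def)
  have T: "subspace T" "T \<subseteq> sp W x"
    using submod_sub[OF subobject_submod[OF largest_maximiser_sub[OF HN_part_largest_maximiser[OF sW]]]]
      submod_le[OF subobject_submod[OF largest_maximiser_sub[OF HN_part_largest_maximiser[OF sW]]], of _ 0]
    by (auto simp: T_def shift_def pullback_def)
  have factor: "tr V ?X ?Y v = g y (tr W x y (f ?X v))" if v: "v \<in> S" for v
  proof -
    have vV: "v \<in> sp V ?X" and fv: "f ?X v \<in> sp W x" using S T fST[OF v] v by auto
    have "g y (tr W x y (f ?X v)) = tr V (vec \<epsilon> + x) (vec \<epsilon> + y) (g x (f ?X v))"
      using gcomm[OF xy fv] .
    also have "g x (f ?X v) = tr V ?X (vec \<epsilon> + x) v" using gf[OF vV] by simp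
    also have "tr V (vec \<epsilon> + x) (vec \<epsilon> + y) \<dots> = tr V ?X (vec \<epsilon> + y) v"
    proof (rule pers_comp[OF L _ mono[OF xy] vV])
      show "?X \<le> vec \<epsilon> + x" using order_trans[OF e0(1,3)] by (simp add: add.commute)
    qed
    finally show ?thesis by (simp add: add.commute)
  qed
  let ?TW = "tr W x y ` T" and ?SV = "tr V ?X ?Y ` S"
  have finS: "fin_subspace S" using fin_subspace_subset[OF pers_fin[OF L] S] .
  have finT: "fin_subspace T" using fin_subspace_subset[OF pers_fin[OF LW] T] .
  have linT: "linear_between T (sp W y) (tr W x y)"
    using linear_between_subset[OF pers_linear[OF LW xy] T(2)] pers_tr[OF LW xy] T(2) by blast
  have linS: "linear_between S (sp V ?Y) (tr V ?X ?Y)"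
    using linear_between_subset[OF pers_linear[OF L XY] S(2)] pers_tr[OF L XY] S(2) by blast
  have finTW: "fin_subspace ?TW" using fin_subspace_image[OF finT linT] .
  have TWy: "?TW \<subseteq> sp W y" using linT by (simp add: linear_between_def)
  have ling: "linear_between ?TW (sp V (vec \<epsilon> + y)) (g y)"
    by (rule linear_between_subset[OF glin TWy]) (use TWy linear_between_in[OF glin] in auto)
  have "?SV \<subseteq> g y ` ?TW" using factor fST by auto
  then have "dim ?SV \<le> dim (g y ` ?TW)"
    using dim_subset_le[OF fin_subspace_image[OF finTW ling] fin_subspaceD[OF fin_subspace_image[OF finS linS]]]
    by blast
  also have "\<dots> \<le> dim ?TW" using rank_nullity[OF finTW ling] by simp
  finally have "dim ?SV \<le> dim ?TW" .
  moreover have "HN_rank Z \<theta> U p q = enat (dim (tr U p q ` HN_part Z \<theta> (shift p U) 0))"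
    if "p \<le> q" for p q :: "'a^'n" and U :: "('a^'n, 'v) pmod"
    using that by (simp add: HN_rank_def shift_def pullback_def)
  ultimately show ?thesis using xy XY by (simp add: S_def T_def)
qed

theorem HN_landscape_stable:
  fixes V W :: "('a^'n, 'v) pmod"
  assumes V: "V \<in> pers_fp" and W: "W \<in> pers_fp"
  shows "(SUP \<theta>. landscape_distance (landscape (HN_rank Z \<theta> V)) (landscape (HN_rank Z \<theta> W)))
      \<le> interleaving_distance V W"
  unfolding interleaving_distance_def
proof (rule Inf_greatest, clarify)
  fix \<epsilon> :: 'a assume \<epsilon>: "0 \<le> \<epsilon>" and "interleaved \<epsilon> V W"
  then obtain f g where f: "is_hom index_order V (shift (vec \<epsilon>) W) f"
    and g: "is_hom index_order W (shift (vec \<epsilon>) V) g"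
    and gf: "\<forall>q. \<forall>v\<in>sp V q. g (vec \<epsilon> + q) (f q v) = tr V q (vec \<epsilon> + (vec \<epsilon> + q)) v"
    and fg: "\<forall>q. \<forall>w\<in>sp W q. f (vec \<epsilon> + q) (g q w) = tr W q (vec \<epsilon> + (vec \<epsilon> + q)) w"
    unfolding interleaved_def by (elim exE conjE) (rule that)
  have inf: "HN_rank Z \<theta> U x y = \<infinity>" if "\<not> x \<le> y" for \<theta> U x y using that by (simp add: HN_rank_def)
  have "abs_diff (landscape (HN_rank Z \<theta> V) k x) (landscape (HN_rank Z \<theta> W) k x) \<le> ennreal (coord_real \<epsilon>)"
    for \<theta> k x
  proof (rule abs_diff_le)
    show "landscape (HN_rank Z \<theta> V) k x \<le> landscape (HN_rank Z \<theta> W) k x + ennreal (coord_real \<epsilon>)"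
    proof (rule landscape_shift_le[OF \<epsilon>])
      show "HN_rank Z \<theta> V (x - vec \<epsilon>) (y + vec \<epsilon>) \<le> HN_rank Z \<theta> W x y" if "x \<le> y" for x y
        by (rule HN_rank_interleaved[OF V W \<epsilon> that f g]) (use gf in simp)
    qed (rule inf)
    show "landscape (HN_rank Z \<theta> W) k x \<le> landscape (HN_rank Z \<theta> V) k x + ennreal (coord_real \<epsilon>)"
    proof (rule landscape_shift_le[OF \<epsilon>])
      show "HN_rank Z \<theta> W (x - vec \<epsilon>) (y + vec \<epsilon>) \<le> HN_rank Z \<theta> V x y" if "x \<le> y" for x y
        by (rule HN_rank_interleaved[OF W V \<epsilon> that g f]) (use fg in simp)
    qed (rule inf)
  qed
  then show "(SUP \<theta>. landscape_distance (landscape (HN_rank Z \<theta> V)) (landscape (HN_rank Z \<theta> W)))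
      \<le> ennreal (coord_real \<epsilon>)"
    unfolding landscape_distance_def by (auto intro!: SUP_least)
qed

end

section \<open>Step functions and integrals\<close>

definition vec_measure :: "('n::finite \<Rightarrow> 'a measure) \<Rightarrow> ('a^'n) measure" where
  "vec_measure M = embed_measure (PiM UNIV M) vec_lambda"

lemma space_vec_measure: "q \<in> space (vec_measure M) \<longleftrightarrow> (\<forall>i. q $ i \<in> space (M i))"
proof
  assume "q \<in> space (vec_measure M)"
  then show "\<forall>i. q $ i \<in> space (M i)"
    by (auto simp: vec_measure_def space_embed_measure space_PiM PiE_iff)
next
  assume "\<forall>i. q $ i \<in> space (M i)"
  then have "vec_nth q \<in> space (PiM UNIV M)" by (auto simp: space_PiM)
  then have "vec_lambda (vec_nth q) \<in> vec_lambda ` space (PiM UNIV M)" by (rule imageI)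
  then show "q \<in> space (vec_measure M)" by (simp add: vec_measure_def space_embed_measure vec_nth_inverse)
qed

lemma measurable_vec_measure:
  "(\<lambda>x. g (vec_lambda x)) \<in> measurable (PiM UNIV M) N \<Longrightarrow> g \<in> measurable (vec_measure M) N"
  unfolding vec_measure_def by (rule measurable_embed_measure1)

lemma measurable_vec_lambda: "vec_lambda \<in> measurable (PiM UNIV M) (vec_measure M)"
  unfolding vec_measure_def by (rule measurable_embed_measure2[OF inj_vec_lambda])

lemma vec_measure_distr: "vec_measure M = distr (PiM UNIV M) (vec_measure M) vec_lambda"
  unfolding vec_measure_def by (rule embed_measure_eq_distr[OF inj_vec_lambda])

lemma integral_vec_measure:
  fixes f :: "'a^'n::finite \<Rightarrow> real"
  assumes "f \<in> borel_measurable (vec_measure M)"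
  shows "integral\<^sup>L (vec_measure M) f = integral\<^sup>L (PiM UNIV M) (\<lambda>x. f (vec_lambda x))"
    and "integrable (vec_measure M) f \<longleftrightarrow> integrable (PiM UNIV M) (\<lambda>x. f (vec_lambda x))"
proof -
  show "integral\<^sup>L (vec_measure M) f = integral\<^sup>L (PiM UNIV M) (\<lambda>x. f (vec_lambda x))"
    by (subst vec_measure_distr, rule integral_distr[OF measurable_vec_lambda assms])
  show "integrable (vec_measure M) f \<longleftrightarrow> integrable (PiM UNIV M) (\<lambda>x. f (vec_lambda x))"
    by (subst vec_measure_distr, rule integrable_distr_eq[OF measurable_vec_lambda assms])
qed

lemma step_fun_bounded:
  assumes "finite B" "step_fun B h" obtains C where "\<And>q. \<bar>h q\<bar> \<le> C"
proof -
  have "h q = h (SOME q'. key B q' = key B q)" for q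
  proof (rule step_funD[OF assms(2), symmetric])
    show "key B (SOME q'. key B q' = key B q) = key B q" by (rule someI) simp
  qed
  then have "range h \<subseteq> (\<lambda>K. h (SOME q'. key B q' = K)) ` range (key B)" by blast
  then have "finite (range h)" using finite_keys[OF assms(1)] finite_surj by blast
  then have "finite ((\<lambda>q. \<bar>h q\<bar>) ` UNIV)" by (simp add: image_image[of abs h, symmetric])
  then have "\<bar>h q\<bar> \<le> Max (range (\<lambda>q. \<bar>h q\<bar>))" for q by (intro Max_ge) auto
  then show ?thesis using that by blast
qed

text \<open>
  Products of coordinate measures occur twice: on all of \<open>Q\<close>, and on a face, where the factors are
  interval measures or point masses.
\<close>

locale coord_product = product_sigma_finite M
  for M :: "'n::finite \<Rightarrow> 'a::measured_coord measure" +
  assumes sets_up: "{x \<in> space (M i). s \<le> x} \<in> sets (M i)"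
begin

lemma step_fun_measurable:
  fixes h :: "'a^'n \<Rightarrow> real"
  assumes B: "finite B" and h: "step_fun B h"
  shows "h \<in> borel_measurable (vec_measure M)"
proof (rule measurable_vec_measure)
  let ?P = "PiM UNIV M" and ?k = "\<lambda>x. key B (vec_lambda x)"
  have at: "{x \<in> space ?P. a \<le> x i} \<in> sets ?P" for i a
  proof -
    have "(\<lambda>x. x i) -` {y \<in> space (M i). a \<le> y} \<inter> space ?P \<in> sets ?P"
    proof (rule measurable_sets)
      show "(\<lambda>x. x i) \<in> measurable ?P (M i)" by (rule measurable_component_singleton) simp
    qed (rule sets_up)
    moreover have "(\<lambda>x. x i) -` {y \<in> space (M i). a \<le> y} \<inter> space ?P = {x \<in> space ?P. a \<le> x i}"
      by (auto simp: space_PiM)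
    ultimately show ?thesis by simp
  qed
  have "?k \<in> measurable ?P (count_space (Pow B))"
  proof (subst measurable_count_space_eq2)
    show "finite (Pow B)" using B by simp
    have "?k -` {S} \<inter> space ?P \<in> sets ?P" if S: "S \<in> Pow B" for S
    proof -
      have "?k -` {S} \<inter> space ?P = {x \<in> space ?P. \<forall>z\<in>B. snd z \<le> x (fst z) \<longleftrightarrow> z \<in> S}"
      proof -
        have "z \<in> ?k x \<longleftrightarrow> z \<in> B \<and> snd z \<le> x (fst z)" for x z
          by (cases z) (simp add: key_def)
        then have "?k x = S \<longleftrightarrow> (\<forall>z\<in>B. snd z \<le> x (fst z) \<longleftrightarrow> z \<in> S)" for x
          unfolding set_eq_iff using S by blast
        then show ?thesis by (simp add: vimage_def Int_def conj_commute)
      qed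
      moreover have "{x \<in> space ?P. \<forall>z\<in>B. snd z \<le> x (fst z) \<longleftrightarrow> z \<in> S} \<in> sets ?P"
      proof (rule sets.sets_Collect_finite_All[OF _ B])
        fix z
        show "{x \<in> space ?P. snd z \<le> x (fst z) \<longleftrightarrow> z \<in> S} \<in> sets ?P"
          using at[of "snd z" "fst z"] sets.sets_Collect_neg[OF at[of "snd z" "fst z"]]
          by (cases "z \<in> S") simp_all
      qed
      ultimately show ?thesis by simp
    qed
    then show "?k \<in> space ?P \<rightarrow> Pow B \<and> (\<forall>S\<in>Pow B. ?k -` {S} \<inter> space ?P \<in> sets ?P)"
      by (auto simp: key_def)
  qed
  moreover have "(\<lambda>K. h (SOME q. key B q = K)) \<in> borel_measurable (count_space (Pow B))" by simp
  ultimately have "(\<lambda>x. h (SOME q. key B q = ?k x)) \<in> borel_measurable ?P"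
    by (rule measurable_compose)
  moreover have "h (SOME q. key B q = ?k x) = h (vec_lambda x)" for x
  proof (rule step_funD[OF h])
    show "key B (SOME q. key B q = ?k x) = ?k x" by (rule someI) simp
  qed
  ultimately show "(\<lambda>x. h (vec_lambda x)) \<in> borel_measurable ?P" by simp
qed

lemma integrable_times_step:
  assumes w: "integrable (vec_measure M) w" and "step_function h"
  shows "integrable (vec_measure M) (\<lambda>q. w q * h q :: real)"
proof -
  obtain B where B: "finite B" "step_fun B h" using assms(2) by (auto simp: step_function_def)
  obtain C where C: "\<And>q. \<bar>h q\<bar> \<le> C" using step_fun_bounded[OF B] by blast
  have "integrable (vec_measure M) (\<lambda>q. C * w q)" using w by simp
  then show ?thesis
  proof (rule Bochner_Integration.integrable_bound)
    show "(\<lambda>q. w q * h q) \<in> borel_measurable (vec_measure M)"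
      using w step_fun_measurable[OF B] by simp
    have "\<bar>w q * h q\<bar> \<le> \<bar>C * w q\<bar>" for q
      using mult_mono[OF C order_refl, of "\<bar>w q\<bar>" q] C[of q] by (simp add: abs_mult mult.commute)
    then show "AE q in vec_measure M. norm (w q * h q) \<le> norm (C * w q)" by simp
  qed
qed

text \<open>
  Fubini: the integral over a slab is proportional to the width of the slab in direction \<open>i\<close>.
\<close>

lemma integral_slab:
  fixes f g :: "'a^'n \<Rightarrow> real"
  assumes f: "integrable (vec_measure M) f" "\<And>q. f q = (if q $ i \<in> J then g q else 0)"
    and g: "\<And>q x. g (upd q i x) = g q"
    and J: "J \<inter> space (M i) \<in> sets (M i)"
  shows "integral\<^sup>L (vec_measure M) f =
    measure (M i) (J \<inter> space (M i)) * (\<integral>x. g (vec_lambda x) \<partial>PiM (UNIV - {i}) M)"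
proof -
  have fm: "f \<in> borel_measurable (vec_measure M)" using f(1) by auto
  have U: "insert i (UNIV - {i}) = UNIV" by auto
  have int: "integrable (PiM (insert i (UNIV - {i})) M) (\<lambda>x. f (vec_lambda x))"
    using f(1) integral_vec_measure(2)[OF fm] by (simp add: U)
  have upd: "vec_lambda (x(i := y)) = upd (vec_lambda x) i y" for x y
    by (simp add: upd_def vec_eq_iff)
  have "integral\<^sup>L (vec_measure M) f = integral\<^sup>L (PiM (insert i (UNIV - {i})) M) (\<lambda>x. f (vec_lambda x))"
    using integral_vec_measure(1)[OF fm] by (simp add: U)
  also have "\<dots> = (\<integral>x. (\<integral>y. f (vec_lambda (x(i := y))) \<partial>M i) \<partial>PiM (UNIV - {i}) M)"
    by (rule product_integral_insert[OF _ _ int]) auto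
  also have "\<dots> = (\<integral>x. measure (M i) (J \<inter> space (M i)) * g (vec_lambda x) \<partial>PiM (UNIV - {i}) M)"
  proof (intro Bochner_Integration.integral_cong refl)
    fix x
    have "(\<integral>y. f (vec_lambda (x(i := y))) \<partial>M i) = (\<integral>y. indicator J y * g (vec_lambda x) \<partial>M i)"
      by (intro Bochner_Integration.integral_cong refl) (simp add: f(2) upd g indicator_def)
    also have "\<dots> = (\<integral>y. indicator (J \<inter> space (M i)) y * g (vec_lambda x) \<partial>M i)"
      by (intro Bochner_Integration.integral_cong refl) (simp add: indicator_def)
    also have "\<dots> = measure (M i) (J \<inter> space (M i)) * g (vec_lambda x)"
      by simp
    finally show "(\<integral>y. f (vec_lambda (x(i := y))) \<partial>M i) = measure (M i) (J \<inter> space (M i)) * g (vec_lambda x)" .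
  qed
  finally show ?thesis by simp
qed

lemma integrable_one:
  assumes "\<And>i. finite_measure (M i)" shows "integrable (vec_measure M) (\<lambda>_. 1 :: real)"
proof -
  have "emeasure (PiM UNIV M) (space (PiM UNIV M)) = (\<Prod>i\<in>UNIV. emeasure (M i) (space (M i)))"
    unfolding space_PiM by (rule emeasure_PiM) auto
  also have "\<dots> \<noteq> \<infinity>"
  proof
    assume "(\<Prod>i\<in>UNIV. emeasure (M i) (space (M i))) = \<infinity>"
    then obtain i where "emeasure (M i) (space (M i)) = \<infinity>"
      unfolding infinity_ennreal_def ennreal_prod_eq_top by blast
    then show False using finite_measure.emeasure_finite[OF assms, of i "space (M i)"] by simp
  qed
  finally have "finite_measure (PiM UNIV M)" by (rule finite_measureI)
  then have "integrable (PiM UNIV M) (\<lambda>_. 1 :: real)" by (rule finite_measure.integrable_const)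
  then show ?thesis
    by (rule integral_vec_measure(2)[OF borel_measurable_const, THEN iffD2])
qed

end

lemma sets_interval: "{a..<b :: 'a::measured_coord} \<in> sets coord_measure"
proof -
  have "{a..<b} = {a..} - {b..}" by auto
  then show ?thesis using sets_coord by (metis sets.Diff)
qed

lemma side_measure_interval:
  fixes a b :: "'a::measured_coord"
  assumes "a < b"
  shows "side_measure {a..<b} = restrict_space coord_measure {a..<b}"
proof -
  obtain T where "open T" "T \<noteq> {}" "T \<subseteq> {a..<b}" using interior_interval[OF assms] by blast
  then have "interior {a..<b} \<noteq> {}" using interior_maximal by blast
  then show ?thesis by (simp add: side_measure_def)
qed

lemma space_side_measure [simp]: "space (side_measure (J :: 'a::measured_coord set)) = J"
  by (simp add: side_measure_def space_restrict_space)

lemma sets_side_measure_up: "{x \<in> J. s \<le> x} \<in> sets (side_measure (J :: 'a::measured_coord set))"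
proof -
  have "{x \<in> J. s \<le> x} = J \<inter> {s..}" by auto
  then show ?thesis using sets_coord[of s] by (auto simp: side_measure_def sets_restrict_space)
qed

lemma finite_side_interval:
  fixes a b :: "'a::measured_coord"
  assumes "a < b" shows "finite_measure (side_measure {a..<b})"
proof (rule finite_measureI)
  have "emeasure (side_measure {a..<b}) {a..<b} = emeasure coord_measure {a..<b}"
    unfolding side_measure_interval[OF assms] by (rule emeasure_restrict_space) (auto simp: sets_interval)
  then show "emeasure (side_measure {a..<b}) (space (side_measure {a..<b})) \<noteq> \<infinity>"
    using coord_measure_finite[of a b] by simp
qed

lemma finite_side_point: "finite_measure (side_measure {x :: 'a::measured_coord})"
proof (rule finite_measureI)
  have "emeasure coord_measure {x} \<le> emeasure coord_measure {x..<x + 1}"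
    by (rule emeasure_mono) (auto simp: sets_interval)
  then have "emeasure coord_measure {x} < \<infinity>" using coord_measure_finite le_less_trans by blast
  then show "emeasure (side_measure {x}) (space (side_measure {x})) \<noteq> \<infinity>"
    using sets_coord_singleton[of x]
    by (simp add: side_measure_def emeasure_restrict_space less_top[symmetric])
qed

definition face_side :: "'a::order set \<Rightarrow> bool" where
  "face_side J \<longleftrightarrow> (\<exists>a b. a < b \<and> J = {a..<b}) \<or> (\<exists>x. J = {x})"

lemma finite_face_side: "face_side (J :: 'a::measured_coord set) \<Longrightarrow> finite_measure (side_measure J)"
  using finite_side_interval finite_side_point by (auto simp: face_side_def)

lemma face_product:
  assumes "\<And>i. face_side (J i :: 'a::measured_coord set)"
  shows "coord_product (\<lambda>i::'n::finite. side_measure (J i))"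
proof -
  have "product_sigma_finite (\<lambda>i. side_measure (J i))"
    unfolding product_sigma_finite_def
    using finite_face_side[OF assms] finite_measure.axioms(1) by blast
  then show ?thesis
    by (simp add: coord_product_def coord_product_axioms_def sets_side_measure_up)
qed

lemma full_product: "coord_product (\<lambda>i::'n::finite. coord_measure :: 'a::measured_coord measure)"
proof -
  have "product_sigma_finite (\<lambda>i::'n. coord_measure :: 'a measure)"
    unfolding product_sigma_finite_def using sigma_finite_coord by blast
  moreover have "{x. s \<le> x} \<in> sets (coord_measure :: 'a measure)" for s
    using sets_coord[of s] by (simp add: atLeast_def)
  ultimately show ?thesis by (simp add: coord_product_def coord_product_axioms_def)
qed

lemma cube_measure_full: "cube_measure UNIV = vec_measure (\<lambda>i::'n::finite. coord_measure :: 'a::measured_coord measure)"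
  by (simp add: cube_measure_def vec_measure_def range_coord side_measure_UNIV)

lemma cube_measure_prod:
  fixes J :: "'n::finite \<Rightarrow> 'a::measured_coord set"
  assumes "\<And>i. J i \<noteq> {}"
  shows "cube_measure (prod_cube J) = vec_measure (\<lambda>i. side_measure (J i))"
proof -
  have "(\<lambda>q. q $ i) ` prod_cube J = J i" for i
  proof
    show "J i \<subseteq> (\<lambda>q. q $ i) ` prod_cube J"
    proof
      fix x assume x: "x \<in> J i"
      define q :: "'a^'n" where "q = (\<chi> j. if j = i then x else SOME y. y \<in> J j)"
      have "q \<in> prod_cube J"
        using x assms some_in_eq[of "J _"] by (auto simp: q_def prod_cube_def)
      moreover have "q $ i = x" by (simp add: q_def)
      ultimately show "x \<in> (\<lambda>q. q $ i) ` prod_cube J" by force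
    qed
  qed (auto simp: prod_cube_def)
  then show ?thesis by (simp add: cube_measure_def vec_measure_def)
qed

lemma step_function_slab:
  fixes \<Delta> :: "'a::linorder^'n \<Rightarrow> real"
  assumes "step_function \<Delta>" "finite U"
  shows "step_function (slab_low s' s i \<Delta>)" "step_function (slab_high s U i \<Delta>)"
proof -
  obtain B where B: "finite B" "step_fun B \<Delta>" using assms(1) by (auto simp: step_function_def)
  let ?C = "B \<union> {(i, s'), (i, s)} \<union> Pair i ` U"
  have C: "finite ?C" using B assms(2) by simp
  have kB: "\<Delta> q = \<Delta> q'" if "key ?C q = key ?C q'" for q q'
    by (rule step_funD[OF step_fun_mono[OF B(2)] that]) auto
  have k: "a \<le> q $ i \<longleftrightarrow> a \<le> q' $ i" "q $ i < a \<longleftrightarrow> q' $ i < a"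
    if "key ?C q = key ?C q'" "(i, a) \<in> ?C" for q q' a
  proof -
    show 1: "a \<le> q $ i \<longleftrightarrow> a \<le> q' $ i" using that unfolding key_eq_iff by blast
    then show "q $ i < a \<longleftrightarrow> q' $ i < a" unfolding not_le[symmetric] by blast
  qed
  have "step_fun ?C (slab_low s' s i \<Delta>)"
    unfolding step_fun_def
  proof (intro allI impI)
    fix q q' assume c: "key ?C q = key ?C q'"
    show "slab_low s' s i \<Delta> q = slab_low s' s i \<Delta> q'"
      using kB[OF c] k(1)[OF c, of s'] k(2)[OF c, of s] by (simp add: slab_low_def)
  qed
  then show "step_function (slab_low s' s i \<Delta>)" by (rule step_functionI[OF C])
  have "step_fun ?C (slab_high s U i \<Delta>)"
    unfolding step_fun_def
  proof (intro allI impI)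
    fix q q' assume c: "key ?C q = key ?C q'"
    show "slab_high s U i \<Delta> q = slab_high s U i \<Delta> q'"
      using kB[OF c] k(1)[OF c, of s] k(2)[OF c] by (simp add: slab_high_def)
  qed
  then show "step_function (slab_high s U i \<Delta>)" by (rule step_functionI[OF C])
qed

lemma cube_mean_nonneg: "(\<And>q. 0 \<le> h q) \<Longrightarrow> 0 \<le> cube_mean c h"
  unfolding cube_mean_def by (intro divide_nonneg_nonneg Bochner_Integration.integral_nonneg) auto

lemma cube_mean_add:
  fixes J :: "'n::finite \<Rightarrow> 'a::measured_coord set"
  assumes J: "\<And>i. face_side (J i)" and h: "step_function h" "step_function h'"
  shows "cube_mean (prod_cube J) (\<lambda>q. h q + h' q) = cube_mean (prod_cube J) h + cube_mean (prod_cube J) h'"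
proof -
  interpret coord_product "\<lambda>i. side_measure (J i)" using face_product[OF J] .
  have ne: "J i \<noteq> {}" for i using J[of i] by (auto simp: face_side_def)
  have one: "integrable (vec_measure (\<lambda>i. side_measure (J i))) (\<lambda>_. 1 :: real)"
    by (rule integrable_one) (rule finite_face_side[OF J])
  have int: "integrable (vec_measure (\<lambda>i. side_measure (J i))) g" if "step_function g" for g
    using integrable_times_step[OF one that] by simp
  show ?thesis
    unfolding cube_mean_def cube_measure_prod[OF ne]
    by (simp add: int h add_divide_distrib)
qed

lemma slab_ivl_sets:
  fixes s :: "'a::measured_coord"
  assumes "finite U" shows "{x. s \<le> x \<and> (\<forall>u\<in>U. x < u)} \<in> sets coord_measure"
proof -
  have "{x. s \<le> x \<and> (\<forall>u\<in>U. x < u)} = {s..} - (\<Union>u\<in>U. {u..})" by (auto simp: not_le)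
  moreover have "{s..} - (\<Union>u\<in>U. {u..}) \<in> sets coord_measure"
    using assms sets_coord by (intro sets.Diff sets.finite_UN) auto
  ultimately show ?thesis by simp
qed

text \<open>
  A face whose side in direction \<open>i\<close> is an interval with ends in \<open>T\<close> covers both halves of the slab or
  neither, so the two means are proportional to the widths of the halves. A face pinned at a point
  of \<open>T\<close> misses the upper half. It may meet the lower half, at \<open>s'\<close>, where it only adds to the mean:
  this is the reason for the inequality, and the place where the weights of the faces have to be nonnegative.
\<close>

lemma cube_mean_slab:
  fixes J :: "'n::finite \<Rightarrow> 'a::measured_coord set"
  assumes J: "\<And>i. face_side (J i)" and \<Delta>: "step_function \<Delta>" "\<And>q. 0 \<le> \<Delta> q" "\<And>q x. \<Delta> (upd q i x) = \<Delta> q"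
    and s: "s' < s" and U: "finite U" "\<And>u. u \<in> U \<Longrightarrow> s < u"
    and T: "\<And>t. t \<in> T \<Longrightarrow> t \<le> s' \<or> t \<in> U"
    and Ji: "(\<exists>a b. a < b \<and> J i = {a..<b} \<and> a \<in> T \<and> b \<in> T) \<or> (\<exists>t. J i = {t} \<and> t \<in> T)"
  obtains E where
    "cube_mean (prod_cube J) (slab_high s U i \<Delta>) =
       measure coord_measure {x. s \<le> x \<and> (\<forall>u\<in>U. x < u)} * E"
    "measure coord_measure {s'..<s} * E \<le> cube_mean (prod_cube J) (slab_low s' s i \<Delta>)"
    "E \<noteq> 0 \<Longrightarrow> \<exists>a b. a \<in> T \<and> b \<in> T \<and> a \<le> s' \<and> b \<in> U"
proof -
  let ?M = "\<lambda>i. side_measure (J i)"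
  interpret coord_product ?M using face_product[OF J] .
  have ne: "J i \<noteq> {}" for i using J[of i] by (auto simp: face_side_def)
  let ?K = "{x. s \<le> x \<and> (\<forall>u\<in>U. x < u)}"
  have one: "integrable (vec_measure ?M) (\<lambda>_. 1 :: real)"
    by (rule integrable_one) (rule finite_face_side[OF J])
  have int: "integrable (vec_measure ?M) g" if "step_function g" for g
    using integrable_times_step[OF one that] by simp
  note st = step_function_slab[OF \<Delta>(1) U(1)]
  have low0: "0 \<le> cube_mean (prod_cube J) (slab_low s' s i \<Delta>)"
    by (rule cube_mean_nonneg) (simp add: slab_low_def \<Delta>(2))
  show ?thesis
  proof (cases "\<exists>a b. a < b \<and> J i = {a..<b} \<and> a \<le> s' \<and> b \<in> U \<and> a \<in> T \<and> b \<in> T")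
    case True
    then obtain a b where ab: "a < b" "J i = {a..<b}" "a \<le> s'" "b \<in> U" "a \<in> T" "b \<in> T" by blast
    have sub: "{s'..<s} \<subseteq> {a..<b}" "?K \<subseteq> {a..<b}"
      using ab s U(2)[OF ab(4)] by (auto intro: less_trans order_trans less_imp_le)
    have meas: "X \<in> sets (?M i)" "measure (?M i) X = measure coord_measure X"
      if "X \<in> sets coord_measure" "X \<subseteq> {a..<b}" for X
    proof -
      show "X \<in> sets (?M i)"
        using that sets_interval[of a b]
        by (simp add: ab(2) side_measure_interval[OF ab(1)] sets_restrict_space_iff)
      show "measure (?M i) X = measure coord_measure X"
        using that sets_interval[of a b]
        by (simp add: ab(2) side_measure_interval[OF ab(1)] measure_restrict_space)
    qed
    let ?c = "\<integral>x. \<Delta> (vec_lambda x) \<partial>PiM (UNIV - {i}) ?M"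
    let ?v = "\<integral>q. 1 \<partial>vec_measure ?M :: real"
    have spX: "X \<inter> space (?M i) = X" if "X \<subseteq> {a..<b}" for X using that ab(2) by auto
    note K = meas[OF slab_ivl_sets[OF U(1)] sub(2)] spX[OF sub(2)]
    note S = meas[OF sets_interval sub(1)] spX[OF sub(1)]
    have "integral\<^sup>L (vec_measure ?M) (slab_high s U i \<Delta>) = measure (?M i) (?K \<inter> space (?M i)) * ?c"
    proof (rule integral_slab[OF int[OF st(2)] _ \<Delta>(3)])
      show "?K \<inter> space (?M i) \<in> sets (?M i)" unfolding K(3) by (rule K(1))
    qed (simp add: slab_high_def)
    moreover have "integral\<^sup>L (vec_measure ?M) (slab_low s' s i \<Delta>) =
        measure (?M i) ({s'..<s} \<inter> space (?M i)) * ?c"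
    proof (rule integral_slab[OF int[OF st(1)] _ \<Delta>(3)])
      show "{s'..<s} \<inter> space (?M i) \<in> sets (?M i)" unfolding S(3) by (rule S(1))
    qed (simp add: slab_low_def)
    ultimately show ?thesis
      using that[of "?c / ?v"] ab unfolding cube_mean_def cube_measure_prod[OF ne] K S by auto
  next
    case False
    have zero: "slab_high s U i \<Delta> q = 0" if "q \<in> space (vec_measure ?M)" for q
    proof (rule ccontr)
      assume "slab_high s U i \<Delta> q \<noteq> 0"
      then have q: "s \<le> q $ i" "\<And>u. u \<in> U \<Longrightarrow> q $ i < u" by (auto simp: slab_high_def split: if_splits)
      have qJ: "q $ i \<in> J i" using that by (simp add: space_vec_measure)
      from Ji show False
      proof (elim disjE exE conjE)
        fix a b assume ab: "a < b" "J i = {a..<b}" "a \<in> T" "b \<in> T"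
        then have "a \<le> q $ i" "q $ i < b" using qJ by auto
        then have "a \<notin> U" "\<not> b \<le> s'" using q(1) q(2)[of a] s by auto
        then show False using T[OF ab(3)] T[OF ab(4)] False ab by blast
      next
        fix x assume x: "J i = {x}" "x \<in> T"
        then have "x = q $ i" using qJ by simp
        then show False using T[OF x(2)] q(1) q(2)[of x] s by auto
      qed
    qed
    have "integral\<^sup>L (vec_measure ?M) (slab_high s U i \<Delta>) = integral\<^sup>L (vec_measure ?M) (\<lambda>_. 0)"
      by (intro Bochner_Integration.integral_cong refl) (simp add: zero)
    then have "cube_mean (prod_cube J) (slab_high s U i \<Delta>) = 0"
      by (simp add: cube_mean_def cube_measure_prod[OF ne])
    then show ?thesis using that[of 0] low0 by simp
  qed
qed

section \<open>Stability conditions from grid functions\<close>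

text \<open>
  Some sides of an empty grid may be infinite, so its set of thresholds is empty by decree.
\<close>

definition grid_thresholds :: "('a::index_coord, 'n::finite) grid_fun \<Rightarrow> ('n \<times> 'a) set" where
  "grid_thresholds G = (if grid_dom G = {} then {} else {(i, grid_coord G i m) | i m. m \<in> grid_sides G i})"

text \<open>
  The cube of a point is bounded only if all coordinates of the point are in range.
\<close>

definition in_range :: "('a::index_coord, 'n::finite) grid_fun \<Rightarrow> 'n \<Rightarrow> 'a \<Rightarrow> bool" where
  "in_range G i y \<longleftrightarrow> (\<exists>l u. (i, l) \<in> grid_thresholds G \<and> (i, u) \<in> grid_thresholds G \<and> l \<le> y \<and> y < u)"

lemma grid_dom_iff: "p \<in> grid_dom G \<longleftrightarrow> (\<forall>i. p $ i \<in> grid_sides G i)"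
  by (simp add: grid_dom_def prod_cube_def)

lemma grid_app_le_iff: "grid_app G p \<le> q \<longleftrightarrow> (\<forall>i. grid_coord G i (p $ i) \<le> q $ i)"
  by (simp add: grid_app_def less_eq_vec_def)

lemma grid_thresholds_mem: "p \<in> grid_dom G \<Longrightarrow> (i, grid_coord G i (p $ i)) \<in> grid_thresholds G"
proof -
  assume p: "p \<in> grid_dom G"
  then have "grid_dom G \<noteq> {}" "p $ i \<in> grid_sides G i" using grid_dom_iff[of p G] by blast+
  then show ?thesis by (auto simp: grid_thresholds_def)
qed

lemma grid_thresholdsE:
  assumes "(i, x) \<in> grid_thresholds G" obtains p where "p \<in> grid_dom G" "x = grid_coord G i (p $ i)"
proof -
  have ne: "grid_dom G \<noteq> {}" using assms by (auto simp: grid_thresholds_def split: if_splits)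
  then obtain p where p: "p \<in> grid_dom G" by blast
  obtain m where m: "m \<in> grid_sides G i" "x = grid_coord G i m"
    using assms ne by (auto simp: grid_thresholds_def)
  have "upd p i m \<in> grid_dom G" using p m by (auto simp: grid_dom_iff)
  then show ?thesis using that[of "upd p i m"] m by simp
qed

lemma finite_grid_thresholds:
  assumes "finite (grid_dom G)" shows "finite (grid_thresholds G)"
proof -
  have "grid_thresholds G \<subseteq> (\<lambda>(i, p). (i, grid_coord G i (p $ i))) ` (UNIV \<times> grid_dom G)"
  proof
    fix z assume "z \<in> grid_thresholds G"
    then obtain i x where z: "z = (i, x)" "(i, x) \<in> grid_thresholds G" by (cases z) auto
    then obtain p where "p \<in> grid_dom G" "x = grid_coord G i (p $ i)" using grid_thresholdsE by blast
    then show "z \<in> (\<lambda>(i, p). (i, grid_coord G i (p $ i))) ` (UNIV \<times> grid_dom G)" using z by auto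
  qed
  then show ?thesis by (rule finite_subset) (use assms in simp)
qed

lemma grid_floor_key:
  assumes "key (grid_thresholds G) q = key (grid_thresholds G) q'" shows "grid_floor G q = grid_floor G q'"
proof -
  have "grid_app G p \<le> q \<longleftrightarrow> grid_app G p \<le> q'" if "p \<in> grid_dom G" for p
    unfolding grid_app_le_iff using key_eqD[OF assms grid_thresholds_mem[OF that]] by blast
  then have "(p \<in> grid_dom G \<and> grid_app G p \<le> q) \<longleftrightarrow> (p \<in> grid_dom G \<and> grid_app G p \<le> q')" for p
    by blast
  then show ?thesis unfolding grid_floor_def Bex_def by simp
qed

lemma grid_floor_mem:
  assumes G: "finite_grid G" and p: "grid_floor G q = Some p" shows "p \<in> grid_dom G"
proof -
  have ex: "\<exists>p\<in>grid_dom G. grid_app G p \<le> q" using p by (auto simp: grid_floor_def split: if_splits)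
  then obtain p0 where p0: "p0 \<in> grid_dom G" "grid_app G p0 \<le> q" by blast
  let ?S = "\<lambda>i. {m \<in> grid_sides G i. grid_coord G i m \<le> q $ i}"
  have fin: "finite (?S i)" for i
  proof -
    have "?S i \<subseteq> (\<lambda>p. p $ i) ` grid_dom G"
    proof
      fix m assume "m \<in> ?S i"
      then have "upd p0 i m \<in> grid_dom G" using p0 by (auto simp: grid_dom_iff)
      moreover have "m = upd p0 i m $ i" by simp
      ultimately show "m \<in> (\<lambda>p. p $ i) ` grid_dom G" by blast
    qed
    then show ?thesis by (rule finite_subset) (use G in \<open>simp add: finite_grid_def\<close>)
  qed
  have ne: "p0 $ i \<in> ?S i" for i using p0 by (auto simp: grid_dom_iff grid_app_le_iff)
  define M where "M = (\<chi> i. Max (?S i))"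
  have Mi: "M $ i \<in> ?S i" for i using Max_in[OF fin, of i] ne by (auto simp: M_def)
  have "(GREATEST p. p \<in> grid_dom G \<and> grid_app G p \<le> q) = M"
  proof (rule Greatest_equality)
    show "M \<in> grid_dom G \<and> grid_app G M \<le> q" using Mi by (simp add: grid_dom_iff grid_app_le_iff)
    show "y \<le> M" if "y \<in> grid_dom G \<and> grid_app G y \<le> q" for y
    proof -
      have "y $ i \<in> ?S i" for i using that by (simp add: grid_dom_iff grid_app_le_iff)
      then show ?thesis using Max_ge[OF fin] by (simp add: M_def less_eq_vec_def)
    qed
  qed
  then show ?thesis using p ex Mi by (auto simp: grid_floor_def grid_dom_iff)
qed

text \<open>
  A coordinate beyond the range of \<open>G\<close> can be increased, and one below the range can be decreased together
  with all others, without changing the value of the floor.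
\<close>

lemma unbounded_cub:
  fixes G :: "('a::measured_coord, 'n::finite) grid_fun"
  assumes "\<not> in_range G i (q $ i)" shows "\<not> bounded_cube (cub G (grid_floor G q))"
proof (cases "\<exists>l. (i, l) \<in> grid_thresholds G \<and> l \<le> q $ i")
  case True
  have all: "u \<le> q $ i" if "(i, u) \<in> grid_thresholds G" for u
    using True assms that unfolding in_range_def by (meson leI)
  have up: "upd q i y \<in> cub G (grid_floor G q)" if y: "q $ i \<le> y" for y
  proof -
    have "key (grid_thresholds G) (upd q i y) = key (grid_thresholds G) q"
      unfolding key_eq_iff
    proof clarify
      fix j t assume "(j, t) \<in> grid_thresholds G"
      then show "t \<le> upd q i y $ j \<longleftrightarrow> t \<le> q $ j"
        using all[of t] y by (cases "j = i") (auto intro: order_trans)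
    qed
    then show ?thesis using grid_floor_key by (auto simp: cub_def)
  qed
  have "\<not> bdd_above (cub G (grid_floor G q))"
  proof
    assume "bdd_above (cub G (grid_floor G q))"
    then obtain b where b: "\<And>x. x \<in> cub G (grid_floor G q) \<Longrightarrow> x \<le> b" by (auto simp: bdd_above_def)
    have "upd q i (max (q $ i) (b $ i + 1)) \<le> b" using b[OF up] by simp
    then have "max (q $ i) (b $ i + 1) \<le> b $ i" unfolding less_eq_vec_def by (metis upd_nth)
    then show False by simp
  qed
  then show ?thesis by (simp add: bounded_cube_def)
next
  case False
  have none: "grid_floor G x = None" if "x \<le> q" for x
  proof -
    have "\<not> grid_app G p \<le> x" if "p \<in> grid_dom G" for p
    proof
      assume "grid_app G p \<le> x"
      then have "grid_app G p \<le> q" using \<open>x \<le> q\<close> by (rule order_trans)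
      then have "grid_coord G i (p $ i) \<le> q $ i" by (simp add: grid_app_le_iff)
      then show False using False grid_thresholds_mem[OF that, of i] by blast
    qed
    then show ?thesis by (auto simp: grid_floor_def)
  qed
  have "\<not> bdd_below (cub G (grid_floor G q))"
  proof
    assume "bdd_below (cub G (grid_floor G q))"
    then obtain b where b: "\<And>x. x \<in> cub G (grid_floor G q) \<Longrightarrow> b \<le> x" by (auto simp: bdd_below_def)
    define x where "x = (\<chi> j. min (q $ j) (b $ j - 1))"
    have "x \<le> q" by (simp add: x_def less_eq_vec_def)
    then have "x \<in> cub G (grid_floor G q)" using none by (simp add: cub_def)
    then have "b \<le> x" using b by blast
    then have "b $ i \<le> min (q $ i) (b $ i - 1)" by (auto simp: x_def less_eq_vec_def)
    then show False by simp
  qed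
  then show ?thesis by (simp add: bounded_cube_def)
qed

text \<open>
  Moving coordinate \<open>i\<close> of a grid point of \<open>G\<close> to \<open>x\<close> gives a grid point of \<open>G'\<close>. It stays in the convex cube \<open>c\<close>
  which cuts out \<open>G\<close>, so it belongs to \<open>G\<close>. Thus \<open>G'\<close> does not refine \<open>G\<close> within its range.
\<close>

lemma extension_thresholds:
  assumes E: "extension G G'" and l: "(i, l) \<in> grid_thresholds G" and u: "(i, u) \<in> grid_thresholds G"
    and x: "(i, x) \<in> grid_thresholds G'" and le: "l \<le> x" "x \<le> u"
  shows "(i, x) \<in> grid_thresholds G"
proof -
  obtain g where g0: "g ` grid_dom G \<subseteq> grid_dom G' \<and> (\<forall>p\<in>grid_dom G. grid_app G p = grid_app G' (g p))"
    using E unfolding extension_def refinement_def by (elim conjE exE) (rule that, intro conjI)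
  note g = g0[THEN conjunct1] g0[THEN conjunct2, rule_format]
  obtain c where c: "is_cube c" "grid_app G ` grid_dom G = grid_app G' ` grid_dom G' \<inter> c"
    using E unfolding extension_def by (elim conjE exE) (rule that)
  obtain J where J: "\<And>i. ord_convex (J i)" "c = prod_cube J" using c(1) unfolding is_cube_def by blast
  obtain pl where pl: "pl \<in> grid_dom G" "l = grid_coord G i (pl $ i)" using grid_thresholdsE[OF l] .
  obtain pu where pu: "pu \<in> grid_dom G" "u = grid_coord G i (pu $ i)" using grid_thresholdsE[OF u] .
  obtain px where px: "px \<in> grid_dom G'" "x = grid_coord G' i (px $ i)" using grid_thresholdsE[OF x] .
  have "grid_app G pl \<in> c" "grid_app G pu \<in> c" using c(2) pl pu by blast+
  then have Jl: "grid_app G pl $ j \<in> J j" and Ju: "grid_app G pu $ j \<in> J j" for j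
    by (auto simp: J(2) prod_cube_def)
  define p' where "p' = upd (g pl) i (px $ i)"
  have "g pl \<in> grid_dom G'" using g(1) pl(1) by blast
  then have p': "p' \<in> grid_dom G'"
    using px(1) by (auto simp: p'_def grid_dom_iff)
  have app: "grid_app G' p' = upd (grid_app G pl) i x"
    unfolding g(2)[OF pl(1)] by (auto simp: p'_def grid_app_def upd_def px(2) vec_eq_iff)
  have "l \<in> J i" "u \<in> J i" using Jl[of i] Ju[of i] pl(2) pu(2) by (simp_all add: grid_app_def)
  then have "x \<in> J i" using J(1)[of i, unfolded ord_convex_def] le by blast
  then have "grid_app G' p' \<in> c" using Jl by (auto simp: app J(2) prod_cube_def)
  then have "grid_app G' p' \<in> grid_app G ` grid_dom G" using c(2) p' by blast
  then obtain p where p: "p \<in> grid_dom G" "grid_app G p = upd (grid_app G pl) i x" using app by auto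
  then have "grid_coord G i (p $ i) = x" by (auto simp: grid_app_def vec_eq_iff dest!: spec[of _ i])
  then show ?thesis using grid_thresholds_mem[OF p(1), of i] by simp
qed

text \<open>
  For an extension \<open>G'\<close> the coordinates that are in range only matter up to the thresholds of \<open>G\<close>.
\<close>

lemma extension_floor:
  fixes G G' :: "('a::index_coord, 'n::finite) grid_fun"
  assumes E: "extension G G'"
    and q: "\<And>i. q $ i = q' $ i \<or> in_range G i (q $ i) \<and> in_range G i (q' $ i) \<and>
      (\<forall>t. (i, t) \<in> grid_thresholds G \<longrightarrow> (t \<le> q $ i \<longleftrightarrow> t \<le> q' $ i))"
  shows "grid_floor G' q = grid_floor G' q'"
proof (rule grid_floor_key)
  have imp: "x \<le> b" if x: "(i, x) \<in> grid_thresholds G'" "x \<le> a" and r: "in_range G i a" "in_range G i b"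
    and eq: "\<forall>t. (i, t) \<in> grid_thresholds G \<longrightarrow> (t \<le> a \<longleftrightarrow> t \<le> b)" for i a b x
  proof (rule ccontr)
    assume "\<not> x \<le> b"
    moreover obtain l where l: "(i, l) \<in> grid_thresholds G" "l \<le> b" using r(2) by (auto simp: in_range_def)
    moreover obtain u where u: "(i, u) \<in> grid_thresholds G" "a < u" using r(1) by (auto simp: in_range_def)
    ultimately have "(i, x) \<in> grid_thresholds G" using extension_thresholds[OF E l(1) u(1) x(1)] x(2) by auto
    then show False using eq x(2) \<open>\<not> x \<le> b\<close> by blast
  qed
  show "key (grid_thresholds G') q = key (grid_thresholds G') q'"
    unfolding key_eq_iff
  proof (clarify)
    fix i x assume x: "(i, x) \<in> grid_thresholds G'"
    show "x \<le> q $ i \<longleftrightarrow> x \<le> q' $ i"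
      using q[of i] imp[OF x, of "q $ i" "q' $ i"] imp[OF x, of "q' $ i" "q $ i"] by auto
  qed
qed

text \<open>
  If an end \<open>a i\<close> or \<open>b i\<close> of the cube were not a threshold, then no threshold would separate it from some
  point just below it, and both would lie in the cube or neither would. But \<open>a i\<close> is the smallest coordinate in the
  cube, and \<open>b i\<close> is the smallest one above the cube.
\<close>

lemma face_thresholds:
  fixes G :: "('a::measured_coord, 'n::finite) grid_fun"
  assumes fin: "finite (grid_thresholds G)" and c: "c \<in> faces (cub G x)"
  obtains J a b where "c = prod_cube J" "\<And>i. a i < b i" "\<And>i. J i \<in> {{a i..<b i}, {a i}, {b i}}"
    "\<And>i. (i, a i) \<in> grid_thresholds G" "\<And>i. (i, b i) \<in> grid_thresholds G"
proof -
  obtain J a b where J: "c = prod_cube J" "\<And>i. a i < b i" "cub G x = prod_cube (\<lambda>i. {a i..<b i})"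
    "\<And>i. J i \<in> {{a i..<b i}, {a i}, {b i}}"
    using c unfolding faces_def by blast
  define A where "A = vec_lambda a"
  have A: "A \<in> cub G x" unfolding J(3) using J(2) by (simp add: A_def prod_cube_def)
  have move: "upd A i z \<in> cub G x"
    if y: "upd A i y \<in> cub G x" and t: "\<And>t. (i, t) \<in> grid_thresholds G \<Longrightarrow> t \<le> y \<longleftrightarrow> t \<le> z" for i y z
  proof -
    have "key (grid_thresholds G) (upd A i z) = key (grid_thresholds G) (upd A i y)" unfolding key_eq_iff using t by auto
    then show ?thesis using y grid_floor_key by (auto simp: cub_def)
  qed
  have mem: "upd A i y \<in> cub G x \<longleftrightarrow> a i \<le> y \<and> y < b i" for i y
    unfolding J(3) using J(2) by (auto simp: A_def prod_cube_def dest!: spec[of _ i])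
  have finT: "finite {t. (i, t) \<in> grid_thresholds G \<and> P t}" for i P using finite_thresholds[OF fin] .
  have "(i, a i) \<in> grid_thresholds G" for i
  proof (rule ccontr)
    assume no: "(i, a i) \<notin> grid_thresholds G"
    define S where "S = insert (a i - 1) {t. (i, t) \<in> grid_thresholds G \<and> t < a i}"
    have S: "finite S" "S \<noteq> {}" using finT by (auto simp: S_def)
    define y where "y = Max S"
    have y: "y < a i" using Max_in[OF S] by (auto simp: S_def y_def)
    have "t \<le> a i \<longleftrightarrow> t \<le> y" if "(i, t) \<in> grid_thresholds G" for t
    proof
      assume "t \<le> a i"
      then have "t < a i" using no that by (auto simp: le_less)
      then show "t \<le> y" using Max_ge[OF S(1)] that by (auto simp: S_def y_def)
    qed (use y in auto)
    then have "upd A i y \<in> cub G x" using move[of i "a i" y] mem J(2) by simp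
    then show False using mem y by auto
  qed
  moreover have "(i, b i) \<in> grid_thresholds G" for i
  proof (rule ccontr)
    assume no: "(i, b i) \<notin> grid_thresholds G"
    define S where "S = insert (a i) {t. (i, t) \<in> grid_thresholds G \<and> t < b i}"
    have S: "finite S" "S \<noteq> {}" using finT by (auto simp: S_def)
    define y where "y = Max S"
    have y: "a i \<le> y" "y < b i" using Max_in[OF S] Max_ge[OF S(1)] J(2) by (auto simp: S_def y_def)
    have "t \<le> y \<longleftrightarrow> t \<le> b i" if "(i, t) \<in> grid_thresholds G" for t
    proof
      assume "t \<le> b i"
      then have "t < b i" using no that by (auto simp: le_less)
      then show "t \<le> y" using Max_ge[OF S(1)] that by (auto simp: S_def y_def)
    qed (use y in auto)
    then have "upd A i (b i) \<in> cub G x" using move[of i y "b i"] mem y by simp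
    then show False using mem by auto
  qed
  ultimately show ?thesis using that J by blast
qed

lemma integral_slabs:
  fixes w \<Delta> :: "'a::measured_coord^'n::finite \<Rightarrow> real"
  assumes w: "integrable (cube_measure UNIV) w"
    and \<Delta>: "step_function \<Delta>" "\<And>q x. \<Delta> (upd q i x) = \<Delta> q"
    and const: "\<And>q x. s' \<le> x \<Longrightarrow> (\<forall>u\<in>U. x < u) \<Longrightarrow> w (upd q i x) = w (upd q i s')"
    and s: "s' < s" and U: "finite U" "\<And>u. u \<in> U \<Longrightarrow> s < u"
  obtains K where
    "(\<integral>q. w q * slab_low s' s i \<Delta> q \<partial>cube_measure UNIV) = measure coord_measure {s'..<s} * K"
    "(\<integral>q. w q * slab_high s U i \<Delta> q \<partial>cube_measure UNIV) =
       measure coord_measure {x. s \<le> x \<and> (\<forall>u\<in>U. x < u)} * K"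
proof -
  let ?M = "\<lambda>i::'n. coord_measure :: 'a measure"
  interpret coord_product ?M by (rule full_product)
  define g where "g q = w (upd q i s') * \<Delta> q" for q
  have id: "upd q i (q $ i) = q" for q :: "'a^'n" by (simp add: upd_def vec_eq_iff)
  have uu: "upd (upd q i x) i y = upd q i y" for q :: "'a^'n" and x y by (simp add: upd_def vec_eq_iff)
  have g: "g (upd q i x) = g q" for q x by (simp add: g_def uu \<Delta>(2))
  have wg: "w q * \<Delta> q = g q" if "s' \<le> q $ i" "\<forall>u\<in>U. q $ i < u" for q
    using const[OF that, of q] by (simp add: g_def id)
  note int = integrable_times_step[OF w[unfolded cube_measure_full] step_function_slab(1)[OF \<Delta>(1) U(1)]]
    integrable_times_step[OF w[unfolded cube_measure_full] step_function_slab(2)[OF \<Delta>(1) U(1)]]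
  have "integral\<^sup>L (vec_measure ?M) (\<lambda>q. w q * slab_low s' s i \<Delta> q) =
      measure coord_measure ({s'..<s} \<inter> space coord_measure) *
      (\<integral>x. g (vec_lambda x) \<partial>PiM (UNIV - {i}) ?M)"
  proof (rule integral_slab[OF int(1) _ g])
    show "w q * slab_low s' s i \<Delta> q = (if q $ i \<in> {s'..<s} then g q else 0)" for q
      using wg[of q] U(2) by (auto simp: slab_low_def intro: less_trans)
  qed (simp add: sets_interval)
  moreover have "integral\<^sup>L (vec_measure ?M) (\<lambda>q. w q * slab_high s U i \<Delta> q) =
      measure coord_measure ({x. s \<le> x \<and> (\<forall>u\<in>U. x < u)} \<inter> space coord_measure) *
      (\<integral>x. g (vec_lambda x) \<partial>PiM (UNIV - {i}) ?M)"
  proof (rule integral_slab[OF int(2) _ g])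
    show "w q * slab_high s U i \<Delta> q = (if q $ i \<in> {x. s \<le> x \<and> (\<forall>u\<in>U. x < u)} then g q else 0)" for q
      using wg[of q] order_trans[OF less_imp_le[OF s], of "q $ i"] by (auto simp: slab_high_def)
  qed (simp add: slab_ivl_sets[OF U(1)])
  ultimately show ?thesis
    using that[of "\<integral>x. g (vec_lambda x) \<partial>PiM (UNIV - {i}) ?M"] by (simp add: cube_measure_full)
qed

lemma slab_measure_pos:
  fixes s :: "'a::measured_coord"
  assumes "finite U" "U \<noteq> {}" "\<And>u. u \<in> U \<Longrightarrow> s < u"
  shows "0 < measure coord_measure {x. s \<le> x \<and> (\<forall>u\<in>U. x < u)}"
proof -
  have "{x. s \<le> x \<and> (\<forall>u\<in>U. x < u)} = {s..<Min U}"
    using Min_gr_iff[OF assms(1,2)] by auto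
  moreover have "s < Min U" using assms by simp
  ultimately show ?thesis
    using coord_measure_pos[of s "Min U"] coord_measure_finite[of s "Min U"]
    by (simp add: measure_def enn2real_positive_iff)
qed

context persistence
begin

text \<open>
  Where coordinate \<open>i\<close> is in range, the densities do not vary over the slab, and by Fubini the degrees of the
  two halves are proportional to their widths, up to nonnegative terms from faces. Out of range, the
  imaginary density vanishes, no face covers the upper half of the slab, and the sign of \<open>\<theta>\<close> decides.
\<close>

lemma Z_grid_step_charge:
  fixes G :: "('a::measured_coord, 'n::finite) grid_fun"
    and Z :: "(('a^'n, 'v) pmod \<Rightarrow>\<^sub>0 int) set \<Rightarrow> complex"
  assumes G: "finite_grid G" and Z: "Z \<in> Z_grid G"
  shows "\<exists>R I. step_charge scale Z (grid_thresholds G) R I"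
proof -
  let ?\<F> = "\<Union>{faces (cub G (Some x)) | x. x \<in> grid_dom G \<and> bounded_cube (cub G (Some x))}"
  obtain Z' wt where Zst: "Z \<in> stability_conditions" and Z': "Z' \<in> Z_step G"
    and wt: "\<And>c. 0 \<le> (wt c :: real)"
    and ZV: "\<And>V. V \<in> pers_fp \<Longrightarrow> Z (K_class V) = Z' (K_class V) + \<i> * of_real
        (\<Sum>c\<in>?\<F>. wt c * cube_mean c (\<lambda>q. real (dim (sp V q))))"
    using Z unfolding Z_grid_def by blast
  obtain G' a b where E: "extension G G'" and a: "discretisable G' a" and b: "discretisable G' b"
    and a0: "\<And>x q. x \<in> insert None (Some ` grid_dom G) \<Longrightarrow> \<not> bounded_cube (cub G x) \<Longrightarrow> q \<in> cub G x \<Longrightarrow> a q = 0"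
    and b0: "\<And>q. 0 < b q" and bint: "integrable (cube_measure UNIV) b"
    and Z'V: "\<And>V. V \<in> pers_fp \<Longrightarrow> Z' (K_class V) =
        (\<integral>q. Complex (b q) (a q) * of_nat (dim (sp V q)) \<partial>cube_measure UNIV)"
    using Z' unfolding Z_step_def by blast
  have finA: "finite (grid_thresholds G)" using finite_grid_thresholds G by (auto simp: finite_grid_def)
  have disc: "h q = h q'" if "discretisable G' h" "grid_floor G' q = grid_floor G' q'" for h q q'
    using that unfolding discretisable_def by metis
  have a_out: "a q = 0" if "\<not> in_range G i (q $ i)" for i q
  proof (rule a0)
    show "\<not> bounded_cube (cub G (grid_floor G q))" using unbounded_cub[of G i q] that by blast
    show "q \<in> cub G (grid_floor G q)" by (simp add: cub_def)
    show "grid_floor G q \<in> insert None (Some ` grid_dom G)"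
      using grid_floor_mem[OF G] by (cases "grid_floor G q") auto
  qed
  have in_key: "in_range G i (q $ i) \<longleftrightarrow> in_range G i (q' $ i)" if "key (grid_thresholds G) q = key (grid_thresholds G) q'" for i q q'
    unfolding in_range_def not_le[symmetric] using key_eqD[OF that] by blast
  \<comment> \<open>Although \<open>b\<close> may take infinitely many values, the quotient \<open>a / b\<close> is a step function, hence
      bounded; so integrability of \<open>b\<close> gives that of \<open>a\<close>.\<close>
  have "step_fun (grid_thresholds G) (\<lambda>q. a q / b q)"
    unfolding step_fun_def
  proof (intro allI impI)
    fix q q' assume k: "key (grid_thresholds G) q = key (grid_thresholds G) q'"
    show "a q / b q = a q' / b q'"
    proof (cases "\<forall>i. in_range G i (q $ i)")
      case True
      have "grid_floor G' q = grid_floor G' q'"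
        by (rule extension_floor[OF E]) (use True in_key[OF k] key_eqD[OF k] in blast)
      then show ?thesis using disc[OF a] disc[OF b] by metis
    next
      case False
      then have "a q = 0" "a q' = 0" using a_out in_key[OF k] by blast+
      then show ?thesis by simp
    qed
  qed
  then have quot: "step_function (\<lambda>q. a q / b q)" using step_functionI[OF finA] by blast
  interpret coord_product "\<lambda>i::'n. coord_measure :: 'a measure" by (rule full_product)
  have aint: "integrable (cube_measure UNIV) a"
    using integrable_times_step[OF bint[unfolded cube_measure_full] quot] b0
    by (simp add: cube_measure_full less_imp_neq[symmetric])
  have int: "integrable (cube_measure UNIV) (\<lambda>q. a q * h q)" "integrable (cube_measure UNIV) (\<lambda>q. b q * h q)"
    if "step_function h" for h
    using integrable_times_step[OF aint[unfolded cube_measure_full] that]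
      integrable_times_step[OF bint[unfolded cube_measure_full] that] by (simp_all add: cube_measure_full)
  define R where "R h = (\<integral>q. b q * h q \<partial>cube_measure UNIV)" for h
  define I0 where "I0 h = (\<integral>q. a q * h q \<partial>cube_measure UNIV)" for h
  define I where "I h = I0 h + (\<Sum>c\<in>?\<F>. wt c * cube_mean c h)" for h
  have R_add: "R (\<lambda>q. h q + h' q) = R h + R h'" and I0_add: "I0 (\<lambda>q. h q + h' q) = I0 h + I0 h'"
    if "step_function h" "step_function h'" for h h'
    using int[OF that(1)] int[OF that(2)] by (simp_all add: R_def I0_def distrib_left)
  have face: "\<exists>J. c = prod_cube J \<and> (\<forall>i. face_side (J i)) \<and>
      (\<forall>i. (\<exists>a b. a < b \<and> J i = {a..<b} \<and> (i, a) \<in> grid_thresholds G \<and> (i, b) \<in> grid_thresholds G) \<or>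
            (\<exists>t. J i = {t} \<and> (i, t) \<in> grid_thresholds G))" if mem: "c \<in> ?\<F>" for c
  proof -
    obtain x where "c \<in> faces (cub G x)" using mem by blast
    then obtain J a b where J: "c = prod_cube J" "\<And>i. a i < b i" "\<And>i. J i \<in> {{a i..<b i}, {a i}, {b i}}"
      "\<And>i. (i, a i) \<in> grid_thresholds G" "\<And>i. (i, b i) \<in> grid_thresholds G" using face_thresholds[OF finA] by metis
    have Ji: "(\<exists>a b. a < b \<and> J i = {a..<b} \<and> (i, a) \<in> grid_thresholds G \<and> (i, b) \<in> grid_thresholds G) \<or>
            (\<exists>t. J i = {t} \<and> (i, t) \<in> grid_thresholds G)" for i
      using J(2)[of i] J(3)[of i] J(4)[of i] J(5)[of i] by auto
    moreover have "face_side (J i)" for i unfolding face_side_def using Ji[of i] by blast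
    ultimately show ?thesis using J(1) by blast
  qed
  have I_add: "I (\<lambda>q. h q + h' q) = I h + I h'" if h: "step_function h" "step_function h'" for h h'
  proof -
    have "cube_mean c (\<lambda>q. h q + h' q) = cube_mean c h + cube_mean c h'" if mem: "c \<in> ?\<F>" for c
    proof -
      obtain J where "c = prod_cube J" "\<forall>i. face_side (J i)" using face[OF mem] by blast
      then show ?thesis using cube_mean_add[of J, OF _ h] by simp
    qed
    then have "(\<Sum>c\<in>?\<F>. wt c * cube_mean c (\<lambda>q. h q + h' q)) =
        (\<Sum>c\<in>?\<F>. wt c * cube_mean c h + wt c * cube_mean c h')"
      by (intro sum.cong refl) (simp add: distrib_left)
    then show ?thesis using I0_add[OF h] by (simp add: I_def sum.distrib)
  qed
  have charge: "Z (K_class V) = Complex (R (dimfun (sp V))) (I (dimfun (sp V)))" if V: "V \<in> pers_fp" for V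
  proof -
    obtain B where B: "tame B V" using V pers_fp_iff_tame by blast
    have st: "step_function (dimfun (sp V))" using step_functionI[OF tame_finite[OF B] dimfun_step[OF B]] .
    let ?d = "dimfun (sp V)"
    have "Complex (b q) (a q) * of_nat (dim (sp V q)) = of_real (b q * ?d q) + \<i> * of_real (a q * ?d q)" for q
      by (simp add: complex_eq_iff dimfun_def)
    then have "Z' (K_class V) = (\<integral>q. of_real (b q * ?d q) + \<i> * of_real (a q * ?d q) \<partial>cube_measure UNIV)"
      using Z'V[OF V] by simp
    also have "\<dots> = (\<integral>q. of_real (b q * ?d q) \<partial>cube_measure UNIV) + (\<integral>q. \<i> * of_real (a q * ?d q) \<partial>cube_measure UNIV)"
      using int[OF st] by (intro Bochner_Integration.integral_add integrable_mult_right integrable_of_real)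
    also have "\<dots> = of_real (R ?d) + \<i> * of_real (I0 ?d)"
      by (simp only: R_def I0_def integral_mult_right_zero integral_complex_of_real)
    finally show ?thesis
      using ZV[OF V] by (simp add: I_def complex_eq_iff dimfun_def)
  qed
  have pos: "0 < R (dimfun (sp V))" if "V \<in> pers_fp" "\<not> zero_pmod V" for V
  proof -
    have "0 < Re (Z (K_class V))"
      using Zst[unfolded stability_conditions_def, THEN CollectD, THEN conjunct2] that by blast
    then show ?thesis using charge[OF that(1)] by simp
  qed
  have slab: "0 \<le> I (slab_low s' s i \<Delta>) - \<theta> * R (slab_low s' s i \<Delta>) \<or>
      I (slab_high s U i \<Delta>) - \<theta> * R (slab_high s U i \<Delta>) < 0 \<or>
      0 < \<theta> \<and> I (slab_high s U i \<Delta>) = 0"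
    if \<Delta>: "step_function \<Delta>" "\<And>q. 0 \<le> \<Delta> q" "\<And>q x. \<Delta> (upd q i x) = \<Delta> q"
      and s: "s' < s" and U: "finite U" "\<And>u. u \<in> U \<Longrightarrow> s < u"
      and T: "\<And>t. (i, t) \<in> grid_thresholds G \<Longrightarrow> t \<le> s' \<or> t \<in> U" for \<Delta> s' s i U \<theta>
  proof -
    let ?h\<^sub>1 = "slab_low s' s i \<Delta>" and ?h\<^sub>2 = "slab_high s U i \<Delta>"
    let ?m\<^sub>1 = "measure coord_measure {s'..<s}"
    let ?m\<^sub>2 = "measure coord_measure {x. s \<le> x \<and> (\<forall>u\<in>U. x < u)}"
    let ?in = "\<exists>l u. (i, l) \<in> grid_thresholds G \<and> (i, u) \<in> grid_thresholds G \<and> l \<le> s' \<and> u \<in> U"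
    have ex: "\<exists>E. cube_mean c ?h\<^sub>2 = ?m\<^sub>2 * E \<and> ?m\<^sub>1 * E \<le> cube_mean c ?h\<^sub>1 \<and> (E \<noteq> 0 \<longrightarrow> ?in)"
      if mem: "c \<in> ?\<F>" for c
    proof -
      obtain J where c: "c = prod_cube J" and J: "\<And>i. face_side (J i)"
        and Ji: "(\<exists>a b. a < b \<and> J i = {a..<b} \<and> (i, a) \<in> grid_thresholds G \<and> (i, b) \<in> grid_thresholds G) \<or>
            (\<exists>t. J i = {t} \<and> (i, t) \<in> grid_thresholds G)"
        using face[OF mem] by blast
      obtain E where "cube_mean (prod_cube J) ?h\<^sub>2 = ?m\<^sub>2 * E" "?m\<^sub>1 * E \<le> cube_mean (prod_cube J) ?h\<^sub>1"
        "E \<noteq> 0 \<Longrightarrow> \<exists>a b. a \<in> {t. (i, t) \<in> grid_thresholds G} \<and> b \<in> {t. (i, t) \<in> grid_thresholds G} \<and> a \<le> s' \<and> b \<in> U"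
        by (rule cube_mean_slab[OF J \<Delta> s U, of "{t. (i, t) \<in> grid_thresholds G}"]) (use T Ji in auto)
      then show ?thesis unfolding c by (intro exI[of _ E]) auto
    qed
    define E where "E c = (SOME E. cube_mean c ?h\<^sub>2 = ?m\<^sub>2 * E \<and> ?m\<^sub>1 * E \<le> cube_mean c ?h\<^sub>1 \<and> (E \<noteq> 0 \<longrightarrow> ?in))"
      for c
    have Ec: "cube_mean c ?h\<^sub>2 = ?m\<^sub>2 * E c \<and> ?m\<^sub>1 * E c \<le> cube_mean c ?h\<^sub>1 \<and> (E c \<noteq> 0 \<longrightarrow> ?in)"
      if "c \<in> ?\<F>" for c
      unfolding E_def by (rule someI_ex) (rule ex[OF that])
    note E2 = Ec[THEN conjunct1] and E1 = Ec[THEN conjunct2, THEN conjunct1]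
      and E0 = Ec[THEN conjunct2, THEN conjunct2, rule_format]
    define X where "X = (\<Sum>c\<in>?\<F>. wt c * E c)"
    have sum2: "(\<Sum>c\<in>?\<F>. wt c * cube_mean c ?h\<^sub>2) = ?m\<^sub>2 * X"
      unfolding X_def sum_distrib_left by (intro sum.cong refl) (simp add: E2)
    have sum1: "?m\<^sub>1 * X \<le> (\<Sum>c\<in>?\<F>. wt c * cube_mean c ?h\<^sub>1)"
      unfolding X_def sum_distrib_left
    proof (intro sum_mono)
      fix c assume "c \<in> ?\<F>"
      then show "?m\<^sub>1 * (wt c * E c) \<le> wt c * cube_mean c ?h\<^sub>1"
        using mult_left_mono[OF E1 wt, of c c] by (simp add: mult_ac)
    qed
    show ?thesis
    proof (cases ?in)
      case True
      then obtain l u where lu: "(i, l) \<in> grid_thresholds G" "(i, u) \<in> grid_thresholds G" "l \<le> s'" "u \<in> U" by blast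
      have fl: "grid_floor G' (upd q i x) = grid_floor G' (upd q i s')"
        if x: "s' \<le> x" "\<forall>u\<in>U. x < u" for q x
      proof (rule extension_floor[OF E])
        have "in_range G i x" "in_range G i s'"
          unfolding in_range_def using lu x s U(2)[OF lu(4)] by (meson less_trans order_trans)+
        moreover have "t \<le> x \<longleftrightarrow> t \<le> s'" if "(i, t) \<in> grid_thresholds G" for t
          using T[OF that] x s U(2)[of t] by (auto intro: order_trans)
        ultimately show "upd q i x $ j = upd q i s' $ j \<or>
            in_range G j (upd q i x $ j) \<and> in_range G j (upd q i s' $ j) \<and>
            (\<forall>t. (j, t) \<in> grid_thresholds G \<longrightarrow> (t \<le> upd q i x $ j \<longleftrightarrow> t \<le> upd q i s' $ j))" for j
          by auto
      qed
      obtain Ka where Ka: "I0 ?h\<^sub>1 = ?m\<^sub>1 * Ka" "I0 ?h\<^sub>2 = ?m\<^sub>2 * Ka"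
        unfolding I0_def
        by (rule integral_slabs[OF aint \<Delta>(1,3) _ s U]) (use disc[OF a fl] in auto)
      obtain Kb where Kb: "R ?h\<^sub>1 = ?m\<^sub>1 * Kb" "R ?h\<^sub>2 = ?m\<^sub>2 * Kb"
        unfolding R_def
        by (rule integral_slabs[OF bint \<Delta>(1,3) _ s U]) (use disc[OF b fl] in auto)
      let ?Y = "Ka + X - \<theta> * Kb"
      have m2: "0 < ?m\<^sub>2" using slab_measure_pos[OF U(1) _ U(2)] lu(4) by blast
      have "I ?h\<^sub>2 - \<theta> * R ?h\<^sub>2 = ?m\<^sub>2 * ?Y"
        unfolding I_def Ka Kb sum2 by (simp add: algebra_simps)
      moreover have "?m\<^sub>1 * ?Y \<le> I ?h\<^sub>1 - \<theta> * R ?h\<^sub>1"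
        unfolding I_def Ka Kb using sum1 by (simp add: algebra_simps)
      moreover have "0 \<le> ?Y \<Longrightarrow> 0 \<le> ?m\<^sub>1 * ?Y" by simp
      moreover have "?Y < 0 \<Longrightarrow> ?m\<^sub>2 * ?Y < 0" using m2 by (simp add: mult_pos_neg)
      ultimately show ?thesis by linarith
    next
      case False
      have out: "\<not> in_range G i y" if "s' \<le> y" "\<forall>u\<in>U. y < u" for y
      proof
        assume "in_range G i y"
        then obtain l u where lu: "(i, l) \<in> grid_thresholds G" "(i, u) \<in> grid_thresholds G" "l \<le> y" "y < u"
          by (auto simp: in_range_def)
        then have "l \<le> s'" "u \<in> U" using T[OF lu(1)] T[OF lu(2)] that by auto
        then show False using False lu by blast
      qed
      have a1: "a q * ?h\<^sub>1 q = 0" for q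
        using a_out[OF out[of "q $ i"]] U(2) by (auto simp: slab_low_def intro: less_trans)
      have a2: "a q * ?h\<^sub>2 q = 0" for q
        using a_out[OF out[of "q $ i"]] s by (auto simp: slab_high_def)
      have "I0 ?h\<^sub>1 = 0" "I0 ?h\<^sub>2 = 0" unfolding I0_def a1 a2 by simp_all
      moreover have "X = 0" unfolding X_def using E0 False by (intro sum.neutral) auto
      ultimately have I: "0 \<le> I ?h\<^sub>1" "I ?h\<^sub>2 = 0" using sum1 sum2 by (simp_all add: I_def)
      have "0 \<le> R ?h\<^sub>1"
        unfolding R_def using less_imp_le[OF b0] \<Delta>(2)
        by (intro Bochner_Integration.integral_nonneg) (simp add: slab_low_def)
      then have "\<theta> \<le> 0 \<Longrightarrow> \<theta> * R ?h\<^sub>1 \<le> 0" by (simp add: mult_nonpos_nonneg)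
      then show ?thesis using I by linarith
    qed
  qed
  have "step_charge scale Z (grid_thresholds G) R I"
    by (unfold_locales) (fact finA charge pos R_add I_add slab)+
  then show ?thesis by blast
qed

theorem Z_all_landscape_stable:
  fixes V W :: "('a::measured_coord^'n::finite, 'v) pmod"
  assumes "Z \<in> Z_all" "V \<in> pers_fp" "W \<in> pers_fp"
  shows "(SUP \<theta>. landscape_distance (landscape (HN_rank Z \<theta> V)) (landscape (HN_rank Z \<theta> W)))
      \<le> interleaving_distance V W"
proof -
  obtain G where "finite_grid G" "Z \<in> Z_grid G" using assms(1) unfolding Z_all_def by blast
  then obtain R I where "step_charge scale Z (grid_thresholds G) R I" using Z_grid_step_charge by blast
  then interpret step_charge scale Z "grid_thresholds G" R I .
  show ?thesis using HN_landscape_stable[OF assms(2,3)] .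
qed

end

theorem corollary3p12:
  fixes scale :: "'k::field \<Rightarrow> 'v::ab_group_add \<Rightarrow> 'v"
  assumes "persistence scale"
  shows "(\<forall>Z \<in> persistence.Z_all scale.
          \<forall>V \<in> (persistence.pers_fp scale :: (real^'n, 'v) pmod set).
          \<forall>W \<in> persistence.pers_fp scale.
            (SUP \<theta>. landscape_distance (landscape (persistence.HN_rank scale Z \<theta> V))
                                       (landscape (persistence.HN_rank scale Z \<theta> W)))
              \<le> persistence.interleaving_distance scale V W) \<and>
         (\<forall>Z \<in> persistence.Z_all scale.
          \<forall>V \<in> (persistence.pers_fp scale :: (int^'n, 'v) pmod set).
          \<forall>W \<in> persistence.pers_fp scale.
            (SUP \<theta>. landscape_distance (landscape (persistence.HN_rank scale Z \<theta> V))
                                       (landscape (persistence.HN_rank scale Z \<theta> W)))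
              \<le> persistence.interleaving_distance scale V W)"
  by (intro conjI ballI; rule persistence.Z_all_landscape_stable[OF assms]; assumption)

end
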